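(* Let $T>0$ and $a\in(0,T)$, and let $p,\tilde p\in AC[0,T]$ and $q,\tilde q\in L(0,T)$ be complex-valued with $\int_0^T p(x)\,dx=\int_0^T\tilde p(x)\,dx$. Let $\Lambda'_0$, $\Lambda'_1$, $\Lambda'_2$ be the spectra of the boundary value problems for the equation $$y''(x)+[\lambda^2-2\lambda p(x)-q(x)]y(x)=0$$ with the conditions $y(0)=y(a)=0$, $\ y(0)=y(T)=0$, and $y(a)=y(T)=0$, respectively, and let $\tilde\Lambda'_0,\tilde\Lambda'_1,\tilde\Lambda'_2$ be the corresponding spectra for $(\tilde p,\tilde q)$. Suppose that $\Lambda'_0\cap\Lambda'_1=\emptyset$. If $\Lambda'_j=\tilde\Lambda'_j$ for $j=0,1,2$ (counting multiplicities), then $p(x)=\tilde p(x)$ for all $x\in(0,T)$ and $q(x)=\tilde q(x)$ for almost every $x\in(0,T)$.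
   Context: $AC[0,T]$ is the set of absolutely continuous functions on $[0,T]$ and $L(0,T)$ the set of Lebesgue integrable functions on $(0,T)$. Solutions of $$y''(x)+[\lambda^2-2\lambda p(x)-q(x)]y(x)=0,\quad x\in(0,T),\qquad ( * )$$ have $y,y'$ absolutely continuous on $[0,T]$ and satisfy $( * )$ almost everywhere. The spectrum of the problem given by $( * )$ and $y(b)=y(c)=0$, $0\le b<c\le T$, is the collection of zeros $\lambda\in\mathbb{C}$, counted with multiplicities, of the entire characteristic function $X_1(b,\lambda)X_2(c,\lambda)-X_2(b,\lambda)X_1(c,\lambda)$, where $X_1,X_2$ are the solutions of $( * )$ with $X_1(0,\lambda)=X_2'(0,\lambda)=1$, $X_1'(0,\lambda)=X_2(0,\lambda)=0$. Objects with a tilde are defined in the same way with $(\tilde p,\tilde q)$ in place of $(p,q)$. *)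

theory Defs
  imports "HOL-Complex_Analysis.Complex_Analysis"
begin

text \<open>
  Absolute continuity on an interval \<open>I\<close>. The distribution's \<^const>\<open>absolutely_continuous\<close> is the
  unrelated notion for measures.
\<close>

definition abs_continuous_on :: "real set \<Rightarrow> (real \<Rightarrow> complex) \<Rightarrow> bool" where
  "abs_continuous_on I f \<longleftrightarrow>
     (\<forall>\<epsilon>>0. \<exists>\<delta>>0. \<forall>(n::nat) u v.
        (\<forall>i<n. u i \<le> v i \<and> {u i..v i} \<subseteq> I) \<and>
        disjoint_family_on (\<lambda>i. {u i<..<v i}) {..<n} \<and>
        (\<Sum>i<n. v i - u i) < \<delta> \<longrightarrow>
        (\<Sum>i<n. norm (f (v i) - f (u i))) < \<epsilon>)"

text \<open>
  The derivative relative to \<open>[0,T]\<close>, which is one-sided at the end points.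
\<close>

definition deriv_on :: "real \<Rightarrow> (real \<Rightarrow> complex) \<Rightarrow> real \<Rightarrow> complex" where
  "deriv_on T y x = vector_derivative y (at x within {0..T})"

definition pencil_solution ::
  "real \<Rightarrow> (real \<Rightarrow> complex) \<Rightarrow> (real \<Rightarrow> complex) \<Rightarrow> complex \<Rightarrow> (real \<Rightarrow> complex) \<Rightarrow> bool" where
  "pencil_solution T p q \<mu> y \<longleftrightarrow>
     abs_continuous_on {0..T} y \<and>
     y differentiable_on {0..T} \<and>
     abs_continuous_on {0..T} (deriv_on T y) \<and>
     (AE x in lebesgue. x \<in> {0<..<T} \<longrightarrow>
        (\<exists>d. (deriv_on T y has_vector_derivative d) (at x) \<and>
             d + (\<mu>\<^sup>2 - 2 * \<mu> * p x - q x) * y x = 0))"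

text \<open>
  With \<open>\<mu>\<close> the spectral parameter, the solution with Cauchy data \<open>y(0) = \<alpha>\<close>, \<open>y'(0) = \<beta>\<close>.
  It is determined on \<open>[0,T]\<close> only; \<^const>\<open>extensional\<close> fixes the irrelevant values elsewhere, so
  that the description is unique.
\<close>

definition cauchy_solution ::
  "real \<Rightarrow> (real \<Rightarrow> complex) \<Rightarrow> (real \<Rightarrow> complex) \<Rightarrow> complex \<Rightarrow> complex \<Rightarrow> real \<Rightarrow> complex \<Rightarrow> complex" where
  "cauchy_solution T p q \<alpha> \<beta> x \<mu> =
     (THE y. pencil_solution T p q \<mu> y \<and> y 0 = \<alpha> \<and> deriv_on T y 0 = \<beta> \<and>
             y \<in> extensional {0..T}) x"

abbreviation X1 where "X1 T p q \<equiv> cauchy_solution T p q 1 0"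
abbreviation X2 where "X2 T p q \<equiv> cauchy_solution T p q 0 1"

definition char_fun ::
  "real \<Rightarrow> (real \<Rightarrow> complex) \<Rightarrow> (real \<Rightarrow> complex) \<Rightarrow> real \<Rightarrow> real \<Rightarrow> complex \<Rightarrow> complex" where
  "char_fun T p q b c \<mu> =
     X1 T p q b \<mu> * X2 T p q c \<mu> - X2 T p q b \<mu> * X1 T p q c \<mu>"

text \<open>
  The spectrum for \<open>y(b) = y(c) = 0\<close>, as a plain set and as a collection with multiplicities. The
  latter is infinite, hence not a \<^typ>\<open>complex multiset\<close>; each zero is paired with its order.
\<close>

definition dirichlet_spectrum ::
  "real \<Rightarrow> (real \<Rightarrow> complex) \<Rightarrow> (real \<Rightarrow> complex) \<Rightarrow> real \<Rightarrow> real \<Rightarrow> complex set" where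
  "dirichlet_spectrum T p q b c = {\<mu>. char_fun T p q b c \<mu> = 0}"

definition counted_spectrum ::
  "real \<Rightarrow> (real \<Rightarrow> complex) \<Rightarrow> (real \<Rightarrow> complex) \<Rightarrow> real \<Rightarrow> real \<Rightarrow> (complex \<times> int) set" where
  "counted_spectrum T p q b c =
     (\<lambda>\<mu>. (\<mu>, zorder (char_fun T p q b c) \<mu>)) ` dirichlet_spectrum T p q b c"

end

theory Submission
  imports Defs
begin

text \<open>
  Let \<open>c\<close> and \<open>s\<close> be the solutions with Cauchy data \<open>(1,0)\<close> and \<open>(0,1)\<close> at \<open>0\<close>, and mark the
  objects that belong to the second pair of coefficients by a prime.

  The three characteristic functions are \<open>D0 = s(a)\<close>, \<open>D1 = s(T)\<close> and
  \<open>D2 = c(a) s(T) - s(a) c(T)\<close>. The last one is again the value of a solution with data \<open>(0,1)\<close>,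
  namely at \<open>T - a\<close> for the equation reflected at the midpoint of \<open>[0,T]\<close>. All three therefore
  behave at infinity like \<open>sin(\<mu> L - P) / \<mu>\<close>, where \<open>L\<close> is the length of the interval in question and
  \<open>P\<close> the integral of \<open>p\<close> over it (\<open>sine_type_asymptotics\<close>). For two functions of this kind with
  the same zeros the quotient is entire, and bounded on the boundaries of large squares, along which
  \<open>|sin z|\<close> is comparable to \<open>exp |Im z|\<close>; hence it is constant, and the two directions of the imaginary axis give the
  constant as \<open>exp(i\<delta>)\<close> and as \<open>exp(-i\<delta>)\<close>, with \<open>\<delta>\<close> the difference of the integrals
  (\<open>sine_type_ratio\<close>). Because the integrals over \<open>[0,T]\<close> agree, \<open>D1 = D1'\<close>, and one number \<open>\<sigma>\<close>
  satisfies \<open>D0 = \<sigma> D0'\<close> and \<open>D2 = \<sigma> D2'\<close>.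

  Substituting these relations into the formula for \<open>D2\<close> shows that \<open>D0'\<close> divides
  \<open>(c(a) - \<sigma> c'(a)) D1'\<close> in the ring of entire functions. It has no zero in common with \<open>D1'\<close>, so
  \<open>(c(a) - \<sigma> c'(a)) / s'(a)\<close> is entire: up to an entire function both problems on \<open>[0,a]\<close> have the
  same Weyl function. The method of spectral mappings now applies. Let \<open>v\<close> be the solution with data
  \<open>(0,1)\<close> at \<open>a\<close>. For each \<open>x\<close> the quotient \<open>(v(x) s'(x) - \<sigma> s(x) v'(x)) / s'(a)\<close> is entire and
  of order \<open>1 / \<mu>\<close> on the squares, so it vanishes (\<open>spectral_mapping_vanishes\<close>). Differentiation in
  \<open>x\<close> and the two constant Wronskians turn this into \<open>s\<^sup>2 = s'\<^sup>2\<close>. Then \<open>s\<close> and \<open>s'\<close> have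
  Wronskian zero, and its derivative \<open>(2 \<mu> (p' - p) + q' - q) s s'\<close> vanishes almost everywhere; two
  values of \<open>\<mu>\<close> separate \<open>p\<close> from \<open>q\<close> (\<open>coefficients_determined\<close>).

  The interval \<open>[a,T]\<close> is treated by reflection, which exchanges \<open>D0\<close> with \<open>D2\<close>. The coprimality
  carries over: at a common zero of \<open>D1\<close> and \<open>D2\<close> also \<open>s(a) c(T) = 0\<close>, where \<open>c(T)\<close> is not zero by
  the Wronskian identity.
\<close>

section \<open>Absolutely continuous functions and the fundamental theorem of calculus\<close>

text \<open>
  An absolutely continuous function is kept together with its almost everywhere derivative. The rules
  of calculus below then speak about the pair, and no exceptional null set has to be carried along.
\<close>

definition primitive_on :: "real \<Rightarrow> real \<Rightarrow> (real \<Rightarrow> complex) \<Rightarrow> (real \<Rightarrow> complex) \<Rightarrow> bool" where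
  "primitive_on a b F f \<longleftrightarrow>
     f absolutely_integrable_on {a..b} \<and> (\<forall>x\<in>{a..b}. F x = F a + integral {a..x} f)"

lemma primitive_onD_integral:
  assumes "primitive_on a b F f" "a \<le> u" "u \<le> v" "v \<le> b"
  shows "F v - F u = integral {u..v} f"
proof -
  have "f integrable_on {a..b}"
    using assms(1) absolutely_integrable_on_def unfolding primitive_on_def by blast
  then have "f integrable_on {a..v}"
    by (rule integrable_on_subinterval) (use assms in auto)
  then have "integral {a..u} f + integral {u..v} f = integral {a..v} f"
    by (intro Henstock_Kurzweil_Integration.integral_combine) (use assms in auto)
  moreover have "F x = F a + integral {a..x} f" if "x \<in> {a..b}" for x
    using assms(1) that unfolding primitive_on_def by blast
  from this[of u] this[of v] have "F u = F a + integral {a..u} f" "F v = F a + integral {a..v} f"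
    using assms by simp_all
  ultimately show ?thesis by (simp add: algebra_simps)
qed

lemma sum_integral_disjoint_le:
  fixes h :: "real \<Rightarrow> real"
  assumes h: "h integrable_on {a..b}" and pos: "\<And>x. x \<in> {a..b} \<Longrightarrow> 0 \<le> h x"
    and uv: "\<And>i. i < n \<Longrightarrow> u i \<le> v i \<and> {u i..v i} \<subseteq> {a..b}"
    and dis: "disjoint_family_on (\<lambda>i. {u i<..<v i}) {..<n::nat}"
  shows "(\<Sum>i<n. integral {u i..v i} h) \<le> integral {a..b} h"
proof -
  let ?g = "\<lambda>i x. if x \<in> {u i<..<v i} then h x else 0"
  have sub: "{u i<..<v i} \<subseteq> {a..b}" if "i < n" for i
    using uv[OF that] greaterThanLessThan_subseteq_atLeastAtMost_iff by blast
  have int: "?g i integrable_on {a..b}" if "i < n" for i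
  proof -
    have "h integrable_on {u i..v i}"
      by (rule integrable_on_subinterval[OF h]) (use uv[OF that] in auto)
    then have "h integrable_on {u i<..<v i}"
      by (simp add: integrable_on_Icc_iff_Ioo)
    then show ?thesis
      using integrable_restrict_Int[of "{u i<..<v i}" h "{a..b}"] inf_absorb2[OF sub[OF that]]
      by (simp only: Int_commute)
  qed
  have eq: "integral {u i..v i} h = integral {a..b} (?g i)" if "i < n" for i
  proof -
    have "integral {a..b} (?g i) = integral ({u i<..<v i} \<inter> {a..b}) h"
      using integral_restrict_Int[of "{a..b}" "{u i<..<v i}" h] by (simp add: Int_commute)
    also have "... = integral {u i<..<v i} h" using sub[OF that] by (simp add: inf_absorb1)
    also have "... = integral {u i..v i} h" by (simp add: integral_open_interval_real)
    finally show ?thesis by simp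
  qed
  have "(\<Sum>i<n. integral {u i..v i} h) = (\<Sum>i<n. integral {a..b} (?g i))"
    by (rule sum.cong) (use eq in auto)
  also have "... = integral {a..b} (\<lambda>x. \<Sum>i<n. ?g i x)"
    by (rule integral_sum[symmetric]) (use int in auto)
  also have "... \<le> integral {a..b} h"
  proof (rule integral_le)
    show "(\<lambda>x. \<Sum>i<n. ?g i x) integrable_on {a..b}"
      by (rule integrable_sum) (use int in auto)
    show "h integrable_on {a..b}" by fact
    fix x assume x: "x \<in> {a..b}"
    show "(\<Sum>i<n. ?g i x) \<le> h x"
    proof (cases "\<exists>i<n. x \<in> {u i<..<v i}")
      case True
      then obtain j where j: "j < n" "x \<in> {u j<..<v j}" by blast
      have "?g i x = (if i = j then h x else 0)" if "i < n" for i
      proof (cases "i = j")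
        case False
        then have "{u i<..<v i} \<inter> {u j<..<v j} = {}"
          using dis that j(1) unfolding disjoint_family_on_def by blast
        then show ?thesis using False j(2) by auto
      qed (use j in auto)
      then have "(\<Sum>i<n. ?g i x) = (\<Sum>i<n. if i = j then h x else 0)"
        by (intro sum.cong) auto
      then show ?thesis using j(1) by simp
    next
      case False
      then have "(\<Sum>i<n. ?g i x) = 0" by (intro sum.neutral) auto
      then show ?thesis using pos[OF x] by simp
    qed
  qed
  finally show ?thesis .
qed

definition short_intervals :: "real set \<Rightarrow> real \<Rightarrow> nat \<Rightarrow> (nat \<Rightarrow> real) \<Rightarrow> (nat \<Rightarrow> real) \<Rightarrow> bool" where
  "short_intervals I d n u v \<longleftrightarrow> (\<forall>i<n. u i \<le> v i \<and> {u i..v i} \<subseteq> I) \<and>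
     disjoint_family_on (\<lambda>i. {u i<..<v i}) {..<n} \<and> (\<Sum>i<n. v i - u i) < d"

lemma abs_continuous_on_iff:
  "abs_continuous_on I f \<longleftrightarrow> (\<forall>e>0. \<exists>d>0. \<forall>n u v. short_intervals I d n u v \<longrightarrow>
     (\<Sum>i<n. norm (f (v i) - f (u i))) < e)"
  by (simp add: abs_continuous_on_def short_intervals_def)

text \<open>
  Cut the integrand off at height \<open>n\<close>. The part above \<open>n\<close> has an arbitrarily small integral by dominated
  convergence, and the rest contributes at most \<open>n\<close> times the total length of the intervals.
\<close>

lemma primitive_imp_abs_continuous:
  assumes F: "primitive_on a b F f"
  shows "abs_continuous_on {a..b} F"
proof -
  have fabs: "f absolutely_integrable_on {a..b}" using F by (simp add: primitive_on_def)
  have nf: "(\<lambda>x. norm (f x)) absolutely_integrable_on {a..b}"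
    using absolutely_integrable_norm[OF fabs] by (simp add: o_def)
  define h where "h = (\<lambda>(n::nat) x. max (norm (f x) - real n) 0)"
  have hi: "h n integrable_on {a..b}" for n
  proof -
    have "(\<lambda>x. norm (f x) - real n) absolutely_integrable_on {a..b}"
      using nf by (intro set_integral_diff) (auto simp: absolutely_integrable_on_const)
    then have "h n absolutely_integrable_on {a..b}"
      unfolding h_def by (intro absolutely_integrable_max_1) auto
    then show ?thesis using absolutely_integrable_on_def by blast
  qed
  have nfi: "(\<lambda>x. norm (f x)) integrable_on {a..b}"
    using nf absolutely_integrable_on_def by blast
  have lim: "(\<lambda>n. integral {a..b} (h n)) \<longlonglongrightarrow> integral {a..b} (\<lambda>x. 0)"
  proof (rule dominated_convergence(2)[OF hi nfi])
    show "norm (h n x) \<le> norm (f x)" for n x by (auto simp: h_def)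
    fix x assume "x \<in> {a..b}"
    obtain N :: nat where N: "norm (f x) \<le> real N" using real_arch_simple by blast
    have "h n x = 0" if "n \<ge> N" for n using N that by (auto simp: h_def)
    then have "eventually (\<lambda>n. h n x = 0) sequentially"
      using eventually_at_top_linorder by blast
    then show "(\<lambda>n. h n x) \<longlonglongrightarrow> 0" by (rule tendsto_eventually)
  qed
  show ?thesis
    unfolding abs_continuous_on_iff
  proof (intro allI impI)
    fix e :: real assume e: "e > 0"
    have "eventually (\<lambda>n. integral {a..b} (h n) < e/2) sequentially"
      by (rule order_tendstoD(2)[OF lim]) (use e in simp)
    then obtain n where n: "integral {a..b} (h n) < e/2"
      using eventually_happens by force
    define d where "d = e / (2 * (real n + 1))"
    have d: "d > 0" using e by (simp add: d_def)
    have main: "(\<Sum>i<m. norm (F (v i) - F (u i))) < e"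
      if "short_intervals {a..b} d m u v" for m u v
    proof -
      from that have A: "\<forall>i<m. u i \<le> v i \<and> {u i..v i} \<subseteq> {a..b}"
        "disjoint_family_on (\<lambda>i. {u i<..<v i}) {..<m}" "(\<Sum>i<m. v i - u i) < d"
        by (auto simp only: short_intervals_def)
      have step: "norm (F (v i) - F (u i)) \<le> real n * (v i - u i) + integral {u i..v i} (h n)" if i: "i < m" for i
      proof -
        have ab: "a \<le> u i" "u i \<le> v i" "v i \<le> b" using A(1) i by auto
        have i1: "f integrable_on {u i..v i}"
          by (rule integrable_on_subinterval[where S="{a..b}"]) (use fabs absolutely_integrable_on_def ab in auto)
        have i2: "h n integrable_on {u i..v i}"
          by (rule integrable_on_subinterval[OF hi]) (use ab in auto)
        have "norm (F (v i) - F (u i)) = norm (integral {u i..v i} f)"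
          using primitive_onD_integral[OF F ab] by simp
        also have "... \<le> integral {u i..v i} (\<lambda>x. real n + h n x)"
        proof (rule Henstock_Kurzweil_Integration.integral_norm_bound_integral[OF i1])
          show "(\<lambda>x. real n + h n x) integrable_on {u i..v i}"
            by (rule integrable_add) (use i2 in auto)
        qed (auto simp: h_def)
        also have "... = real n * (v i - u i) + integral {u i..v i} (h n)"
          by (subst Henstock_Kurzweil_Integration.integral_add) (use i2 ab in auto)
        finally show ?thesis .
      qed
      have "(\<Sum>i<m. norm (F (v i) - F (u i))) \<le> (\<Sum>i<m. real n * (v i - u i) + integral {u i..v i} (h n))"
        by (rule sum_mono) (use step in auto)
      also have "... = real n * (\<Sum>i<m. v i - u i) + (\<Sum>i<m. integral {u i..v i} (h n))"
        by (simp add: sum.distrib sum_distrib_left)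
      also have "... \<le> real n * d + integral {a..b} (h n)"
      proof (rule add_mono)
        show "real n * (\<Sum>i<m. v i - u i) \<le> real n * d" using A(3) by (intro mult_left_mono) auto
        show "(\<Sum>i<m. integral {u i..v i} (h n)) \<le> integral {a..b} (h n)"
          by (rule sum_integral_disjoint_le[OF hi]) (use A in \<open>auto simp: h_def\<close>)
      qed
      also have "real n * d \<le> e/2" using e by (simp add: d_def field_simps)
      finally show ?thesis using n by linarith
    qed
    then show "\<exists>d>0. \<forall>m u v. short_intervals {a..b} d m u v \<longrightarrow>
        (\<Sum>i<m. norm (F (v i) - F (u i))) < e"
      using d by blast
  qed
qed

text \<open>
  The one-sided half of Lebesgue's differentiation theorem, obtained from averages over intervals whose
  left end point is \<open>x\<close>.
\<close>

lemma right_derivative_indefinite_integral: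
  fixes f :: "real \<Rightarrow> complex"
  assumes f: "\<And>a b. f integrable_on {a..b}"
  obtains N where "negligible N"
    "\<And>x e::real. \<lbrakk>x \<notin> N; 0 < e\<rbrakk> \<Longrightarrow> \<exists>d>0. \<forall>h. 0 < h \<and> h < d \<longrightarrow>
        norm (integral {x..x+h} f - h *\<^sub>R f x) \<le> e * h"
proof -
  obtain N :: "real set" where N: "negligible N"
    "\<And>x e. \<lbrakk>x \<notin> N; 0 < e\<rbrakk> \<Longrightarrow> \<exists>d>0. \<forall>h. 0 < h \<and> h < d \<longrightarrow>
        norm (integral (cbox x (x + h *\<^sub>R One)) f /\<^sub>R h ^ DIM(real) - f x) < e"
    by (rule integrable_ccontinuous_explicit[of f]) (use f that in \<open>auto simp only: box_real\<close>)
  show ?thesis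
  proof (rule that[OF N(1)])
    fix x e :: real assume "x \<notin> N" "0 < e"
    from N(2)[OF this] obtain d where d: "d > 0"
      "\<And>h. 0 < h \<Longrightarrow> h < d \<Longrightarrow> norm (integral {x..x+h} f /\<^sub>R h - f x) < e"
      unfolding DIM_real power_one_right box_real by auto
    have "norm (integral {x..x+h} f - h *\<^sub>R f x) \<le> e * h" if h: "0 < h" "h < d" for h
    proof -
      have "integral {x..x+h} f - h *\<^sub>R f x = h *\<^sub>R (integral {x..x+h} f /\<^sub>R h - f x)"
        using h by (simp add: algebra_simps)
      then have "norm (integral {x..x+h} f - h *\<^sub>R f x) = h * norm (integral {x..x+h} f /\<^sub>R h - f x)"
        using h by simp
      also have "... \<le> h * e" using d(2)[OF h] h by (intro mult_left_mono) auto
      finally show ?thesis by (simp add: mult.commute)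
    qed
    then show "\<exists>d>0. \<forall>h. 0 < h \<and> h < d \<longrightarrow> norm (integral {x..x+h} f - h *\<^sub>R f x) \<le> e * h"
      using d(1) by blast
  qed
qed

text \<open>
  The left derivative of an indefinite integral is the right derivative for the reflected integrand.
\<close>

lemma primitive_ae_derivative:
  assumes F: "primitive_on a b F f"
  obtains N where "negligible N"
    "\<And>x. x \<in> {a<..<b} - N \<Longrightarrow> (F has_vector_derivative f x) (at x)"
proof -
  have fi: "f integrable_on {a..b}"
    using F absolutely_integrable_on_def unfolding primitive_on_def by blast
  \<comment> \<open>The differentiation theorem asks for an integrand on the whole line.\<close>
  define g where "g = (\<lambda>x. if x \<in> {a..b} then f x else 0)"
  have gi: "g integrable_on {c..d}" for c d :: real
  proof -
    have "f integrable_on ({c..d} \<inter> {a..b})"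
      by (simp add: integrable_on_subinterval[OF fi])
    then show ?thesis
      unfolding g_def using integrable_restrict_Int[of "{a..b}" f "{c..d}"] by (simp add: Int_commute)
  qed
  have gri: "(\<lambda>x. g (- x)) integrable_on {c..d}" for c d :: real
    using gi[of "-d" "-c"] Henstock_Kurzweil_Integration.integrable_reflect_real[of g "-c" "-d"] by simp
  obtain N1 where N1: "negligible N1"
    "\<And>x e. \<lbrakk>x \<notin> N1; 0 < e\<rbrakk> \<Longrightarrow> \<exists>d>0. \<forall>h. 0 < h \<and> h < d \<longrightarrow>
        norm (integral {x..x+h} g - h *\<^sub>R g x) \<le> e * h"
    using right_derivative_indefinite_integral[OF gi] by blast
  obtain N2 where N2: "negligible N2"
    "\<And>x e. \<lbrakk>x \<notin> N2; 0 < e\<rbrakk> \<Longrightarrow> \<exists>d>0. \<forall>h. 0 < h \<and> h < d \<longrightarrow>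
        norm (integral {x..x+h} (\<lambda>x. g (- x)) - h *\<^sub>R g (- x)) \<le> e * h"
    using right_derivative_indefinite_integral[OF gri] by blast
  have neg2: "negligible (uminus ` N2)"
    using N2(1)
    by (rule negligible_differentiable_image_negligible[rotated]) (auto intro!: derivative_intros simp: differentiable_on_def)
  show ?thesis
  proof (rule that[of "N1 \<union> uminus ` N2"])
    show "negligible (N1 \<union> uminus ` N2)" using N1(1) neg2 by simp
    fix x assume x: "x \<in> {a<..<b} - (N1 \<union> uminus ` N2)"
    then have x1: "x \<notin> N1" and x2: "- x \<notin> N2" by (auto simp: image_iff dest: bspec[where x="-x"])
    have gx: "g x = f x" using x by (simp add: g_def)
    have Fg: "F w - F u = integral {u..w} g" if "a \<le> u" "u \<le> w" "w \<le> b" for u w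
    proof -
      have "integral {u..w} g = integral {u..w} f"
        by (rule Henstock_Kurzweil_Integration.integral_cong) (use that in \<open>auto simp: g_def\<close>)
      then show ?thesis using primitive_onD_integral[OF F that] by simp
    qed
    show "(F has_vector_derivative f x) (at x)"
      unfolding has_vector_derivative_def has_derivative_at_alt
    proof (intro conjI allI impI)
      show "bounded_linear (\<lambda>h. h *\<^sub>R f x)" by (rule bounded_linear_scaleR_left)
      fix e :: real assume e: "e > 0"
      obtain d1 where d1: "d1 > 0" "\<And>h. 0 < h \<Longrightarrow> h < d1 \<Longrightarrow> norm (integral {x..x+h} g - h *\<^sub>R g x) \<le> e * h"
        using N1(2)[OF x1 e] by blast
      obtain d2 where d2: "d2 > 0" "\<And>h. 0 < h \<Longrightarrow> h < d2 \<Longrightarrow>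
          norm (integral {-x..-x+h} (\<lambda>x. g (- x)) - h *\<^sub>R g (- (- x))) \<le> e * h"
        using N2(2)[OF x2 e] by blast
      define d where "d = min (min d1 d2) (min (x - a) (b - x))"
      have "d > 0" using d1 d2 x by (simp add: d_def)
      moreover have "norm (F y - F x - (y - x) *\<^sub>R f x) \<le> e * norm (y - x)" if y: "norm (y - x) < d" for y
      proof -
        consider "y = x" | "y > x" | "y < x" by linarith
        then show ?thesis
        proof cases
          case 2
          have "norm (integral {x..x+(y-x)} g - (y-x) *\<^sub>R g x) \<le> e * (y-x)"
            by (rule d1(2)) (use 2 y in \<open>auto simp: d_def\<close>)
          moreover have "F y - F x = integral {x..y} g"
            by (rule Fg) (use 2 y x in \<open>auto simp: d_def\<close>)
          ultimately show ?thesis using 2 gx by simp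
        next
          case 3
          have "norm (integral {-x..-x+(x-y)} (\<lambda>x. g (- x)) - (x-y) *\<^sub>R g (- (- x))) \<le> e * (x-y)"
            by (rule d2(2)) (use 3 y in \<open>auto simp: d_def\<close>)
          moreover have "integral {-x..-x+(x-y)} (\<lambda>x. g (- x)) = integral {y..x} g"
            using Henstock_Kurzweil_Integration.integral_reflect_real[of y x g] by simp
          moreover have "F x - F y = integral {y..x} g"
            by (rule Fg) (use 3 y x in \<open>auto simp: d_def\<close>)
          ultimately have "norm (F x - F y - (x-y) *\<^sub>R f x) \<le> e * (x-y)" using gx by simp
          have "F y - F x - (y - x) *\<^sub>R f x = - (F x - F y - (x-y) *\<^sub>R f x)"
            by (simp add: algebra_simps)
          then have "norm (F y - F x - (y - x) *\<^sub>R f x) = norm (F x - F y - (x-y) *\<^sub>R f x)"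
            by (metis norm_minus_cancel)
          then show ?thesis using 3 \<open>norm (F x - F y - (x-y) *\<^sub>R f x) \<le> e * (x-y)\<close> by simp
        qed simp
      qed
      ultimately show "\<exists>d>0. \<forall>y. norm (y - x) < d \<longrightarrow>
          norm (F y - F x - (y - x) *\<^sub>R f x) \<le> e * norm (y - x)" by blast
    qed
  qed
qed

text \<open>
  The Henstock--Kurzweil integral makes this direction elementary. At a tag outside the exceptional set
  \<open>N\<close> the gauge comes from differentiability. At a tag in \<open>N\<close> it is an open set of small measure around
  \<open>N\<close>; absolute continuity bounds the total increment of \<open>F\<close> over the intervals that fit into it.
\<close>

lemma abs_continuous_has_integral:
  assumes ab: "a \<le> b" and F: "abs_continuous_on {a..b} F" and N: "negligible N"
    and der: "\<And>x. x \<in> {a..b} - N \<Longrightarrow> (F has_vector_derivative f x) (at x within {a..b})"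
  shows "(f has_integral (F b - F a)) {a..b}"
proof -
  define g where "g = (\<lambda>x. if x \<in> N then 0 else f x)"
  have "(g has_integral (F b - F a)) (cbox a b)"
    unfolding has_integral
  proof (intro allI impI)
    fix e :: real assume e: "e > 0"
    define e1 where "e1 = e / (2 * (b - a + 1))"
    have e1: "e1 > 0" "e1 * (b - a) < e/2" using e ab by (auto simp: e1_def field_simps)
    obtain \<delta> where \<delta>: "\<delta> > 0" "\<And>n u v. short_intervals {a..b} \<delta> n u v \<Longrightarrow>
        (\<Sum>i<n. norm (F (v i) - F (u i))) < e/2"
      using F half_gt_zero[OF e] unfolding abs_continuous_on_iff by blast
    have N0: "N \<in> null_sets lebesgue" using N by (simp add: negligible_iff_null_sets)
    obtain U where U: "open U" "N \<subseteq> U" "U - N \<in> lmeasurable" "emeasure lebesgue (U - N) < ennreal \<delta>"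
      using sets_lebesgue_outer_open[OF null_setsD2[OF N0] \<delta>(1)] by blast
    have Ueq: "U = (U - N) \<union> N" using U(2) by blast
    have Uem: "emeasure lebesgue U = emeasure lebesgue (U - N)"
      using emeasure_Un_null_set[of "U - N" lebesgue N] N0 U(3) Ueq by (simp add: fmeasurableD)
    have Ulm: "U \<in> lmeasurable"
      using U(3,4) Uem U(1) by (intro fmeasurableI) (auto simp: less_top[symmetric] intro: less_trans)
    have Um: "measure lebesgue U < \<delta>"
      using U(4) Uem \<delta>(1) by (metis emeasure_eq_measure2 Ulm ennreal_less_iff measure_nonneg)
    have "\<exists>d>0. \<forall>y\<in>{a..b}. norm (y - x) < d \<longrightarrow> norm (F y - F x - (y - x) *\<^sub>R f x) \<le> e1 * norm (y - x)"
      if "x \<in> {a..b} - N" for x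
      using der[OF that] e1(1) unfolding has_vector_derivative_def has_derivative_within_alt by blast
    then obtain d where d: "\<And>x. x \<in> {a..b} - N \<Longrightarrow> d x > 0"
      "\<And>x y. x \<in> {a..b} - N \<Longrightarrow> y \<in> {a..b} \<Longrightarrow> norm (y - x) < d x \<Longrightarrow>
         norm (F y - F x - (y - x) *\<^sub>R f x) \<le> e1 * norm (y - x)"
      by metis
    define \<gamma> where "\<gamma> = (\<lambda>x. if x \<in> N then U else if x \<in> {a..b} then ball x (d x) else UNIV)"
    have gau: "gauge \<gamma>"
      using U d(1) unfolding gauge_def \<gamma>_def by auto
    have main: "norm ((\<Sum>(x,k)\<in>p. measure lborel k *\<^sub>R g x) - (F b - F a)) < e"
      if p: "p tagged_division_of cbox a b" "\<gamma> fine p" for p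
    proof -
      have pfin: "finite p" using p(1) by blast
      have K: "\<exists>u v. K = {u..v} \<and> u \<le> v \<and> x \<in> {u..v} \<and> {u..v} \<subseteq> {a..b}" if "(x,K) \<in> p" for x K
      proof -
        have "x \<in> K" "K \<subseteq> cbox a b" "\<exists>u v. K = cbox u v"
          using tagged_division_ofD(2-4)[OF p(1) that] by auto
        then show ?thesis by (metis atLeastAtMost_iff box_real(2) order_trans)
      qed
      define pN where "pN = {(x,K) \<in> p. x \<in> N}"
      have pNsub: "pN \<subseteq> p" and pNfin: "finite pN" using pfin by (auto simp: pN_def intro: finite_subset)
      define D where "D = (\<lambda>(x,K). measure lborel K *\<^sub>R g x - (F (Sup K) - F (Inf K)))"
      have "(\<Sum>(x,k)\<in>p. measure lborel k *\<^sub>R g x) - (F b - F a) = sum D p"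
      proof -
        have "(\<Sum>(x,K)\<in>p. F (Sup K) - F (Inf K)) = F b - F a"
          using additive_tagged_division_1[OF ab] p(1) by simp
        then show ?thesis by (simp add: D_def sum_subtractf case_prod_unfold)
      qed
      also have "... = sum D (p - pN) + sum D pN"
        using pfin pNsub by (metis sum.subset_diff)
      finally have eq: "(\<Sum>(x,k)\<in>p. measure lborel k *\<^sub>R g x) - (F b - F a) = sum D (p - pN) + sum D pN" .
      have "norm (sum D (p - pN)) \<le> (\<Sum>(x,K)\<in>p - pN. e1 * measure lborel K)"
      proof (rule sum_norm_le)
        fix t assume t: "t \<in> p - pN"
        obtain x K where tx: "t = (x,K)" by (cases t)
        then have xK: "(x,K) \<in> p" "x \<notin> N" using t by (auto simp: pN_def)
        obtain u v where uv: "K = {u..v}" "u \<le> v" "x \<in> {u..v}" "{u..v} \<subseteq> {a..b}" using K[OF xK(1)] by blast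
        have xab: "x \<in> {a..b} - N" using uv xK by auto
        have "K \<subseteq> ball x (d x)" using p(2) xK xab unfolding fine_def \<gamma>_def by fastforce
        moreover have "u \<in> K" "v \<in> K" using uv by auto
        ultimately have "u \<in> ball x (d x)" "v \<in> ball x (d x)" by blast+
        then have "norm (u - x) < d x" "norm (v - x) < d x" by (auto simp: dist_norm norm_minus_commute)
        then have b1: "norm (F u - F x - (u - x) *\<^sub>R f x) \<le> e1 * norm (u - x)"
          and b2: "norm (F v - F x - (v - x) *\<^sub>R f x) \<le> e1 * norm (v - x)"
          using d(2)[OF xab, of u] d(2)[OF xab, of v] uv \<open>norm (u - x) < d x\<close> \<open>norm (v - x) < d x\<close> by auto
        have Dt: "D t = (F u - F x - (u - x) *\<^sub>R f x) - (F v - F x - (v - x) *\<^sub>R f x)"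
          using uv xK tx by (simp add: D_def g_def algebra_simps)
        have "norm (D t) \<le> e1 * norm (u - x) + e1 * norm (v - x)"
          unfolding Dt by (rule order_trans[OF norm_triangle_ineq4 add_mono[OF b1 b2]])
        also have "... = e1 * measure lborel K" using uv by (simp add: algebra_simps)
        finally show "norm (D t) \<le> (case t of (x,K) \<Rightarrow> e1 * measure lborel K)" using tx by simp
      qed
      also have "... \<le> (\<Sum>(x,K)\<in>p. e1 * measure lborel K)"
        using e1(1) pfin by (intro sum_mono2) auto
      also have "... = e1 * (\<Sum>(x,K)\<in>p. measure lborel K)" by (simp add: sum_distrib_left case_prod_unfold)
      also have "... = e1 * (b - a)" using additive_content_tagged_division[OF p(1)] ab by simp
      finally have p1: "norm (sum D (p - pN)) \<le> e1 * (b - a)" .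
      obtain h and n :: nat where h: "bij_betw h {..<n} pN"
        using ex_bij_betw_nat_finite[OF pNfin] atLeast0LessThan by metis
      define u where "u = (\<lambda>i. Inf (snd (h i)))"
      define v where "v = (\<lambda>i. Sup (snd (h i)))"
      have hp: "h i \<in> pN" if "i < n" for i using h that by (auto simp: bij_betw_def)
      have huv: "snd (h i) = {u i..v i} \<and> u i \<le> v i \<and> {u i..v i} \<subseteq> {a..b} \<and> {u i..v i} \<subseteq> U" if "i < n" for i
      proof -
        obtain x K where xK: "h i = (x,K)" by (cases "h i")
        with hp[OF that] have "(x,K) \<in> p" "x \<in> N" by (auto simp: pN_def)
        moreover from this have "K \<subseteq> U" using p(2) unfolding fine_def \<gamma>_def by fastforce
        ultimately show ?thesis using K[of x K] xK by (auto simp: u_def v_def)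
      qed
      have le: "u i \<le> v i" if "i < n" for i using huv[OF that] by blast
      have inU: "{u i<..<v i} \<subseteq> U" if "i < n" for i
        using huv[OF that] greaterThanLessThan_subseteq_atLeastAtMost_iff[of "u i" "v i" "u i" "v i"] by blast
      have dis: "disjoint_family_on (\<lambda>i. {u i<..<v i}) {..<n}"
        unfolding disjoint_family_on_def
      proof (intro ballI impI)
        fix i j assume ij: "i \<in> {..<n}" "j \<in> {..<n}" "i \<noteq> j"
        then have ne: "h i \<noteq> h j"
          using inj_on_eq_iff[OF bij_betw_imp_inj_on[OF h] ij(1) ij(2)] by simp
        obtain x K x' K' where xK: "h i = (x,K)" "h j = (x',K')"
          by (cases "h i", cases "h j", rule that) (simp only:)+
        have "interior K \<inter> interior K' = {}"
        proof (rule tagged_division_ofD(5)[OF p(1)])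
          show "(x,K) \<in> p" "(x',K') \<in> p" using hp[of i] hp[of j] ij xK pNsub by auto
          show "(x,K) \<noteq> (x',K')" using ne xK by simp
        qed
        moreover have "K = {u i..v i}" using huv[of i] ij(1) xK(1) by simp
        moreover have "K' = {u j..v j}" using huv[of j] ij(2) xK(2) by simp
        ultimately show "{u i<..<v i} \<inter> {u j<..<v j} = {}" by (simp add: interior_atLeastAtMost_real)
      qed
      have "(\<Sum>i<n. v i - u i) = (\<Sum>i<n. measure lebesgue {u i<..<v i})"
        by (rule sum.cong) (use le in auto)
      also have "... = measure lebesgue (\<Union>i<n. {u i<..<v i})"
        by (rule measure_finite_Union[symmetric]) (use dis le in auto)
      also have "... \<le> measure lebesgue U"
        using inU Ulm by (intro measure_mono_fmeasurable) auto
      finally have small: "(\<Sum>i<n. v i - u i) < \<delta>" using Um by simp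
      have "norm (sum D pN) \<le> (\<Sum>t\<in>pN. norm (D t))" by (rule norm_sum)
      also have "... = (\<Sum>i<n. norm (D (h i)))"
        using sum.reindex_bij_betw[OF h, of "\<lambda>t. norm (D t)"] by simp
      also have "... = (\<Sum>i<n. norm (F (v i) - F (u i)))"
      proof (rule sum.cong)
        fix i assume "i \<in> {..<n}"
        then have "fst (h i) \<in> N" using hp[of i] unfolding pN_def by (cases "h i") auto
        then show "norm (D (h i)) = norm (F (v i) - F (u i))"
          by (simp add: D_def case_prod_unfold g_def u_def v_def norm_minus_commute)
      qed simp
      also have "... < e/2" by (rule \<delta>(2)) (unfold short_intervals_def, use huv dis small in blast)
      finally have p2: "norm (sum D pN) < e/2" .
      show ?thesis unfolding eq using p1 p2 e1(2) norm_triangle_ineq[of "sum D (p - pN)" "sum D pN"] by linarith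
    qed
    show "\<exists>\<gamma>. gauge \<gamma> \<and> (\<forall>p. p tagged_division_of cbox a b \<and> \<gamma> fine p \<longrightarrow>
        norm ((\<Sum>(x, k)\<in>p. measure lborel k *\<^sub>R g x) - (F b - F a)) < e)"
      by (intro exI[of _ \<gamma>] conjI gau allI impI main) (elim conjE, assumption)+
  qed
  then have "(g has_integral (F b - F a)) {a..b}" by simp
  then show ?thesis
    by (rule has_integral_spike[OF N, rotated]) (auto simp: g_def)
qed

section \<open>Calculus of primitives\<close>

lemma primitive_onD: "primitive_on a b F f \<Longrightarrow> x \<in> {a..b} \<Longrightarrow> F x = F a + integral {a..x} f"
  unfolding primitive_on_def by blast

lemma primitive_on_integrable: "primitive_on a b F f \<Longrightarrow> f absolutely_integrable_on {a..b}"
  by (simp add: primitive_on_def)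

lemma primitive_on_has_integral:
  assumes "primitive_on a b F f" "a \<le> u" "u \<le> v" "v \<le> b"
  shows "(f has_integral (F v - F u)) {u..v}"
proof -
  have "f integrable_on {a..b}"
    using primitive_on_integrable[OF assms(1)] absolutely_integrable_on_def by blast
  then have "f integrable_on {u..v}"
    by (rule integrable_on_subinterval) (use assms in auto)
  then show ?thesis
    using primitive_onD_integral[OF assms] by (simp add: integrable_integral)
qed

lemma primitive_onI:
  assumes "f absolutely_integrable_on {a..b}"
    and "\<And>x. x \<in> {a..b} \<Longrightarrow> (f has_integral (F x - F a)) {a..x}"
  shows "primitive_on a b F f"
  unfolding primitive_on_def
proof (intro conjI ballI)
  fix x assume "x \<in> {a..b}"
  then have "integral {a..x} f = F x - F a" using assms(2) by (simp add: integral_unique)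
  then show "F x = F a + integral {a..x} f" by simp
qed fact

lemma primitive_on_subinterval:
  assumes "primitive_on a b F f" "a \<le> c" "d \<le> b"
  shows "primitive_on c d F f"
proof (rule primitive_onI)
  show "f absolutely_integrable_on {c..d}"
    by (rule absolutely_integrable_on_subinterval[OF primitive_on_integrable[OF assms(1)]]) (use assms in auto)
  show "(f has_integral (F x - F c)) {c..x}" if "x \<in> {c..d}" for x
    by (rule primitive_on_has_integral[OF assms(1)]) (use that assms in auto)
qed

lemma primitive_on_continuous:
  assumes "primitive_on a b F f"
  shows "continuous_on {a..b} F"
proof -
  have fi: "f integrable_on {a..b}"
    using primitive_on_integrable[OF assms] absolutely_integrable_on_def by blast
  have "continuous_on {a..b} (\<lambda>x. F a + integral {a..x} f)"
    by (intro continuous_intros indefinite_integral_continuous_1[OF fi])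
  then show ?thesis
    by (rule continuous_on_eq) (rule primitive_onD[OF assms, symmetric])
qed

lemma primitive_on_cong:
  assumes "primitive_on a b F f" "\<And>x. x \<in> {a..b} \<Longrightarrow> F x = G x" "\<And>x. x \<in> {a..b} \<Longrightarrow> f x = g x"
  shows "primitive_on a b G g"
proof (rule primitive_onI)
  show "g absolutely_integrable_on {a..b}"
    using primitive_on_integrable[OF assms(1)] set_integrable_cong[OF refl refl, of "{a..b}" f g lebesgue] assms(3) by blast
  fix x assume x: "x \<in> {a..b}"
  then have "(f has_integral (F x - F a)) {a..x}"
    by (intro primitive_on_has_integral[OF assms(1)]) auto
  then have "(g has_integral (F x - F a)) {a..x}"
    by (rule has_integral_eq[rotated]) (use assms(3) x in auto)
  then show "(g has_integral (G x - G a)) {a..x}" using assms(2) x by auto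
qed

lemma primitive_on_add:
  assumes "primitive_on a b F f" "primitive_on a b G g"
  shows "primitive_on a b (\<lambda>x. F x + G x) (\<lambda>x. f x + g x)"
proof (rule primitive_onI)
  show "(\<lambda>x. f x + g x) absolutely_integrable_on {a..b}"
    using assms by (intro set_integral_add) (auto simp: primitive_on_integrable)
  fix x assume "x \<in> {a..b}"
  then have "(f has_integral (F x - F a)) {a..x}" "(g has_integral (G x - G a)) {a..x}"
    by (intro primitive_on_has_integral[OF assms(1)] primitive_on_has_integral[OF assms(2)]; auto)+
  from has_integral_add[OF this]
  show "((\<lambda>x. f x + g x) has_integral F x + G x - (F a + G a)) {a..x}" by (simp add: algebra_simps)
qed

lemma primitive_on_cmult:
  assumes "primitive_on a b F f"
  shows "primitive_on a b (\<lambda>x. c * F x) (\<lambda>x. c * f x)"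
proof (rule primitive_onI)
  show "(\<lambda>x. c * f x) absolutely_integrable_on {a..b}"
    using assms by (intro set_integrable_mult_right) (auto simp: primitive_on_integrable)
  fix x assume "x \<in> {a..b}"
  then have "(f has_integral (F x - F a)) {a..x}"
    by (intro primitive_on_has_integral[OF assms(1)]; auto)
  from has_integral_mult_right[OF this]
  show "((\<lambda>x. c * f x) has_integral c * F x - c * F a) {a..x}" by (simp add: algebra_simps)
qed

lemma primitive_on_diff:
  assumes "primitive_on a b F f" "primitive_on a b G g"
  shows "primitive_on a b (\<lambda>x. F x - G x) (\<lambda>x. f x - g x)"
  using primitive_on_add[OF assms(1) primitive_on_cmult[OF assms(2), of "-1"]] by simp

lemma primitive_on_C1:
  assumes "\<And>x. x \<in> {a..b} \<Longrightarrow> (F has_vector_derivative f x) (at x within {a..b})"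
    and "continuous_on {a..b} f"
  shows "primitive_on a b F f"
proof (rule primitive_onI)
  show "f absolutely_integrable_on {a..b}"
    using assms(2) by (rule absolutely_integrable_continuous_real)
  show "(f has_integral (F x - F a)) {a..x}" if "x \<in> {a..b}" for x
    by (rule fundamental_theorem_of_calculus)
      (use that in \<open>auto intro: has_vector_derivative_within_subset[OF assms(1)]\<close>)
qed

lemma primitive_on_C1_derivative:
  assumes "primitive_on a b F f" "continuous_on {a..b} f" "x \<in> {a..b}"
  shows "(F has_vector_derivative f x) (at x within {a..b})"
proof -
  have "((\<lambda>u. F a + integral {a..u} f) has_vector_derivative f x) (at x within {a..b})"
    using integral_has_vector_derivative[OF assms(2,3)] by (auto intro!: derivative_eq_intros)
  then show ?thesis
    by (rule has_vector_derivative_transform[OF assms(3), where f = "\<lambda>u. F a + integral {a..u} f", rotated])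
      (rule primitive_onD[OF assms(1)])
qed

lemma has_integral_reflect_about:
  fixes f :: "real \<Rightarrow> 'a::euclidean_space"
  assumes "(f has_integral i) {u..v}"
  shows "((\<lambda>x. f (c - x)) has_integral i) {c - v..c - u}"
proof -
  have "((\<lambda>x. f ((-1) *\<^sub>R x + c)) has_integral (1 / \<bar>-1\<bar> ^ DIM(real)) *\<^sub>R i)
      ((\<lambda>x. (1 / -1) *\<^sub>R x + - ((1 / -1) *\<^sub>R c)) ` cbox u v)"
    by (rule has_integral_affinity) (use assms in auto)
  moreover have "(\<lambda>x. (1 / -1) *\<^sub>R x + - ((1 / -1) *\<^sub>R c)) ` cbox u v = {c - v..c - u}"
    using image_affinity_atLeastAtMost[of "-1" c u v] by (auto simp: add.commute)
  ultimately show ?thesis by simp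
qed

lemma absolutely_integrable_reflect_about:
  fixes f :: "real \<Rightarrow> complex"
  assumes "f absolutely_integrable_on {u..v}"
  shows "(\<lambda>x. f (c - x)) absolutely_integrable_on {c - v..c - u}"
proof -
  have refl: "(\<lambda>x. h (c - x)) integrable_on {c - v..c - u}" if "h integrable_on {u..v}"
    for h :: "real \<Rightarrow> 'b::euclidean_space"
    using has_integral_reflect_about[OF integrable_integral[OF that]] by (rule has_integral_integrable)
  show ?thesis
    using assms refl[of f] refl[of "\<lambda>x. norm (f x)"] unfolding absolutely_integrable_on_def by simp
qed

lemma primitive_on_reflect:
  assumes "primitive_on a b F f"
  shows "primitive_on (c - b) (c - a) (\<lambda>x. F (c - x)) (\<lambda>x. - f (c - x))"
proof (rule primitive_onI)
  show "(\<lambda>x. - f (c - x)) absolutely_integrable_on {c - b..c - a}"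
    using set_integrable_mult_right[OF absolutely_integrable_reflect_about[OF primitive_on_integrable[OF assms], of c], of "-1"]
    by simp
  fix x assume x: "x \<in> {c - b..c - a}"
  have "(f has_integral (F b - F (c - x))) {c - x..b}"
    by (rule primitive_on_has_integral[OF assms]) (use x in auto)
  from has_integral_neg[OF has_integral_reflect_about[OF this, of c]]
  show "((\<lambda>x. - f (c - x)) has_integral F (c - x) - F (c - (c - b))) {c - b..x}" by simp
qed

lemma absolutely_integrable_mult_continuous:
  fixes f g :: "real \<Rightarrow> complex"
  assumes f: "f absolutely_integrable_on {a..b}" and g: "continuous_on {a..b} g"
  shows "(\<lambda>x. f x * g x) absolutely_integrable_on {a..b}"
proof -
  have "(\<lambda>x. g x * f x) absolutely_integrable_on {a..b}"
  proof (rule absolutely_integrable_bounded_measurable_product[where h = "(*)", OF _ _ _ _ f])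
    show "g \<in> borel_measurable (lebesgue_on {a..b})"
      by (rule continuous_imp_measurable_on_sets_lebesgue[OF g]) auto
    show "bounded (g ` {a..b})"
      using compact_continuous_image[OF g] compact_imp_bounded by auto
  qed (auto simp: bilinear_conv_bounded_bilinear bounded_bilinear_mult)
  then show ?thesis by (simp add: mult.commute)
qed

lemma abs_continuous_on_mult:
  assumes F: "abs_continuous_on {a..b} F" and G: "abs_continuous_on {a..b} G"
    and M: "\<And>x. x \<in> {a..b} \<Longrightarrow> norm (F x) \<le> M" "\<And>x. x \<in> {a..b} \<Longrightarrow> norm (G x) \<le> M"
  shows "abs_continuous_on {a..b} (\<lambda>x. F x * G x)"
  unfolding abs_continuous_on_iff
proof (intro allI impI)
  fix e :: real assume e: "e > 0"
  define M' where "M' = \<bar>M\<bar> + 1"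
  have M': "M' > 0" "\<And>x. x \<in> {a..b} \<Longrightarrow> norm (F x) \<le> M'" "\<And>x. x \<in> {a..b} \<Longrightarrow> norm (G x) \<le> M'"
    using M by (force simp: M'_def)+
  define e' where "e' = e / (2 * M')"
  have e': "e' > 0" using e M' by (simp add: e'_def)
  let ?P = "\<lambda>d. short_intervals {a..b} d"
  obtain d1 where d1: "d1 > 0" "\<And>n u v. ?P d1 n u v \<Longrightarrow> (\<Sum>i<n. norm (F (v i) - F (u i))) < e'"
    using F e' unfolding abs_continuous_on_iff by blast
  obtain d2 where d2: "d2 > 0" "\<And>n u v. ?P d2 n u v \<Longrightarrow> (\<Sum>i<n. norm (G (v i) - G (u i))) < e'"
    using G e' unfolding abs_continuous_on_iff by blast
  have "(\<Sum>i<n. norm (F (v i) * G (v i) - F (u i) * G (u i))) < e" if P: "?P (min d1 d2) n u v" for n u v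
  proof -
    have P12: "?P d1 n u v" "?P d2 n u v" using P by (auto simp: short_intervals_def)
    have "norm (F (v i) * G (v i) - F (u i) * G (u i))
        \<le> M' * norm (F (v i) - F (u i)) + M' * norm (G (v i) - G (u i))" if "i < n" for i
    proof -
      have ab: "u i \<in> {a..b}" "v i \<in> {a..b}" using P that by (auto simp: short_intervals_def)
      have "F (v i) * G (v i) - F (u i) * G (u i)
          = G (v i) * (F (v i) - F (u i)) + F (u i) * (G (v i) - G (u i))" by (simp add: algebra_simps)
      also have "norm ... \<le> norm (G (v i)) * norm (F (v i) - F (u i)) + norm (F (u i)) * norm (G (v i) - G (u i))"
        by (metis norm_mult norm_triangle_ineq)
      also have "... \<le> M' * norm (F (v i) - F (u i)) + M' * norm (G (v i) - G (u i))"
        using M' ab by (intro add_mono mult_right_mono) auto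
      finally show ?thesis .
    qed
    then have "(\<Sum>i<n. norm (F (v i) * G (v i) - F (u i) * G (u i)))
        \<le> (\<Sum>i<n. M' * norm (F (v i) - F (u i)) + M' * norm (G (v i) - G (u i)))"
      by (intro sum_mono) auto
    also have "... = M' * (\<Sum>i<n. norm (F (v i) - F (u i))) + M' * (\<Sum>i<n. norm (G (v i) - G (u i)))"
      by (simp add: sum.distrib sum_distrib_left)
    also have "... < M' * e' + M' * e'"
      using M'(1) d1(2)[OF P12(1)] d2(2)[OF P12(2)] by (intro add_strict_mono mult_strict_left_mono) auto
    also have "... = e" using M'(1) by (simp add: e'_def)
    finally show ?thesis .
  qed
  then show "\<exists>d>0. \<forall>n u v. ?P d n u v \<longrightarrow> (\<Sum>i<n. norm (F (v i) * G (v i) - F (u i) * G (u i))) < e"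
    using d1(1) d2(1) by (intro exI[of _ "min d1 d2"]) auto
qed

lemma abs_continuous_on_subset_cong:
  assumes "abs_continuous_on S F" "I \<subseteq> S" "\<And>x. x \<in> I \<Longrightarrow> F x = G x"
  shows "abs_continuous_on I G"
  unfolding abs_continuous_on_iff
proof (intro allI impI)
  fix e :: real assume "e > 0"
  then obtain d where d: "d > 0" "\<And>n u v. short_intervals S d n u v \<Longrightarrow> (\<Sum>i<n. norm (F (v i) - F (u i))) < e"
    using assms(1) unfolding abs_continuous_on_iff by blast
  have "(\<Sum>i<n. norm (G (v i) - G (u i))) < e" if A: "short_intervals I d n u v" for n u v
  proof -
    have "G (v i) - G (u i) = F (v i) - F (u i)" if "i < n" for i
    proof -
      have "u i \<le> v i" "{u i..v i} \<subseteq> I" using A that unfolding short_intervals_def by blast+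
      then have "u i \<in> I" "v i \<in> I" by auto
      then show ?thesis by (simp add: assms(3))
    qed
    moreover have "short_intervals S d n u v"
      using A assms(2) subset_trans[of _ I S] by (simp add: short_intervals_def)
    ultimately show ?thesis using d(2) by simp
  qed
  then show "\<exists>d>0. \<forall>n u v. short_intervals I d n u v \<longrightarrow> (\<Sum>i<n. norm (G (v i) - G (u i))) < e"
    using d(1) by blast
qed

text \<open>
  Integration by parts with merely integrable derivatives: the product is absolutely continuous and
  obeys the product rule off a null set, so the fundamental theorem applies to it.
\<close>

lemma primitive_on_mult:
  assumes F: "primitive_on a b F f" and G: "primitive_on a b G g"
  shows "primitive_on a b (\<lambda>x. F x * G x) (\<lambda>x. f x * G x + F x * g x)"
proof (rule primitive_onI)
  have cF: "continuous_on {a..b} F" and cG: "continuous_on {a..b} G"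
    using F G by (auto intro: primitive_on_continuous)
  show "(\<lambda>x. f x * G x + F x * g x) absolutely_integrable_on {a..b}"
    using absolutely_integrable_mult_continuous[OF primitive_on_integrable[OF F] cG]
      absolutely_integrable_mult_continuous[OF primitive_on_integrable[OF G] cF]
    by (intro set_integral_add) (auto simp: mult.commute)
  obtain B where B: "\<And>x. x \<in> {a..b} \<Longrightarrow> norm (F x) \<le> B"
    using compact_imp_bounded[OF compact_continuous_image[OF cF compact_Icc]]
    unfolding bounded_iff by blast
  obtain C where C: "\<And>x. x \<in> {a..b} \<Longrightarrow> norm (G x) \<le> C"
    using compact_imp_bounded[OF compact_continuous_image[OF cG compact_Icc]]
    unfolding bounded_iff by blast
  have ac: "abs_continuous_on {a..b} (\<lambda>x. F x * G x)"
    by (rule abs_continuous_on_mult[of _ _ _ _ "max B C"])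
      (use primitive_imp_abs_continuous[OF F] primitive_imp_abs_continuous[OF G] B C in \<open>auto simp: le_max_iff_disj\<close>)
  obtain N1 where N1: "negligible N1" "\<And>x. x \<in> {a<..<b} - N1 \<Longrightarrow> (F has_vector_derivative f x) (at x)"
    using primitive_ae_derivative[OF F] by blast
  obtain N2 where N2: "negligible N2" "\<And>x. x \<in> {a<..<b} - N2 \<Longrightarrow> (G has_vector_derivative g x) (at x)"
    using primitive_ae_derivative[OF G] by blast
  fix c assume c: "c \<in> {a..b}"
  show "((\<lambda>x. f x * G x + F x * g x) has_integral F c * G c - F a * G a) {a..c}"
  proof (rule abs_continuous_has_integral[where N = "N1 \<union> N2 \<union> {a,b}" and F = "\<lambda>x. F x * G x"])
    show "abs_continuous_on {a..c} (\<lambda>x. F x * G x)"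
      by (rule abs_continuous_on_subset_cong[OF ac _ refl]) (use c in auto)
    show "negligible (N1 \<union> N2 \<union> {a,b})" using N1(1) N2(1) by (simp add: negligible_Un)
    fix x assume x: "x \<in> {a..c} - (N1 \<union> N2 \<union> {a,b})"
    have "((\<lambda>x. F x * G x) has_vector_derivative F x * g x + f x * G x) (at x)"
      by (rule has_vector_derivative_mult) (use x c N1(2)[of x] N2(2)[of x] in auto)
    then show "((\<lambda>x. F x * G x) has_vector_derivative f x * G x + F x * g x) (at x within {a..c})"
      by (metis add.commute has_vector_derivative_at_within)
  qed (use c in auto)
qed

lemma primitive_on_constant_AE:
  assumes F: "primitive_on a b F f" and const: "\<And>x. x \<in> {a..b} \<Longrightarrow> F x = F a"
  obtains N where "negligible N" "\<And>x. x \<in> {a<..<b} - N \<Longrightarrow> f x = 0"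
proof -
  obtain N where N: "negligible N" "\<And>x. x \<in> {a<..<b} - N \<Longrightarrow> (F has_vector_derivative f x) (at x)"
    using primitive_ae_derivative[OF F] by blast
  show ?thesis
  proof (rule that[OF N(1)])
    fix x assume x: "x \<in> {a<..<b} - N"
    have "((\<lambda>x. F a) has_vector_derivative 0) (at x)" by simp
    then have "(F has_vector_derivative 0) (at x)"
    proof (rule has_vector_derivative_transform_within_open)
      show "open {a<..<b}" "x \<in> {a<..<b}" using x by auto
      show "F a = F y" if "y \<in> {a<..<b}" for y using const[of y] that by simp
    qed
    then show "f x = 0" using N(2)[OF x] vector_derivative_unique_at by blast
  qed
qed

section \<open>Linear second order equations with integrable coefficients\<close>

text \<open>
  Solutions of \<open>y'' = Q y\<close> with \<open>z = y'\<close>, for a coefficient \<open>Q\<close> that is only integrable.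
\<close>

definition solves ::
  "real \<Rightarrow> real \<Rightarrow> (real \<Rightarrow> complex) \<Rightarrow> (real \<Rightarrow> complex) \<Rightarrow> (real \<Rightarrow> complex) \<Rightarrow> bool" where
  "solves a b Q y z \<longleftrightarrow> primitive_on a b y z \<and> primitive_on a b z (\<lambda>x. Q x * y x)"

lemma solves_subinterval:
  "solves a b Q y z \<Longrightarrow> a \<le> c \<Longrightarrow> d \<le> b \<Longrightarrow> solves c d Q y z"
  unfolding solves_def using primitive_on_subinterval by blast

lemma solves_continuous:
  assumes "solves a b Q y z" shows "continuous_on {a..b} y" "continuous_on {a..b} z"
  using assms primitive_on_continuous unfolding solves_def by blast+

lemma solves_derivative:
  assumes "solves a b Q y z" "x \<in> {a..b}"
  shows "(y has_vector_derivative z x) (at x within {a..b})"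
  using assms primitive_on_C1_derivative[of a b y z] solves_continuous(2)[OF assms(1)]
  unfolding solves_def by blast

lemma solves_combination:
  assumes "solves a b Q y z" "solves a b Q u w"
  shows "solves a b Q (\<lambda>x. c * y x + d * u x) (\<lambda>x. c * z x + d * w x)"
  unfolding solves_def
proof
  show "primitive_on a b (\<lambda>x. c * y x + d * u x) (\<lambda>x. c * z x + d * w x)"
    using assms unfolding solves_def by (intro primitive_on_add primitive_on_cmult) auto
  have "primitive_on a b (\<lambda>x. c * z x + d * w x) (\<lambda>x. c * (Q x * y x) + d * (Q x * u x))"
    using assms unfolding solves_def by (intro primitive_on_add primitive_on_cmult) auto
  then show "primitive_on a b (\<lambda>x. c * z x + d * w x) (\<lambda>x. Q x * (c * y x + d * u x))"
    by (simp add: algebra_simps)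
qed

lemma solves_reflect:
  assumes "solves a b Q y z"
  shows "solves (c - b) (c - a) (\<lambda>x. Q (c - x)) (\<lambda>x. y (c - x)) (\<lambda>x. - z (c - x))"
  unfolding solves_def
proof
  show "primitive_on (c - b) (c - a) (\<lambda>x. y (c - x)) (\<lambda>x. - z (c - x))"
    using assms unfolding solves_def by (intro primitive_on_reflect) auto
  have "primitive_on (c - b) (c - a) (\<lambda>x. -1 * z (c - x)) (\<lambda>x. -1 * - (Q (c - x) * y (c - x)))"
    using assms unfolding solves_def by (intro primitive_on_cmult primitive_on_reflect) auto
  then show "primitive_on (c - b) (c - a) (\<lambda>x. - z (c - x)) (\<lambda>x. Q (c - x) * y (c - x))"
    by simp
qed

text \<open>
  In the derivative of the Wronskian the products of first derivatives cancel. For equal coefficients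
  the Wronskian is constant; for different ones its derivative exhibits their difference.
\<close>

lemma primitive_on_wronskian:
  assumes "solves a b Q y z" "solves a b R u w"
  shows "primitive_on a b (\<lambda>x. y x * w x - u x * z x) (\<lambda>x. (R x - Q x) * (y x * u x))"
proof -
  have "primitive_on a b (\<lambda>x. y x * w x - u x * z x)
      (\<lambda>x. (z x * w x + y x * (R x * u x)) - (w x * z x + u x * (Q x * y x)))"
    using assms unfolding solves_def by (intro primitive_on_diff primitive_on_mult) auto
  then show ?thesis by (simp add: algebra_simps)
qed

lemma solves_wronskian_constant:
  assumes "solves a b Q y z" "solves a b Q u w" "x \<in> {a..b}"
  shows "y x * w x - u x * z x = y a * w a - u a * z a"
  using primitive_onD[OF primitive_on_wronskian[OF assms(1,2)] assms(3)] by simp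

text \<open>
  With zero Cauchy data at \<open>0\<close>, \<open>y'' = w f\<close> is solved by \<open>volterra w f\<close>. The iterated integral is used
  instead of the kernel \<open>x - t\<close> because the inner integral is the derivative of the solution.
\<close>

definition volterra :: "(real \<Rightarrow> complex) \<Rightarrow> (real \<Rightarrow> complex) \<Rightarrow> real \<Rightarrow> complex" where
  "volterra w f x = integral {0..x} (\<lambda>s. integral {0..s} (\<lambda>t. w t * f t))"

lemma primitive_on_indefinite:
  "f absolutely_integrable_on {a..b} \<Longrightarrow> primitive_on a b (\<lambda>x. integral {a..x} f) f"
  by (simp add: primitive_on_def)

lemma primitive_on_volterra:
  assumes w: "w absolutely_integrable_on {0..L}" and f: "continuous_on {0..L} f"
  shows "primitive_on 0 L (\<lambda>s. integral {0..s} (\<lambda>t. w t * f t)) (\<lambda>t. w t * f t)"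
    and "primitive_on 0 L (volterra w f) (\<lambda>s. integral {0..s} (\<lambda>t. w t * f t))"
proof -
  show 1: "primitive_on 0 L (\<lambda>s. integral {0..s} (\<lambda>t. w t * f t)) (\<lambda>t. w t * f t)"
    by (rule primitive_on_indefinite[OF absolutely_integrable_mult_continuous[OF w f]])
  show "primitive_on 0 L (volterra w f) (\<lambda>s. integral {0..s} (\<lambda>t. w t * f t))"
    unfolding volterra_def
    by (rule primitive_on_indefinite[OF absolutely_integrable_continuous_real[OF primitive_on_continuous[OF 1]]])
qed

lemma primitive_on_unique:
  assumes "primitive_on a b F f" "primitive_on a b G f" "F a = G a" "x \<in> {a..b}"
  shows "F x = G x"
  using primitive_onD[OF assms(1,4)] primitive_onD[OF assms(2,4)] assms(3) by simp

text \<open>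
  In the norm weighted by \<open>exp(\<nu> x)\<close> the outer integration gains a factor \<open>1/\<nu>\<close>. For large \<open>\<nu>\<close> the
  Volterra operator is therefore a contraction on the whole interval, however long, and the choice of
  \<open>\<nu>\<close> depends on \<open>w\<close> only through its \<open>L1\<close> norm.
\<close>

lemma volterra_bound:
  assumes w: "w absolutely_integrable_on {0..L}" and f: "continuous_on {0..L} f"
    and I: "integral {0..L} (\<lambda>t. norm (w t)) \<le> I" and I\<nu>: "I / \<nu> \<le> 1/2"
    and C: "\<And>t. t \<in> {0..L} \<Longrightarrow> norm (f t) \<le> C * exp (\<nu> * t)" and \<nu>: "\<nu> > 0"
    and x: "x \<in> {0..L}"
  shows "norm (volterra w f x) \<le> C / 2 * exp (\<nu> * x)"
proof -
  have wn: "(\<lambda>t. norm (w t)) integrable_on {0..L}" and wi: "w integrable_on {0..L}"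
    using w absolutely_integrable_on_def by blast+
  have C0: "C \<ge> 0" using order_trans[OF norm_ge_zero C[of 0]] x by simp
  have wf: "(\<lambda>t. w t * f t) integrable_on {0..L}"
    using absolutely_integrable_mult_continuous[OF w f] absolutely_integrable_on_def by blast
  have I0: "0 \<le> I"
    using I Henstock_Kurzweil_Integration.integral_nonneg[OF wn] by force
  have inner: "norm (integral {0..s} (\<lambda>t. w t * f t)) \<le> C * I * exp (\<nu> * s)" if s: "s \<in> {0..L}" for s
  proof -
    have wns: "(\<lambda>t. norm (w t)) integrable_on {0..s}"
      by (rule integrable_on_subinterval[OF wn]) (use s in auto)
    have "norm (integral {0..s} (\<lambda>t. w t * f t)) \<le> integral {0..s} (\<lambda>t. norm (w t) * (C * exp (\<nu> * s)))"
    proof (rule Henstock_Kurzweil_Integration.integral_norm_bound_integral)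
      show "(\<lambda>t. w t * f t) integrable_on {0..s}"
        by (rule integrable_on_subinterval[OF wf]) (use s in auto)
      show "(\<lambda>t. norm (w t) * (C * exp (\<nu> * s))) integrable_on {0..s}"
        by (rule integrable_on_mult_left[OF wns])
      fix t assume t: "t \<in> {0..s}"
      have "norm (f t) \<le> C * exp (\<nu> * t)" using t s by (intro C) auto
      also have "... \<le> C * exp (\<nu> * s)" using t \<nu> C0 by (intro mult_left_mono) auto
      finally show "norm (w t * f t) \<le> norm (w t) * (C * exp (\<nu> * s))"
        by (simp add: norm_mult mult_left_mono)
    qed
    also have "... = integral {0..s} (\<lambda>t. norm (w t)) * (C * exp (\<nu> * s))" by simp
    also have "... \<le> I * (C * exp (\<nu> * s))"
    proof (rule mult_right_mono)
      have "integral {0..s} (\<lambda>t. norm (w t)) \<le> integral {0..L} (\<lambda>t. norm (w t))"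
        by (rule integral_subset_le) (use s wns wn in auto)
      then show "integral {0..s} (\<lambda>t. norm (w t)) \<le> I" using I by simp
    qed (use C0 in auto)
    finally show ?thesis by (simp add: mult_ac)
  qed
  have int: "((\<lambda>s. C * I * exp (\<nu> * s)) has_integral (C * I / \<nu> * exp (\<nu> * x) - C * I / \<nu> * exp (\<nu> * 0))) {0..x}"
  proof (rule fundamental_theorem_of_calculus)
    fix s
    show "((\<lambda>s. C * I / \<nu> * exp (\<nu> * s)) has_vector_derivative C * I * exp (\<nu> * s)) (at s within {0..x})"
      unfolding has_real_derivative_iff_has_vector_derivative[symmetric]
      using \<nu> by (auto intro!: derivative_eq_intros)
  qed (use x in auto)
  have "norm (volterra w f x) \<le> integral {0..x} (\<lambda>s. C * I * exp (\<nu> * s))"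
    unfolding volterra_def
  proof (rule Henstock_Kurzweil_Integration.integral_norm_bound_integral)
    show "(\<lambda>s. integral {0..s} (\<lambda>t. w t * f t)) integrable_on {0..x}"
      by (rule integrable_continuous_interval)
        (rule continuous_on_subset[OF primitive_on_continuous[OF primitive_on_volterra(1)[OF w f]]], use x in auto)
    show "(\<lambda>s. C * I * exp (\<nu> * s)) integrable_on {0..x}" using int by blast
  qed (use inner x in auto)
  also have "... = C * I / \<nu> * exp (\<nu> * x) - C * I / \<nu> * exp (\<nu> * 0)"
    using int by (rule integral_unique)
  also have "... \<le> C * (I / \<nu>) * exp (\<nu> * x)" using C0 I0 \<nu> by simp
  also have "... \<le> C * (1/2) * exp (\<nu> * x)"
    using I\<nu> C0 by (intro mult_right_mono mult_left_mono) auto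
  finally show ?thesis by simp
qed

lemma volterra_eqI:
  assumes w: "w absolutely_integrable_on {0..L}" and f: "continuous_on {0..L} f"
    and Z: "primitive_on 0 L Z (\<lambda>t. w t * f t)" "Z 0 = 0"
    and Y: "primitive_on 0 L Y Z" "Y 0 = 0" and x: "x \<in> {0..L}"
  shows "volterra w f x = Y x"
proof -
  note V = primitive_on_volterra[OF w f]
  have "Z s = integral {0..s} (\<lambda>t. w t * f t)" if "s \<in> {0..L}" for s
    using primitive_on_unique[OF Z(1) V(1) _ that] Z(2) by simp
  then have "primitive_on 0 L Y (\<lambda>s. integral {0..s} (\<lambda>t. w t * f t))"
    by (rule primitive_on_cong[OF Y(1) refl])
  from primitive_on_unique[OF V(2) this _ x] show ?thesis by (simp add: volterra_def Y(2))
qed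

lemma volterra_add:
  assumes w: "w absolutely_integrable_on {0..L}"
    and f: "continuous_on {0..L} f" and g: "continuous_on {0..L} g" and x: "x \<in> {0..L}"
  shows "volterra w (\<lambda>t. f t + c * g t) x = volterra w f x + c * volterra w g x"
proof (rule volterra_eqI[OF w _ _ _ _ _ x])
  note Pf = primitive_on_volterra[OF w f] and Pg = primitive_on_volterra[OF w g]
  show "continuous_on {0..L} (\<lambda>t. f t + c * g t)" by (intro continuous_intros f g)
  show "primitive_on 0 L (\<lambda>s. integral {0..s} (\<lambda>t. w t * f t) + c * integral {0..s} (\<lambda>t. w t * g t))
      (\<lambda>t. w t * (f t + c * g t))"
    using primitive_on_add[OF Pf(1) primitive_on_cmult[OF Pg(1), of c]] by (simp add: algebra_simps)
  show "primitive_on 0 L (\<lambda>x. volterra w f x + c * volterra w g x)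
      (\<lambda>s. integral {0..s} (\<lambda>t. w t * f t) + c * integral {0..s} (\<lambda>t. w t * g t))"
    by (rule primitive_on_add[OF Pf(2) primitive_on_cmult[OF Pg(2)]])
qed (simp_all add: volterra_def)

lemma volterra_weight_add:
  assumes v: "v absolutely_integrable_on {0..L}" and w: "w absolutely_integrable_on {0..L}"
    and f: "continuous_on {0..L} f" and x: "x \<in> {0..L}"
  shows "volterra (\<lambda>t. v t + c * w t) f x = volterra v f x + c * volterra w f x"
proof (rule volterra_eqI[OF _ f _ _ _ _ x])
  note Pv = primitive_on_volterra[OF v f] and Pw = primitive_on_volterra[OF w f]
  show "(\<lambda>t. v t + c * w t) absolutely_integrable_on {0..L}"
    using v w by (intro set_integral_add(1) set_integrable_mult_right) auto
  show "primitive_on 0 L (\<lambda>s. integral {0..s} (\<lambda>t. v t * f t) + c * integral {0..s} (\<lambda>t. w t * f t))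
      (\<lambda>t. (v t + c * w t) * f t)"
    using primitive_on_add[OF Pv(1) primitive_on_cmult[OF Pw(1), of c]] by (simp add: algebra_simps)
  show "primitive_on 0 L (\<lambda>x. volterra v f x + c * volterra w f x)
      (\<lambda>s. integral {0..s} (\<lambda>t. v t * f t) + c * integral {0..s} (\<lambda>t. w t * f t))"
    by (rule primitive_on_add[OF Pv(2) primitive_on_cmult[OF Pw(2)]])
qed (simp_all add: volterra_def)

lemma volterra_cong:
  assumes "\<And>t. t \<in> {0..L} \<Longrightarrow> f t = g t" "x \<in> {0..L}"
  shows "volterra w f x = volterra w g x"
  unfolding volterra_def
  by (intro Henstock_Kurzweil_Integration.integral_cong) (use assms in auto)

lemma volterra_fixpoint_zero:
  assumes w: "w absolutely_integrable_on {0..L}" and f: "continuous_on {0..L} f"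
    and fp: "\<And>x. x \<in> {0..L} \<Longrightarrow> f x = volterra w f x" and x: "x \<in> {0..L}"
  shows "f x = 0"
proof -
  define I where "I = integral {0..L} (\<lambda>t. norm (w t))"
  have I0: "I \<ge> 0" unfolding I_def
    by (rule Henstock_Kurzweil_Integration.integral_nonneg) (use w absolutely_integrable_on_def in blast, auto)
  define \<nu> where "\<nu> = 2 * I + 1"
  have \<nu>: "\<nu> > 0" "I / \<nu> \<le> 1/2" using I0 by (auto simp: \<nu>_def field_simps)
  obtain B where B: "\<And>t. t \<in> {0..L} \<Longrightarrow> norm (f t) \<le> B"
    using compact_imp_bounded[OF compact_continuous_image[OF f compact_Icc]] unfolding bounded_iff by blast
  have B0: "B \<ge> 0" using order_trans[OF norm_ge_zero B[OF x]] .
  have bound: "norm (f t) \<le> B * (1/2)^n * exp (\<nu> * t)" if "t \<in> {0..L}" for n t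
    using that
  proof (induction n arbitrary: t)
    case 0
    have "B * 1 \<le> B * exp (\<nu> * t)" using 0 \<nu> B0 by (intro mult_left_mono) auto
    then show ?case using B[OF 0] by simp
  next
    case (Suc n)
    have "norm (volterra w f t) \<le> B * (1/2)^n / 2 * exp (\<nu> * t)"
      by (rule volterra_bound[OF w f _ \<nu>(2) Suc.IH \<nu>(1) Suc.prems]) (simp_all add: I_def)
    then show ?case using fp[OF Suc.prems] by simp
  qed
  have "(\<lambda>n. B * (1/2)^n * exp (\<nu> * x)) \<longlonglongrightarrow> B * 0 * exp (\<nu> * x)"
    by (intro tendsto_intros LIMSEQ_power_zero) simp
  then have "norm (f x) \<le> B * 0 * exp (\<nu> * x)"
    by (rule LIMSEQ_le_const) (use bound[OF x] in blast)
  then show ?thesis by simp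
qed

lemma solves_unique:
  assumes Q: "Q absolutely_integrable_on {0..L}"
    and 1: "solves 0 L Q y z" and 2: "solves 0 L Q u w" and init: "y 0 = u 0" "z 0 = w 0"
    and x: "x \<in> {0..L}"
  shows "y x = u x" "z x = w x"
proof -
  define d where "d = (\<lambda>x. 1 * y x + (-1) * u x)"
  define e where "e = (\<lambda>x. 1 * z x + (-1) * w x)"
  have s: "solves 0 L Q d e" unfolding d_def e_def by (rule solves_combination[OF 1 2])
  then have P: "primitive_on 0 L d e" "primitive_on 0 L e (\<lambda>x. Q x * d x)" by (auto simp: solves_def)
  have d0: "d 0 = 0" "e 0 = 0" using init by (auto simp: d_def e_def)
  have cd: "continuous_on {0..L} d" using solves_continuous[OF s] by simp
  have "d s = volterra Q d s" if "s \<in> {0..L}" for s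
    by (rule volterra_eqI[OF Q cd P(2) d0(2) P(1) d0(1) that, symmetric])
  then have dz: "d s = 0" if "s \<in> {0..L}" for s
    using volterra_fixpoint_zero[OF Q cd _ that] by blast
  show "y x = u x" using dz[OF x] by (simp add: d_def)
  have "integral {0..x} (\<lambda>t. Q t * d t) = integral {0..x} (\<lambda>t. 0)"
    by (rule Henstock_Kurzweil_Integration.integral_cong) (use dz x in auto)
  then have "e x = 0" using primitive_onD[OF P(2) x] d0(2) by simp
  then show "z x = w x" by (simp add: e_def)
qed

section \<open>Holomorphic dependence on the spectral parameter\<close>

definition pencil_coeff :: "(real \<Rightarrow> complex) \<Rightarrow> (real \<Rightarrow> complex) \<Rightarrow> complex \<Rightarrow> real \<Rightarrow> complex" where
  "pencil_coeff p q \<mu> x = 2 * \<mu> * p x + q x - \<mu>\<^sup>2"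

lemma pencil_coeff_integrable:
  assumes "p absolutely_integrable_on {a..b}" "q absolutely_integrable_on {a..b}"
  shows "pencil_coeff p q \<mu> absolutely_integrable_on {a..b}"
proof -
  have "(\<lambda>x. 2 * \<mu> * p x + q x - \<mu>\<^sup>2) absolutely_integrable_on {a..b}"
    using assms
    by (intro set_integral_add(1) set_integral_diff(1) set_integrable_mult_right absolutely_integrable_on_const) auto
  then show ?thesis by (simp add: pencil_coeff_def[abs_def])
qed

text \<open>
  The Picard iterates are polynomials in the parameter whose coefficients are continuous in \<open>x\<close>. This
  gives their holomorphy without differentiating under an integral sign. The last rule is present
  because integrals are controlled only for \<open>x\<close> in \<open>[0,L]\<close>.
\<close>

inductive poly_in_param :: "real \<Rightarrow> (real \<Rightarrow> complex \<Rightarrow> complex) \<Rightarrow> bool" for L where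
  const: "continuous_on {0..L} c \<Longrightarrow> poly_in_param L (\<lambda>x \<mu>. c x)"
| times_param: "poly_in_param L F \<Longrightarrow> poly_in_param L (\<lambda>x \<mu>. \<mu> * F x \<mu>)"
| add: "poly_in_param L F \<Longrightarrow> poly_in_param L G \<Longrightarrow> poly_in_param L (\<lambda>x \<mu>. F x \<mu> + G x \<mu>)"
| cong: "poly_in_param L F \<Longrightarrow> (\<And>x \<mu>. x \<in> {0..L} \<Longrightarrow> F x \<mu> = G x \<mu>) \<Longrightarrow> poly_in_param L G"

lemma poly_in_param_continuous: "poly_in_param L F \<Longrightarrow> continuous_on {0..L} (\<lambda>x. F x \<mu>)"
proof (induction rule: poly_in_param.induct)
  case (cong F G)
  then show ?case by (metis (no_types, lifting) continuous_on_cong)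
qed (auto intro!: continuous_intros)

lemma poly_in_param_holomorphic: "poly_in_param L F \<Longrightarrow> x \<in> {0..L} \<Longrightarrow> F x holomorphic_on UNIV"
proof (induction rule: poly_in_param.induct)
  case (cong F G)
  then have "F x = G x" by auto
  then show ?case using cong by simp
qed (auto intro!: holomorphic_intros)

lemma poly_in_param_volterra:
  assumes w: "w absolutely_integrable_on {0..L}" and F: "poly_in_param L F"
  shows "poly_in_param L (\<lambda>x \<mu>. volterra w (\<lambda>t. F t \<mu>) x)"
  using F
proof (induction rule: poly_in_param.induct)
  case (const c)
  show ?case
    by (rule poly_in_param.const)
      (rule primitive_on_continuous[OF primitive_on_volterra(2)[OF w const]])
next
  case (times_param F)
  show ?case
  proof (rule poly_in_param.cong[OF poly_in_param.times_param[OF times_param.IH]])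
    fix x \<mu> assume x: "x \<in> {0..L}"
    have "volterra w (\<lambda>t. 0 + \<mu> * F t \<mu>) x = volterra w (\<lambda>t. 0) x + \<mu> * volterra w (\<lambda>t. F t \<mu>) x"
      by (rule volterra_add[OF w _ poly_in_param_continuous[OF times_param.hyps] x]) simp
    then show "\<mu> * volterra w (\<lambda>t. F t \<mu>) x = volterra w (\<lambda>t. \<mu> * F t \<mu>) x"
      by (simp add: volterra_def)
  qed
next
  case (add F G)
  show ?case
  proof (rule poly_in_param.cong[OF poly_in_param.add[OF add.IH]])
    fix x \<mu> assume x: "x \<in> {0..L}"
    show "volterra w (\<lambda>t. F t \<mu>) x + volterra w (\<lambda>t. G t \<mu>) x = volterra w (\<lambda>t. F t \<mu> + G t \<mu>) x"
      using volterra_add[OF w poly_in_param_continuous[OF add.hyps(1)] poly_in_param_continuous[OF add.hyps(2)] x, of \<mu> 1 \<mu>]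
      by simp
  qed
next
  case (cong F G)
  show ?case
  proof (rule poly_in_param.cong[OF cong.IH])
    fix x \<mu> assume x: "x \<in> {0..L}"
    show "volterra w (\<lambda>t. F t \<mu>) x = volterra w (\<lambda>t. G t \<mu>) x"
      by (rule volterra_cong[OF _ x]) (use cong.hyps in auto)
  qed
qed

lemma poly_in_param_volterra_pencil:
  assumes p: "p absolutely_integrable_on {0..L}" and q: "q absolutely_integrable_on {0..L}"
    and F: "poly_in_param L F"
  shows "poly_in_param L (\<lambda>x \<mu>. volterra (pencil_coeff p q \<mu>) (\<lambda>t. F t \<mu>) x)"
proof (rule poly_in_param.cong)
  have p2: "(\<lambda>t. 2 * p t) absolutely_integrable_on {0..L}" using p by (intro set_integrable_mult_right) auto
  have c: "(\<lambda>t. -1 :: complex) absolutely_integrable_on {0..L}" by (intro absolutely_integrable_on_const) auto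
  show "poly_in_param L (\<lambda>x \<mu>. volterra q (\<lambda>t. F t \<mu>) x
      + \<mu> * (volterra (\<lambda>t. 2 * p t) (\<lambda>t. F t \<mu>) x + \<mu> * volterra (\<lambda>t. -1) (\<lambda>t. F t \<mu>) x))"
    by (intro poly_in_param.add poly_in_param.times_param poly_in_param_volterra[OF _ F] q p2 c)
  fix x \<mu> assume x: "x \<in> {0..L}"
  have s: "(\<lambda>t. 2 * p t + \<mu> * (-1)) absolutely_integrable_on {0..L}"
    using p2 c by (intro set_integral_add(1) set_integrable_mult_right) auto
  have eq: "pencil_coeff p q \<mu> = (\<lambda>t. q t + \<mu> * (2 * p t + \<mu> * (-1)))"
    by (auto simp: pencil_coeff_def algebra_simps power2_eq_square)
  note Fc = poly_in_param_continuous[OF F]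
  show "volterra q (\<lambda>t. F t \<mu>) x
      + \<mu> * (volterra (\<lambda>t. 2 * p t) (\<lambda>t. F t \<mu>) x + \<mu> * volterra (\<lambda>t. -1) (\<lambda>t. F t \<mu>) x)
      = volterra (pencil_coeff p q \<mu>) (\<lambda>t. F t \<mu>) x"
    unfolding eq volterra_weight_add[OF q s Fc x] volterra_weight_add[OF p2 c Fc x] ..
qed

abbreviation L1_norm :: "real \<Rightarrow> (real \<Rightarrow> complex) \<Rightarrow> real" where
  "L1_norm L f \<equiv> integral {0..L} (\<lambda>t. norm (f t))"

lemma pencil_coeff_norm_bound:
  assumes L: "0 \<le> L" and p: "p absolutely_integrable_on {0..L}" and q: "q absolutely_integrable_on {0..L}"
    and M: "norm \<mu> \<le> M"
  shows "L1_norm L (pencil_coeff p q \<mu>)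
    \<le> 2 * M * L1_norm L p + L1_norm L q + M\<^sup>2 * L"
proof -
  have i: "(\<lambda>t. norm (p t)) integrable_on {0..L}" "(\<lambda>t. norm (q t)) integrable_on {0..L}"
    using p q absolutely_integrable_on_def by blast+
  have "L1_norm L (pencil_coeff p q \<mu>)
      \<le> integral {0..L} (\<lambda>t. 2 * M * norm (p t) + norm (q t) + M\<^sup>2)"
  proof (rule integral_le)
    show "(\<lambda>t. norm (pencil_coeff p q \<mu> t)) integrable_on {0..L}"
      using pencil_coeff_integrable[OF p q] absolutely_integrable_on_def by blast
    show "(\<lambda>t. 2 * M * norm (p t) + norm (q t) + M\<^sup>2) integrable_on {0..L}"
      by (intro integrable_add integrable_on_mult_right i integrable_const_ivl)
    fix t
    have "norm (pencil_coeff p q \<mu> t) \<le> norm (2 * \<mu> * p t) + norm (q t) + norm (\<mu>\<^sup>2)"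
      unfolding pencil_coeff_def by (intro norm_triangle_le_diff add_mono norm_triangle_ineq) simp
    also have "... = 2 * norm \<mu> * norm (p t) + norm (q t) + (norm \<mu>)\<^sup>2"
      by (simp add: norm_mult norm_power)
    also have "... \<le> 2 * M * norm (p t) + norm (q t) + M\<^sup>2"
      using M by (intro add_mono mult_right_mono power_mono) auto
    finally show "norm (pencil_coeff p q \<mu> t) \<le> 2 * M * norm (p t) + norm (q t) + M\<^sup>2" .
  qed
  also have "... = 2 * M * L1_norm L p + L1_norm L q + M\<^sup>2 * L"
  proof (rule integral_unique)
    have "((\<lambda>t. M\<^sup>2) has_integral M\<^sup>2 * L) {0..L}"
      using has_integral_const_real[of "M\<^sup>2" 0 L] L by (simp add: mult.commute)
    then show "((\<lambda>t. 2 * M * norm (p t) + norm (q t) + M\<^sup>2) has_integral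
        2 * M * L1_norm L p + L1_norm L q + M\<^sup>2 * L) {0..L}"
      by (intro has_integral_add has_integral_mult_right integrable_integral i)
  qed
  finally show ?thesis .
qed

text \<open>
  Picard iteration. For \<open>\<mu>\<close> in a disc one weight \<open>\<nu>\<close> serves all coefficients, so the iterates converge
  uniformly in \<open>x\<close> and locally uniformly in \<open>\<mu>\<close>, and the limit is entire in \<open>\<mu>\<close>.
\<close>

lemma pencil_family_exists:
  assumes L: "0 \<le> L" and p: "p absolutely_integrable_on {0..L}" and q: "q absolutely_integrable_on {0..L}"
  obtains y z where "\<And>\<mu>. solves 0 L (pencil_coeff p q \<mu>) (\<lambda>x. y x \<mu>) (\<lambda>x. z x \<mu>)"
    "\<And>\<mu>. y 0 \<mu> = \<alpha>" "\<And>\<mu>. z 0 \<mu> = \<beta>" "\<And>x. x \<in> {0..L} \<Longrightarrow> y x holomorphic_on UNIV"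
proof -
  define b :: "real \<Rightarrow> complex" where "b = (\<lambda>x. \<alpha> + \<beta> * of_real x)"
  have bc: "continuous_on {0..L} b" unfolding b_def by (intro continuous_intros)
  define Y where "Y = rec_nat (\<lambda>x \<mu>. b x)
    (\<lambda>n F x \<mu>. b x + volterra (pencil_coeff p q \<mu>) (\<lambda>t. F t \<mu>) x)"
  have Y0: "Y 0 x \<mu> = b x" and YS: "Y (Suc n) x \<mu> = b x + volterra (pencil_coeff p q \<mu>) (\<lambda>t. Y n t \<mu>) x" for n x \<mu>
    by (auto simp: Y_def)
  have poly: "poly_in_param L (Y n)" for n
  proof (induction n)
    case 0
    then show ?case by (rule poly_in_param.cong[OF poly_in_param.const[OF bc]]) (simp add: Y0)
  next
    case (Suc n)
    then show ?case
      by (rule poly_in_param.cong[OF poly_in_param.add[OF poly_in_param.const[OF bc]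
              poly_in_param_volterra_pencil[OF p q]]]) (simp add: YS)
  qed
  note Yc = poly_in_param_continuous[OF poly]
  note Qi = pencil_coeff_integrable[OF p q]
  define y where "y = (\<lambda>x \<mu>. Y 0 x \<mu> + (\<Sum>k. Y (Suc k) x \<mu> - Y k x \<mu>))"
  obtain B where B: "\<And>t. t \<in> {0..L} \<Longrightarrow> norm (b t) \<le> B"
    using compact_imp_bounded[OF compact_continuous_image[OF bc compact_Icc]] unfolding bounded_iff by blast
  have B0: "B \<ge> 0" using order_trans[OF norm_ge_zero B[of 0]] L by simp
  have bounds: "\<exists>I \<nu>. \<nu> > 0 \<and> I / \<nu> \<le> 1/2 \<and>
      (\<forall>\<mu>. norm \<mu> \<le> M \<longrightarrow> L1_norm L (pencil_coeff p q \<mu>) \<le> I)" if M: "M \<ge> 0" for M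
  proof -
    define I where "I = 2 * M * L1_norm L p + L1_norm L q + M\<^sup>2 * L"
    have i: "(\<lambda>t. norm (p t)) integrable_on {0..L}" "(\<lambda>t. norm (q t)) integrable_on {0..L}"
      using p q absolutely_integrable_on_def by blast+
    have "I \<ge> 0"
      unfolding I_def using M L
      by (intro add_nonneg_nonneg mult_nonneg_nonneg Henstock_Kurzweil_Integration.integral_nonneg i) auto
    then have "2 * I + 1 > 0" "I / (2 * I + 1) \<le> 1/2" by (auto simp: field_simps)
    then show ?thesis using pencil_coeff_norm_bound[OF L p q, of _ M] unfolding I_def[symmetric] by blast
  qed
  have ulim: "uniform_limit ({0..L} \<times> cball 0 M) (\<lambda>n (x,\<mu>). Y n x \<mu>) (\<lambda>(x,\<mu>). y x \<mu>) sequentially"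
    if M: "M \<ge> 0" for M
  proof -
    from bounds[OF M] obtain I \<nu> where \<nu>: "\<nu> > 0" "I / \<nu> \<le> 1/2"
      and I: "\<And>\<mu>. norm \<mu> \<le> M \<Longrightarrow> L1_norm L (pencil_coeff p q \<mu>) \<le> I" by blast
    have d: "norm (Y (Suc n) x \<mu> - Y n x \<mu>) \<le> B * (1/2)^n * exp (\<nu> * x)"
      if x: "x \<in> {0..L}" and \<mu>: "norm \<mu> \<le> M" for x \<mu> n
      using x
    proof (induction n arbitrary: x)
      case 0
      have "norm (b t) \<le> B * exp (\<nu> * t)" if "t \<in> {0..L}" for t
      proof -
        have "B * 1 \<le> B * exp (\<nu> * t)" using that \<nu> B0 by (intro mult_left_mono) auto
        then show ?thesis using B[OF that] by simp
      qed
      then have "norm (volterra (pencil_coeff p q \<mu>) b x) \<le> B / 2 * exp (\<nu> * x)"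
        by (rule volterra_bound[OF Qi bc I[OF \<mu>] \<nu>(2) _ \<nu>(1) 0])
      also have "... \<le> B * exp (\<nu> * x)" using B0 by (intro mult_right_mono) auto
      finally show ?case by (simp add: YS Y0)
    next
      case (Suc n)
      have c: "continuous_on {0..L} (\<lambda>t. Y (Suc n) t \<mu> + (-1) * Y n t \<mu>)"
        by (intro continuous_intros Yc)
      have "Y (Suc (Suc n)) x \<mu> - Y (Suc n) x \<mu>
        = volterra (pencil_coeff p q \<mu>) (\<lambda>t. Y (Suc n) t \<mu> + (-1) * Y n t \<mu>) x"
        unfolding volterra_add[OF Qi Yc Yc Suc.prems] by (simp add: YS[of "Suc n"] YS[of n x])
      also have "norm ... \<le> B * (1/2)^n / 2 * exp (\<nu> * x)"
        by (rule volterra_bound[OF Qi c I[OF \<mu>] \<nu>(2) _ \<nu>(1) Suc.prems]) (use Suc.IH in simp)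
      finally show ?case by simp
    qed
    have "uniform_limit ({0..L} \<times> cball 0 M) (\<lambda>n x. \<Sum>i<n. (case x of (x,\<mu>) \<Rightarrow> Y (Suc i) x \<mu> - Y i x \<mu>))
        (\<lambda>x. suminf (\<lambda>i. case x of (x,\<mu>) \<Rightarrow> Y (Suc i) x \<mu> - Y i x \<mu>)) sequentially"
    proof (rule Weierstrass_m_test)
      show "summable (\<lambda>n. B * exp (\<nu> * L) * (1/2)^n)"
        by (intro summable_mult summable_geometric) simp
      fix n and v :: "real \<times> complex" assume v: "v \<in> {0..L} \<times> cball 0 M"
      obtain x \<mu> where xm: "v = (x,\<mu>)" by (cases v)
      then have x: "x \<in> {0..L}" and \<mu>: "norm \<mu> \<le> M" using v by auto
      have "B * (1/2)^n * exp (\<nu> * x) \<le> B * (1/2)^n * exp (\<nu> * L)"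
        using x \<nu> B0 by (intro mult_left_mono) auto
      then show "norm (case v of (x,\<mu>) \<Rightarrow> Y (Suc n) x \<mu> - Y n x \<mu>) \<le> B * exp (\<nu> * L) * (1/2)^n"
        using d[OF x \<mu>, of n] xm by (simp add: mult_ac)
    qed
    moreover have "(\<Sum>i<n. Y (Suc i) x \<mu> - Y i x \<mu>) = Y n x \<mu> - Y 0 x \<mu>" for n x \<mu>
      by (rule sum_lessThan_telescope)
    ultimately show ?thesis
      unfolding uniform_limit_iff y_def by (simp add: case_prod_unfold dist_norm diff_diff_eq)
  qed
  have ulx: "uniform_limit {0..L} (\<lambda>n x. Y n x \<mu>) (\<lambda>x. y x \<mu>) sequentially" for \<mu>
    using ulim[of "norm \<mu>"] unfolding uniform_limit_iff by (force elim!: eventually_mono)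
  have yc: "continuous_on {0..L} (\<lambda>x. y x \<mu>)" for \<mu>
    by (rule uniform_limit_theorem[OF always_eventually[OF allI[OF Yc]] ulx]) simp
  have yfix: "y x \<mu> = b x + volterra (pencil_coeff p q \<mu>) (\<lambda>t. y t \<mu>) x" if x: "x \<in> {0..L}" for x \<mu>
  proof -
    obtain I \<nu> where \<nu>: "\<nu> > 0" "I / \<nu> \<le> 1/2"
      and I: "L1_norm L (pencil_coeff p q \<mu>) \<le> I"
      using bounds[of "norm \<mu>"] by auto
    have lim1: "(\<lambda>n. Y (Suc n) x \<mu>) \<longlonglongrightarrow> b x + volterra (pencil_coeff p q \<mu>) (\<lambda>t. y t \<mu>) x"
    proof (rule tendstoI)
      fix e :: real assume e: "e > 0"
      define e' where "e' = e * exp (- \<nu> * x)"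
      have e': "e' > 0" using e by (simp add: e'_def)
      have "eventually (\<lambda>n. \<forall>t\<in>{0..L}. dist (Y n t \<mu>) (y t \<mu>) < e') sequentially"
        using ulx e' unfolding uniform_limit_iff by blast
      then show "eventually (\<lambda>n. dist (Y (Suc n) x \<mu>) (b x + volterra (pencil_coeff p q \<mu>) (\<lambda>t. y t \<mu>) x) < e) sequentially"
      proof (rule eventually_mono)
        fix n assume n: "\<forall>t\<in>{0..L}. dist (Y n t \<mu>) (y t \<mu>) < e'"
        have c: "continuous_on {0..L} (\<lambda>t. Y n t \<mu> + (-1) * y t \<mu>)" by (intro continuous_intros Yc yc)
        have "norm (volterra (pencil_coeff p q \<mu>) (\<lambda>t. Y n t \<mu> + (-1) * y t \<mu>) x) \<le> e' / 2 * exp (\<nu> * x)"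
        proof (rule volterra_bound[OF Qi c I \<nu>(2) _ \<nu>(1) x])
          fix t assume t: "t \<in> {0..L}"
          have "e' * 1 \<le> e' * exp (\<nu> * t)" using t \<nu> e' by (intro mult_left_mono) auto
          then show "norm (Y n t \<mu> + (-1) * y t \<mu>) \<le> e' * exp (\<nu> * t)"
            using n t by (force simp: dist_norm)
        qed
        also have "... = e / 2" by (simp add: e'_def exp_minus)
        finally show "dist (Y (Suc n) x \<mu>) (b x + volterra (pencil_coeff p q \<mu>) (\<lambda>t. y t \<mu>) x) < e"
          unfolding volterra_add[OF Qi Yc yc x] using e by (simp add: YS dist_norm)
      qed
    qed
    have "(\<lambda>n. Y n x \<mu>) \<longlonglongrightarrow> y x \<mu>"
      by (rule tendsto_uniform_limitI[OF ulx x])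
    then have "(\<lambda>n. Y (Suc n) x \<mu>) \<longlonglongrightarrow> y x \<mu>" by (rule LIMSEQ_Suc)
    then show ?thesis using lim1 LIMSEQ_unique by blast
  qed
  define z where "z = (\<lambda>x \<mu>. \<beta> + integral {0..x} (\<lambda>t. pencil_coeff p q \<mu> t * y t \<mu>))"
  have "solves 0 L (pencil_coeff p q \<mu>) (\<lambda>x. y x \<mu>) (\<lambda>x. z x \<mu>)" for \<mu>
    unfolding solves_def
  proof
    note V = primitive_on_volterra[OF Qi yc, of \<mu> \<mu>]
    have c: "primitive_on 0 L (\<lambda>x. \<beta>) (\<lambda>x. 0)" by (rule primitive_on_C1) auto
    have b: "primitive_on 0 L b (\<lambda>x. \<beta>)"
      unfolding b_def by (rule primitive_on_C1) (auto intro!: derivative_eq_intros)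
    show "primitive_on 0 L (\<lambda>x. z x \<mu>) (\<lambda>x. pencil_coeff p q \<mu> x * y x \<mu>)"
      unfolding z_def using primitive_on_add[OF c V(1)] by simp
    show "primitive_on 0 L (\<lambda>x. y x \<mu>) (\<lambda>x. z x \<mu>)"
      unfolding z_def by (rule primitive_on_cong[OF primitive_on_add[OF b V(2)]]) (simp_all add: yfix[symmetric])
  qed
  moreover have "y 0 \<mu> = \<alpha>" for \<mu> using yfix[of 0 \<mu>] L by (simp add: volterra_def b_def)
  moreover have "z 0 \<mu> = \<beta>" for \<mu> by (simp add: z_def)
  moreover have "y x holomorphic_on UNIV" if x: "x \<in> {0..L}" for x
  proof (rule holomorphic_uniform_sequence)
    show "Y n x holomorphic_on UNIV" for n by (rule poly_in_param_holomorphic[OF poly x])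
    fix \<mu> :: complex
    have "cball \<mu> 1 \<subseteq> cball 0 (norm \<mu> + 1)"
      by (auto simp: dist_norm) (metis add.commute add_left_mono norm_minus_commute norm_triangle_sub order_trans)
    then have "uniform_limit (cball \<mu> 1) (\<lambda>n. Y n x) (y x) sequentially"
      using ulim[of "norm \<mu> + 1"] x unfolding uniform_limit_iff by (force elim!: eventually_mono)
    then show "\<exists>d>0. cball \<mu> d \<subseteq> UNIV \<and> uniform_limit (cball \<mu> d) (\<lambda>n. Y n x) (y x) sequentially"
      by (intro exI[of _ 1]) auto
  qed auto
  ultimately show ?thesis using that by blast
qed

section \<open>Asymptotics for large spectral parameter\<close>

abbreviation growth :: "complex \<Rightarrow> real \<Rightarrow> real" where
  "growth \<mu> x \<equiv> exp (\<bar>Im \<mu>\<bar> * x)"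

lemma norm_integral_le_total:
  fixes p :: "real \<Rightarrow> complex"
  assumes p: "p absolutely_integrable_on {0..L}" and tx: "0 \<le> t" "t \<le> x" "x \<le> L"
  shows "norm (integral {t..x} p) \<le> L1_norm L p"
proof -
  have i: "p integrable_on {0..L}" "(\<lambda>t. norm (p t)) integrable_on {0..L}"
    using p absolutely_integrable_on_def by blast+
  have "norm (integral {t..x} p) \<le> integral {t..x} (\<lambda>t. norm (p t))"
    by (rule Henstock_Kurzweil_Integration.integral_norm_bound_integral)
      (use i tx in \<open>auto intro: integrable_on_subinterval\<close>)
  also have "... \<le> L1_norm L p"
    by (rule integral_subset_le) (use i tx in \<open>auto intro: integrable_on_subinterval\<close>)
  finally show ?thesis .
qed

lemma norm_exp_imaginary_le:
  assumes "\<omega> = \<i> \<or> \<omega> = - \<i>"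
  shows "norm (exp (\<omega> * (\<mu> * of_real h - d))) \<le> exp (\<bar>Im \<mu>\<bar> * \<bar>h\<bar> + norm d)"
proof -
  have "Re (\<omega> * (\<mu> * of_real h - d)) \<le> \<bar>Im (\<mu> * of_real h - d)\<bar>"
    using assms by auto
  also have "... \<le> \<bar>Im (\<mu> * of_real h)\<bar> + \<bar>Im d\<bar>" by simp
  also have "... \<le> \<bar>Im \<mu>\<bar> * \<bar>h\<bar> + norm d"
    by (intro add_mono abs_Im_le_cmod) (simp add: abs_mult)
  finally show ?thesis by (simp add: norm_exp_eq_Re)
qed

lemma perturbation_integrable:
  fixes p q s s' :: "real \<Rightarrow> complex"
  assumes "continuous_on {0..L} p" "continuous_on {0..L} s" "continuous_on {0..L} s'"
    and "q absolutely_integrable_on {0..L}"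
  shows "(\<lambda>t. norm (p t * s t) + norm (q t) + norm (s' t)) integrable_on {0..L}"
proof -
  have "(\<lambda>t. norm (q t)) integrable_on {0..L}" using assms(4) absolutely_integrable_on_def by blast
  moreover have "(\<lambda>t. norm (p t * s t)) integrable_on {0..L}" "(\<lambda>t. norm (s' t)) integrable_on {0..L}"
    by (intro integrable_continuous_interval continuous_intros assms(1-3))+
  ultimately show ?thesis by (intro integrable_add)
qed

text \<open>
  Let \<open>s\<close> be a smooth approximation of \<open>p\<close> and \<open>\<omega> = \<plusminus>i\<close>. The combination
  \<open>w = y' + \<omega> (\<mu> - s) y\<close> nearly solves the first order equation \<open>w' = \<omega> (\<mu> - p) w\<close>, whose solution is
  \<open>exp(\<omega> (\<mu> x - P(x)))\<close> with \<open>P(x)\<close> the integral of \<open>p\<close> over \<open>[0,x]\<close>. Multiplying by the inverse of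
  this exponential and integrating expresses the error through the residual \<open>g\<close>, in which \<open>p - s\<close>
  multiplies \<open>y'\<close> and \<open>\<mu> y\<close>, while the remaining terms are of order \<open>1 / \<mu>\<close> compared with \<open>\<mu> y\<close>.
\<close>

lemma oscillation_estimate:
  fixes p q s s' :: "real \<Rightarrow> complex"
  assumes L: "0 \<le> L" and pc: "continuous_on {0..L} p" and q: "q absolutely_integrable_on {0..L}"
    and s: "\<And>x. x \<in> {0..L} \<Longrightarrow> (s has_vector_derivative s' x) (at x within {0..L})"
    and s'c: "continuous_on {0..L} s'"
    and \<epsilon>: "\<And>x. x \<in> {0..L} \<Longrightarrow> norm (p x - s x) \<le> \<epsilon>"
    and sol: "solves 0 L (pencil_coeff p q \<mu>) y z" and init: "y 0 = 0" "z 0 = 1"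
    and \<omega>: "\<omega> = \<i> \<or> \<omega> = - \<i>" and \<mu>: "\<mu> \<noteq> 0"
    and Y: "\<And>t. t \<in> {0..L} \<Longrightarrow> norm (\<mu> * y t) \<le> Y * growth \<mu> t"
      "\<And>t. t \<in> {0..L} \<Longrightarrow> norm (z t) \<le> Y * growth \<mu> t"
    and x: "x \<in> {0..L}"
  shows "norm (z x + \<omega> * (\<mu> - s x) * y x - exp (\<omega> * (\<mu> * of_real x - integral {0..x} p)))
    \<le> exp (L1_norm L p) *
       (2 * \<epsilon> * L + integral {0..L} (\<lambda>t. norm (p t * s t) + norm (q t) + norm (s' t)) / norm \<mu>) *
       Y * growth \<mu> x"
proof -
  define P where "P = (\<lambda>x. integral {0..x} p)"
  define B where "B = L1_norm L p"
  define h where "h = (\<lambda>t. norm (p t * s t) + norm (q t) + norm (s' t))"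
  define E where "E = (\<lambda>x. exp (- (\<omega> * (\<mu> * of_real x - P x))))"
  define g where "g = (\<lambda>t. \<omega> * (p t - s t) * z t + (\<mu> * (p t - s t) + p t * s t + q t - \<omega> * s' t) * y t)"
  have \<omega>2: "\<omega> * \<omega> = -1" "norm \<omega> = 1" using \<omega> by auto
  have p: "p absolutely_integrable_on {0..L}" by (rule absolutely_integrable_continuous_real[OF pc])
  have sc: "continuous_on {0..L} s" using s by (rule continuous_on_vector_derivative)
  have Pd: "(P has_vector_derivative p x) (at x within {0..L})" if "x \<in> {0..L}" for x
    unfolding P_def by (rule integral_has_vector_derivative[OF pc that])
  have Pc: "continuous_on {0..L} P" using Pd by (rule continuous_on_vector_derivative)
  have yc: "continuous_on {0..L} y" "continuous_on {0..L} z" using solves_continuous[OF sol] by auto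
  have Ec: "continuous_on {0..L} E" unfolding E_def by (intro continuous_intros Pc)
  have Ep: "primitive_on 0 L E (\<lambda>x. - \<omega> * (\<mu> - p x) * E x)"
  proof (rule primitive_on_C1)
    fix x assume x: "x \<in> {0..L}"
    have i: "((\<lambda>x. - (\<omega> * (\<mu> * of_real x - P x))) has_vector_derivative - (\<omega> * (\<mu> - p x))) (at x within {0..L})"
      using Pd[OF x] by (auto intro!: derivative_eq_intros)
    have "((exp \<circ> (\<lambda>x. - (\<omega> * (\<mu> * of_real x - P x)))) has_vector_derivative
        (- (\<omega> * (\<mu> - p x))) * exp (- (\<omega> * (\<mu> * of_real x - P x)))) (at x within {0..L})"
      by (rule field_vector_diff_chain_within[OF i]) (auto intro!: derivative_eq_intros)
    then show "(E has_vector_derivative - \<omega> * (\<mu> - p x) * E x) (at x within {0..L})"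
      by (simp add: E_def o_def)
  qed (intro continuous_intros pc Ec)
  have sp: "primitive_on 0 L (\<lambda>x. \<omega> * (\<mu> - s x)) (\<lambda>x. - \<omega> * s' x)"
    by (rule primitive_on_C1) (auto intro!: derivative_eq_intros s continuous_intros s'c)
  have wp: "primitive_on 0 L (\<lambda>x. z x + \<omega> * (\<mu> - s x) * y x)
      (\<lambda>x. pencil_coeff p q \<mu> x * y x + (- \<omega> * s' x * y x + \<omega> * (\<mu> - s x) * z x))"
    using sol unfolding solves_def by (intro primitive_on_add primitive_on_mult[OF sp]) auto
  \<comment> \<open>The derivative of E times w; the terms with the square of the parameter cancel because \<omega>^2 = -1.\<close>
  have rearr: "- \<omega> * (\<mu> - a) * e * (b + \<omega> * (\<mu> - c) * d)
      + e * ((2 * \<mu> * a + k - \<mu>\<^sup>2) * d + (- \<omega> * m * d + \<omega> * (\<mu> - c) * b))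
      = e * (\<omega> * (a - c) * b + (\<mu> * (a - c) + a * c + k - \<omega> * m) * d)" for a b c d e k m :: complex
  proof -
    have "- \<omega> * (\<mu> - a) * e * (b + \<omega> * (\<mu> - c) * d)
      = - \<omega> * (\<mu> - a) * e * b - (\<omega> * \<omega>) * (\<mu> - a) * (\<mu> - c) * e * d" by (simp add: algebra_simps)
    also have "... = - \<omega> * (\<mu> - a) * e * b + (\<mu> - a) * (\<mu> - c) * e * d" by (simp add: \<omega>2 algebra_simps)
    finally show ?thesis by (simp add: algebra_simps power2_eq_square)
  qed
  have Ewp: "primitive_on 0 L (\<lambda>x. E x * (z x + \<omega> * (\<mu> - s x) * y x)) (\<lambda>x. E x * g x)"
    by (rule primitive_on_cong[OF primitive_on_mult[OF Ep wp] refl])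
      (simp only: g_def pencil_coeff_def rearr)
  have E0: "E 0 = 1" by (simp add: E_def P_def)
  have Einv: "exp (\<omega> * (\<mu> * of_real x - P x)) * E x = 1" for x
    by (simp add: E_def exp_minus)
  have Egi: "(\<lambda>t. E t * g t) integrable_on {0..x}"
    using primitive_on_has_integral[OF Ewp, of 0 x] x by (auto intro: has_integral_integrable)
  have "E x * (z x + \<omega> * (\<mu> - s x) * y x) = 1 + integral {0..x} (\<lambda>t. E t * g t)"
    using primitive_onD[OF Ewp x] by (simp add: E0 init)
  then have "exp (\<omega> * (\<mu> * of_real x - P x)) * (E x * (z x + \<omega> * (\<mu> - s x) * y x))
      = exp (\<omega> * (\<mu> * of_real x - P x)) + exp (\<omega> * (\<mu> * of_real x - P x)) * integral {0..x} (\<lambda>t. E t * g t)"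
    by (simp add: algebra_simps)
  then have "z x + \<omega> * (\<mu> - s x) * y x - exp (\<omega> * (\<mu> * of_real x - P x))
      = exp (\<omega> * (\<mu> * of_real x - P x)) * integral {0..x} (\<lambda>t. E t * g t)"
    using Einv[of x] by (simp add: mult.assoc[symmetric])
  also have "... = integral {0..x} (\<lambda>t. exp (\<omega> * (\<mu> * of_real x - P x)) * (E t * g t))" by simp
  also have "norm ... \<le> integral {0..x} (\<lambda>t. exp B * Y * growth \<mu> x * (2 * \<epsilon> + h t / norm \<mu>))"
  proof (rule Henstock_Kurzweil_Integration.integral_norm_bound_integral)
    show "(\<lambda>t. exp (\<omega> * (\<mu> * of_real x - P x)) * (E t * g t)) integrable_on {0..x}"
      by (rule integrable_on_mult_right[OF Egi])
    have hi: "h integrable_on {0..L}"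
      unfolding h_def by (rule perturbation_integrable[OF pc sc s'c q])
    have "h integrable_on {0..x}"
      by (rule integrable_on_subinterval[OF hi]) (use x in auto)
    then show "(\<lambda>t. exp B * Y * growth \<mu> x * (2 * \<epsilon> + h t / norm \<mu>)) integrable_on {0..x}"
      by (intro integrable_on_mult_right integrable_add integrable_const_ivl integrable_on_divide)
    fix t assume t: "t \<in> {0..x}"
    then have tL: "t \<in> {0..L}" using x by auto
    have "P x - P t = integral {t..x} p"
      unfolding P_def using primitive_onD_integral[OF primitive_on_indefinite[OF p], of t x] t x by simp
    then have Pb: "norm (P x - P t) \<le> B"
      unfolding B_def using norm_integral_le_total[OF p, of t x] t x by simp
    have "exp (\<omega> * (\<mu> * of_real x - P x)) * E t = exp (\<omega> * (\<mu> * of_real (x - t) - (P x - P t)))"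
      unfolding E_def exp_add[symmetric] by (simp add: algebra_simps)
    also have "norm ... \<le> exp (\<bar>Im \<mu>\<bar> * \<bar>x - t\<bar> + norm (P x - P t))"
      by (rule norm_exp_imaginary_le[OF \<omega>])
    also have "... \<le> exp (\<bar>Im \<mu>\<bar> * (x - t) + B)" using Pb t by simp
    finally have n1: "norm (exp (\<omega> * (\<mu> * of_real x - P x)) * E t) \<le> exp (\<bar>Im \<mu>\<bar> * (x - t) + B)" .
    have a1: "norm (\<omega> * (p t - s t) * z t) \<le> \<epsilon> * (Y * growth \<mu> t)"
      unfolding norm_mult \<omega>2 using \<epsilon>[OF tL] Y(2)[OF tL] by (simp add: mult_mono')
    have a2: "norm (\<mu> * (p t - s t) * y t) \<le> \<epsilon> * (Y * growth \<mu> t)"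
    proof -
      have "norm (\<mu> * (p t - s t) * y t) = norm (p t - s t) * norm (\<mu> * y t)"
        by (simp add: norm_mult mult_ac)
      also have "... \<le> \<epsilon> * (Y * growth \<mu> t)" using \<epsilon>[OF tL] Y(1)[OF tL] by (simp add: mult_mono')
      finally show ?thesis .
    qed
    have a3: "norm ((p t * s t + q t - \<omega> * s' t) * y t) \<le> h t / norm \<mu> * (Y * growth \<mu> t)"
    proof -
      have "norm (p t * s t + q t - \<omega> * s' t) \<le> h t"
        unfolding h_def
        by (intro norm_triangle_le_diff add_mono norm_triangle_ineq) (simp add: norm_mult \<omega>2)
      then have "norm (p t * s t + q t - \<omega> * s' t) * norm (\<mu> * y t) \<le> h t * (Y * growth \<mu> t)"
        using Y(1)[OF tL] by (intro mult_mono') auto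
      moreover have "norm ((p t * s t + q t - \<omega> * s' t) * y t)
          = norm (p t * s t + q t - \<omega> * s' t) * norm (\<mu> * y t) / norm \<mu>"
        using \<mu> by (simp add: norm_mult)
      moreover have "h t / norm \<mu> * (Y * growth \<mu> t) = h t * (Y * growth \<mu> t) / norm \<mu>" by simp
      ultimately show ?thesis by (simp only: divide_right_mono norm_ge_zero)
    qed
    have "g t = \<omega> * (p t - s t) * z t + (\<mu> * (p t - s t) * y t + (p t * s t + q t - \<omega> * s' t) * y t)"
      by (simp add: g_def algebra_simps)
    also have "norm ... \<le> \<epsilon> * (Y * growth \<mu> t) + (\<epsilon> * (Y * growth \<mu> t)
        + h t / norm \<mu> * (Y * growth \<mu> t))"
      by (intro norm_triangle_le add_mono a1 a2 a3)
    also have "... = (2 * \<epsilon> + h t / norm \<mu>) * (Y * growth \<mu> t)" by (simp add: algebra_simps)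
    finally have n2: "norm (g t) \<le> (2 * \<epsilon> + h t / norm \<mu>) * (Y * growth \<mu> t)" .
    have "norm (exp (\<omega> * (\<mu> * of_real x - P x)) * (E t * g t))
        = norm (exp (\<omega> * (\<mu> * of_real x - P x)) * E t) * norm (g t)" by (simp add: norm_mult)
    also have "... \<le> exp (\<bar>Im \<mu>\<bar> * (x - t) + B) * ((2 * \<epsilon> + h t / norm \<mu>) * (Y * growth \<mu> t))"
      by (rule mult_mono'[OF n1 n2]) auto
    also have "... = exp B * Y * (growth \<mu> (x - t) * growth \<mu> t) * (2 * \<epsilon> + h t / norm \<mu>)"
      by (simp add: exp_add mult_ac)
    also have "growth \<mu> (x - t) * growth \<mu> t = growth \<mu> x"
      by (simp add: exp_add[symmetric] algebra_simps)
    finally show "norm (exp (\<omega> * (\<mu> * of_real x - P x)) * (E t * g t))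
        \<le> exp B * Y * growth \<mu> x * (2 * \<epsilon> + h t / norm \<mu>)" .
  qed
  also have "... \<le> exp B * Y * growth \<mu> x * (2 * \<epsilon> * L + integral {0..L} h / norm \<mu>)"
  proof -
    have hi: "h integrable_on {0..L}"
      unfolding h_def by (rule perturbation_integrable[OF pc sc s'c q])
    have hx: "h integrable_on {0..x}"
      by (rule integrable_on_subinterval[OF hi]) (use x in auto)
    have "((\<lambda>t. 2 * \<epsilon>) has_integral 2 * \<epsilon> * x) {0..x}"
      using has_integral_const_real[of "2 * \<epsilon>" 0 x] x by (simp add: mult_ac)
    from has_integral_add[OF this has_integral_divide[OF integrable_integral[OF hx], of "norm \<mu>"]]
    have "integral {0..x} (\<lambda>t. 2 * \<epsilon> + h t / norm \<mu>) = 2 * \<epsilon> * x + integral {0..x} h / norm \<mu>"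
      by (rule integral_unique)
    moreover have "integral {0..x} h \<le> integral {0..L} h"
      by (rule integral_subset_le) (use hx hi x in \<open>auto simp: h_def\<close>)
    moreover have "0 \<le> \<epsilon>" using order_trans[OF norm_ge_zero \<epsilon>[OF x]] .
    then have "2 * \<epsilon> * x \<le> 2 * \<epsilon> * L" using x by (intro mult_left_mono) auto
    ultimately have "integral {0..x} (\<lambda>t. 2 * \<epsilon> + h t / norm \<mu>) \<le> 2 * \<epsilon> * L + integral {0..L} h / norm \<mu>"
      by (simp add: add_mono divide_right_mono)
    moreover have "0 \<le> Y" using order_trans[OF norm_ge_zero Y(2)[of 0]] L by simp
    ultimately show ?thesis by (simp add: mult_left_mono)
  qed
  finally show ?thesis by (simp add: P_def B_def h_def mult_ac)
qed

text \<open>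
  The estimate for \<open>w\<close> presupposes a bound \<open>Y\<close> on \<open>\<mu> y\<close> and \<open>y'\<close>. Taking for \<open>Y\<close> the best constant,
  which is attained at some \<open>x0\<close>, the estimates for both signs of \<open>\<omega>\<close> give \<open>Y \<le> 2 (A + \<nu> Y)\<close>, and a
  small \<open>\<nu>\<close> yields \<open>Y \<le> 4 A\<close>. Subtracting the two estimates gives the sine.
\<close>

lemma oscillation_bounds:
  fixes p q s s' :: "real \<Rightarrow> complex"
  assumes L: "0 \<le> L" and pc: "continuous_on {0..L} p" and q: "q absolutely_integrable_on {0..L}"
    and s: "\<And>x. x \<in> {0..L} \<Longrightarrow> (s has_vector_derivative s' x) (at x within {0..L})"
    and s'c: "continuous_on {0..L} s'"
    and \<epsilon>: "\<And>x. x \<in> {0..L} \<Longrightarrow> norm (p x - s x) \<le> \<epsilon>"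
    and S: "\<And>x. x \<in> {0..L} \<Longrightarrow> norm (s x) \<le> S" "2 * S \<le> norm \<mu>"
    and sol: "solves 0 L (pencil_coeff p q \<mu>) y z" and init: "y 0 = 0" "z 0 = 1" and \<mu>: "\<mu> \<noteq> 0"
  defines "A \<equiv> exp (L1_norm L p)"
  defines "\<nu> \<equiv> A * (2 * \<epsilon> * L + integral {0..L} (\<lambda>t. norm (p t * s t) + norm (q t) + norm (s' t)) / norm \<mu>)"
  assumes \<nu>: "\<nu> \<le> 1/4" and x: "x \<in> {0..L}"
  shows "norm (\<mu> * y x) \<le> 4 * A * growth \<mu> x"
    and "norm (\<mu> * y x - sin (\<mu> * of_real x - integral {0..x} p))
      \<le> (\<nu> + S / norm \<mu>) * (4 * A) * growth \<mu> x"
proof -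
  define \<theta> where "\<theta> = (\<lambda>x. \<mu> * of_real x - integral {0..x} p)"
  define f where "f = (\<lambda>x. max (norm (\<mu> * y x)) (norm (z x)) * exp (- \<bar>Im \<mu>\<bar> * x))"
  have A1: "A \<ge> 1"
    unfolding A_def one_le_exp_iff
    by (intro Henstock_Kurzweil_Integration.integral_nonneg integrable_continuous_interval continuous_intros pc) auto
  have fc: "continuous_on {0..L} f"
    unfolding f_def by (intro continuous_intros solves_continuous[OF sol])
  obtain x0 where x0: "x0 \<in> {0..L}" "\<And>t. t \<in> {0..L} \<Longrightarrow> f t \<le> f x0"
    using continuous_attains_sup[OF compact_Icc _ fc] L by force
  define Y where "Y = f x0"
  have Y0: "Y \<ge> 0" by (simp add: Y_def f_def le_max_iff_disj)
  have fY: "max (norm (\<mu> * y t)) (norm (z t)) \<le> Y * growth \<mu> t" if "t \<in> {0..L}" for t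
  proof -
    have "f t * growth \<mu> t \<le> Y * growth \<mu> t"
      using x0(2)[OF that] by (simp add: Y_def)
    moreover have "f t * growth \<mu> t = max (norm (\<mu> * y t)) (norm (z t))"
      by (simp add: f_def exp_minus)
    ultimately show ?thesis by (simp only:)
  qed
  have osc: "norm (z t + \<omega> * (\<mu> - s t) * y t - exp (\<omega> * \<theta> t)) \<le> \<nu> * Y * growth \<mu> t"
    if "\<omega> = \<i> \<or> \<omega> = - \<i>" "t \<in> {0..L}" for \<omega> t
    unfolding \<theta>_def \<nu>_def A_def
    by (rule oscillation_estimate[OF L pc q s s'c \<epsilon> sol init that(1) \<mu> _ _ that(2)]) (use fY in auto)
  have e: "norm (exp (\<omega> * \<theta> t)) \<le> A * growth \<mu> t" if "\<omega> = \<i> \<or> \<omega> = - \<i>" "t \<in> {0..L}" for \<omega> t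
  proof -
    have "norm (integral {0..t} p) \<le> L1_norm L p"
      by (rule norm_integral_le_total[OF absolutely_integrable_continuous_real[OF pc]]) (use that in auto)
    then have "exp (\<bar>Im \<mu>\<bar> * \<bar>t\<bar> + norm (integral {0..t} p)) \<le> exp (\<bar>Im \<mu>\<bar> * t + L1_norm L p)"
      using that by simp
    then show ?thesis
      using norm_exp_imaginary_le[OF that(1), of \<mu> t "integral {0..t} p"]
      by (simp add: A_def \<theta>_def exp_add mult_ac)
  qed
  have w: "norm (z t + \<omega> * (\<mu> - s t) * y t) \<le> (A + \<nu> * Y) * growth \<mu> t"
    if "\<omega> = \<i> \<or> \<omega> = - \<i>" "t \<in> {0..L}" for \<omega> t
    using norm_triangle_ineq[of "exp (\<omega> * \<theta> t)" "z t + \<omega> * (\<mu> - s t) * y t - exp (\<omega> * \<theta> t)"]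
      osc[OF that] e[OF that] by (simp add: algebra_simps)
  have half: "norm \<mu> \<le> 2 * norm (\<mu> - s t)" if "t \<in> {0..L}" for t
    using S(1)[OF that] S(2) norm_triangle_ineq2[of \<mu> "s t"] by simp
  have zb: "norm (z t) \<le> 2 * (A + \<nu> * Y) * growth \<mu> t"
    and yb: "norm (\<mu> * y t) \<le> 2 * (A + \<nu> * Y) * growth \<mu> t" if t: "t \<in> {0..L}" for t
  proof -
    note w1 = w[OF disjI1[OF refl] t] and w2 = w[OF disjI2[OF refl] t]
    have "norm (2 * z t) \<le> norm (z t + \<i> * (\<mu> - s t) * y t) + norm (z t + - \<i> * (\<mu> - s t) * y t)"
      using norm_triangle_ineq[of "z t + \<i> * (\<mu> - s t) * y t" "z t + - \<i> * (\<mu> - s t) * y t"] by simp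
    then show "norm (z t) \<le> 2 * (A + \<nu> * Y) * growth \<mu> t"
      using w1 w2 order_trans[OF norm_ge_zero w1] unfolding norm_mult mult.assoc by simp
    have "norm (2 * \<i> * ((\<mu> - s t) * y t)) \<le> norm (z t + \<i> * (\<mu> - s t) * y t) + norm (z t + - \<i> * (\<mu> - s t) * y t)"
      using norm_triangle_ineq4[of "z t + \<i> * (\<mu> - s t) * y t" "z t + - \<i> * (\<mu> - s t) * y t"]
      by (simp add: algebra_simps)
    then have "2 * norm (\<mu> - s t) * norm (y t) \<le> 2 * (A + \<nu> * Y) * growth \<mu> t"
      using w1 w2 unfolding norm_mult mult.assoc by simp
    moreover have "norm \<mu> * norm (y t) \<le> 2 * norm (\<mu> - s t) * norm (y t)"
      using half[OF t] by (intro mult_right_mono) auto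
    ultimately show "norm (\<mu> * y t) \<le> 2 * (A + \<nu> * Y) * growth \<mu> t"
      by (simp add: norm_mult)
  qed
  have "Y * growth \<mu> x0 = max (norm (\<mu> * y x0)) (norm (z x0))"
    by (simp add: Y_def f_def exp_minus)
  also have "... \<le> 2 * (A + \<nu> * Y) * growth \<mu> x0"
    using zb[OF x0(1)] yb[OF x0(1)] by simp
  finally have Y2: "Y \<le> 2 * (A + \<nu> * Y)" by simp
  have "A + \<nu> * Y \<le> A + 1/4 * Y" using \<nu> Y0 by (intro add_left_mono mult_right_mono) auto
  then have "2 * (A + \<nu> * Y) \<le> 2 * (A + 1/4 * Y)" by simp
  from order_trans[OF Y2 this] have YA: "Y \<le> 4 * A" by simp
  have \<epsilon>0: "\<epsilon> \<ge> 0" using order_trans[OF norm_ge_zero \<epsilon>[OF x]] .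
  have S0: "S \<ge> 0" using order_trans[OF norm_ge_zero S(1)[OF x]] .
  have "(\<lambda>t. norm (p t * s t) + norm (q t) + norm (s' t)) integrable_on {0..L}"
    by (rule perturbation_integrable[OF pc continuous_on_vector_derivative[OF s] s'c q])
  then have \<nu>0: "\<nu> \<ge> 0"
    unfolding \<nu>_def using A1 \<epsilon>0 L
    by (intro mult_nonneg_nonneg add_nonneg_nonneg divide_nonneg_nonneg
        Henstock_Kurzweil_Integration.integral_nonneg) auto
  have "norm (\<mu> * y x) \<le> Y * growth \<mu> x" using fY[OF x] by simp
  also have "... \<le> 4 * A * growth \<mu> x" using YA by simp
  finally show bound: "norm (\<mu> * y x) \<le> 4 * A * growth \<mu> x" .
  define u where "u = (z x + \<i> * (\<mu> - s x) * y x - exp (\<i> * \<theta> x)) - (z x + - \<i> * (\<mu> - s x) * y x - exp (- \<i> * \<theta> x))"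
  have nub: "norm u \<le> \<nu> * Y * growth \<mu> x + \<nu> * Y * growth \<mu> x"
    unfolding u_def by (intro order_trans[OF norm_triangle_ineq4] add_mono osc x) auto
  have u: "u = 2 * \<i> * ((\<mu> - s x) * y x - sin (\<theta> x))"
    unfolding u_def sin_exp_eq by (simp add: field_simps)
  have nu: "norm u = 2 * norm ((\<mu> - s x) * y x - sin (\<theta> x))"
    unfolding u norm_mult by simp
  have "norm ((\<mu> - s x) * y x - sin (\<theta> x)) \<le> \<nu> * Y * growth \<mu> x"
    using nu nub by linarith
  also have "... \<le> \<nu> * (4 * A) * growth \<mu> x"
    using YA \<nu>0 by (intro mult_right_mono mult_left_mono) auto
  finally have m: "norm ((\<mu> - s x) * y x - sin (\<theta> x)) \<le> \<nu> * (4 * A) * growth \<mu> x" .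
  have sy: "norm (s x * y x) \<le> S / norm \<mu> * (4 * A) * growth \<mu> x"
  proof -
    have "norm (s x * y x) = norm (s x) * (norm (\<mu> * y x) / norm \<mu>)" using \<mu> by (simp add: norm_mult)
    also have "... \<le> S * (4 * A * growth \<mu> x / norm \<mu>)"
      using S(1)[OF x] bound by (intro mult_mono' divide_right_mono) auto
    finally show ?thesis by simp
  qed
  have "\<mu> * y x - sin (\<theta> x) = ((\<mu> - s x) * y x - sin (\<theta> x)) + s x * y x" by (simp add: algebra_simps)
  also have "norm ... \<le> \<nu> * (4 * A) * growth \<mu> x + S / norm \<mu> * (4 * A) * growth \<mu> x"
    by (intro norm_triangle_le add_mono m sy)
  finally show "norm (\<mu> * y x - sin (\<mu> * of_real x - integral {0..x} p))
      \<le> (\<nu> + S / norm \<mu>) * (4 * A) * growth \<mu> x"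
    by (simp add: \<theta>_def algebra_simps)
qed

text \<open>
  The order of the choices matters: first \<open>\<delta>\<close> from \<open>\<eta>\<close>, then a polynomial \<open>s\<close> close to \<open>p\<close>, and only
  then the bound \<open>R\<close>, which depends on the size of \<open>s\<close> and of its derivative.
\<close>

lemma sine_type_asymptotics:
  fixes p q :: "real \<Rightarrow> complex"
  assumes L: "0 < L" and pc: "continuous_on {0..L} p" and q: "q absolutely_integrable_on {0..L}" and \<eta>: "\<eta> > 0"
  obtains R where "R > 0"
    "\<And>\<mu> y z x. R \<le> norm \<mu> \<Longrightarrow> solves 0 L (pencil_coeff p q \<mu>) y z \<Longrightarrow> y 0 = 0 \<Longrightarrow> z 0 = 1 \<Longrightarrow> x \<in> {0..L} \<Longrightarrow>
       norm (\<mu> * y x) \<le> 4 * exp (L1_norm L p) * growth \<mu> x \<and>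
       norm (\<mu> * y x - sin (\<mu> * of_real x - integral {0..x} p)) \<le> \<eta> * growth \<mu> x"
proof -
  define A where "A = exp (L1_norm L p)"
  have A: "A > 0" by (simp add: A_def)
  define \<delta> where "\<delta> = min (1/8) (\<eta> / (12 * A))"
  have \<delta>: "\<delta> > 0" "\<delta> \<le> 1/8" "3 * \<delta> * (4 * A) \<le> \<eta>"
    using \<eta> A by (auto simp: \<delta>_def min_def field_simps)
  define \<epsilon> where "\<epsilon> = \<delta> / (2 * L * A)"
  have \<epsilon>: "\<epsilon> > 0" "A * (2 * \<epsilon> * L) = \<delta>" using \<delta> A L by (auto simp: \<epsilon>_def)
  obtain s where s: "polynomial_function s" "\<And>x. x \<in> {0..L} \<Longrightarrow> norm (p x - s x) < \<epsilon>"
    using Stone_Weierstrass_polynomial_function[OF compact_Icc pc \<epsilon>(1)] by blast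
  obtain s' where s': "polynomial_function s'" "\<And>x. (s has_vector_derivative s' x) (at x)"
    using has_vector_derivative_polynomial_function[OF s(1)] by blast
  have sc: "continuous_on {0..L} s" "continuous_on {0..L} s'"
    using s(1) s'(1) by (auto intro: continuous_on_polymonial_function)
  define H where "H = integral {0..L} (\<lambda>t. norm (p t * s t) + norm (q t) + norm (s' t))"
  have H0: "H \<ge> 0"
    unfolding H_def
    by (rule Henstock_Kurzweil_Integration.integral_nonneg[OF perturbation_integrable[OF pc sc q]]) auto
  obtain S where S: "\<And>t. t \<in> {0..L} \<Longrightarrow> norm (s t) \<le> S"
    using compact_imp_bounded[OF compact_continuous_image[OF sc(1) compact_Icc]] unfolding bounded_iff by blast
  have S0: "S \<ge> 0" using order_trans[OF norm_ge_zero S[of 0]] L by simp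
  define R where "R = (A * H + S) / \<delta> + 1"
  have R: "R > 0" unfolding R_def using A H0 S0 \<delta>
    by (intro add_nonneg_pos divide_nonneg_nonneg add_nonneg_nonneg mult_nonneg_nonneg) auto
  show ?thesis
  proof (rule that[OF R])
    fix \<mu> y z x
    assume \<mu>: "R \<le> norm \<mu>" and sol: "solves 0 L (pencil_coeff p q \<mu>) y z" "y 0 = 0" "z 0 = 1"
      and x: "x \<in> {0..L}"
    have \<mu>0: "\<mu> \<noteq> 0" "norm \<mu> > 0" using \<mu> R by auto
    have "(A * H + S) / \<delta> \<le> norm \<mu>" using \<mu> by (simp add: R_def)
    then have AHS: "A * H + S \<le> \<delta> * norm \<mu>" using \<delta>(1) by (simp add: field_simps)
    have AH: "A * H / norm \<mu> \<le> \<delta>" using AHS S0 \<mu>0 by (simp add: field_simps)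
    have SM: "S / norm \<mu> \<le> \<delta>"
    proof -
      have "0 \<le> A * H" using A H0 by simp
      then have "S \<le> \<delta> * norm \<mu>" using AHS by linarith
      then show ?thesis using \<mu>0 by (simp add: field_simps)
    qed
    have "\<delta> * norm \<mu> \<le> 1/8 * norm \<mu>" using \<delta> by (intro mult_right_mono) auto
    moreover have "S \<le> \<delta> * norm \<mu>" using SM \<mu>0 by (simp add: field_simps)
    ultimately have S2: "2 * S \<le> norm \<mu>" using S0 by linarith
    define \<nu> where "\<nu> = A * (2 * \<epsilon> * L + H / norm \<mu>)"
    have \<nu>: "\<nu> \<le> 2 * \<delta>"
      unfolding \<nu>_def distrib_left \<epsilon>(2) using AH by simp
    have "\<nu> \<le> 1/4" using \<nu> \<delta>(2) by simp
    then have "exp (L1_norm L p) * (2 * \<epsilon> * L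
        + integral {0..L} (\<lambda>t. norm (p t * s t) + norm (q t) + norm (s' t)) / norm \<mu>) \<le> 1/4"
      by (simp only: \<nu>_def A_def H_def)
    note b = oscillation_bounds[OF less_imp_le[OF L] pc q has_vector_derivative_at_within[OF s'(2)] sc(2)
        less_imp_le[OF s(2)] S S2 sol \<mu>0(1) this x, folded A_def, folded H_def, folded \<nu>_def]
    have "(\<nu> + S / norm \<mu>) * (4 * A) * growth \<mu> x \<le> 3 * \<delta> * (4 * A) * growth \<mu> x"
      using \<nu> SM A by (intro mult_right_mono) auto
    also have "... \<le> \<eta> * growth \<mu> x" using \<delta>(3) by (intro mult_right_mono) auto
    finally show "norm (\<mu> * y x) \<le> 4 * exp (L1_norm L p) * growth \<mu> x \<and>
       norm (\<mu> * y x - sin (\<mu> * of_real x - integral {0..x} p)) \<le> \<eta> * growth \<mu> x"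
      using b unfolding A_def[symmetric] by linarith
  qed
qed

section \<open>Entire functions of sine type\<close>

lemma norm_sin_le_exp: "norm (sin z) \<le> exp \<bar>Im z\<bar>" for z :: complex
proof -
  have "norm (sin z) = norm (exp (\<i> * z) - exp (- (\<i> * z))) / 2"
    by (simp add: sin_exp_eq norm_divide norm_mult)
  also have "... \<le> (norm (exp (\<i> * z)) + norm (exp (- (\<i> * z)))) / 2"
    by (intro divide_right_mono norm_triangle_ineq4) simp
  also have "... = (exp (- Im z) + exp (Im z)) / 2" by (simp add: norm_exp_eq_Re)
  also have "... \<le> (exp \<bar>Im z\<bar> + exp \<bar>Im z\<bar>) / 2" by (intro divide_right_mono add_mono) auto
  finally show ?thesis by simp
qed

text \<open>
  The square of \<open>|sin z|\<close> is \<open>(cosh(2 Im z) - cos(2 Re z)) / 2\<close>. This is large where the cosine is \<open>-1\<close>,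
  and also where the hyperbolic cosine dominates.
\<close>

lemma norm_sin_ge_exp:
  assumes "cos (2 * Re z) = -1 \<or> \<bar>Im z\<bar> \<ge> 1"
  shows "norm (sin z) \<ge> exp \<bar>Im z\<bar> / 4"
proof -
  have e: "exp (2 * Im z) + inverse (exp (2 * Im z)) \<ge> exp (2 * \<bar>Im z\<bar>)"
    by (cases "Im z \<ge> 0") (auto simp: exp_minus)
  have sq: "(norm (sin z))\<^sup>2 = (exp (2 * Im z) + inverse (exp (2 * Im z)) - 2 * cos (2 * Re z)) / 4"
    by (rule norm_sin_squared)
  have arith: "E / 16 \<le> (X - 2 * C) / 4"
    if "E \<le> X" "C \<le> 1" "C = -1 \<or> 3 \<le> E" "0 \<le> E" for E X C :: real
    using that by auto
  have "exp (2 * \<bar>Im z\<bar>) / 16 \<le> (norm (sin z))\<^sup>2"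
    unfolding sq
  proof (rule arith[OF e])
    have "3 \<le> exp (2 * \<bar>Im z\<bar>)" if "\<bar>Im z\<bar> \<ge> 1"
      using order_trans[OF _ exp_ge_add_one_self[of "2 * \<bar>Im z\<bar>"]] that by simp
    then show "cos (2 * Re z) = -1 \<or> 3 \<le> exp (2 * \<bar>Im z\<bar>)" using assms by blast
  qed auto
  moreover have "(exp \<bar>Im z\<bar> / 4)\<^sup>2 = exp (2 * \<bar>Im z\<bar>) / 16"
    by (simp add: power2_eq_square exp_add[symmetric])
  ultimately have "(exp \<bar>Im z\<bar> / 4)\<^sup>2 \<le> (norm (sin z))\<^sup>2" by (simp only:)
  then show ?thesis by (rule power2_le_imp_le) simp
qed

text \<open>
  The sides are chosen such that \<open>|sin|\<close> is comparable to \<open>exp |Im z|\<close> on the whole boundary: the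
  vertical ones lie at odd multiples of \<open>\<pi>/2\<close>, half way between the zeros of the sine.
\<close>

definition square_box :: "nat \<Rightarrow> complex set" where
  "square_box n = {z. \<bar>Re z\<bar> \<le> pi / 2 + real n * pi \<and> \<bar>Im z\<bar> \<le> pi / 2 + real n * pi}"

lemma square_box_eq_cbox:
  "square_box n = cbox (Complex (- (pi / 2 + real n * pi)) (- (pi / 2 + real n * pi)))
                       (Complex (pi / 2 + real n * pi) (pi / 2 + real n * pi))"
  by (auto simp: square_box_def in_cbox_complex_iff)

lemma frontier_square_boxD:
  assumes "z \<in> frontier (square_box n)"
  shows "norm z \<ge> real n" "norm (sin z) \<ge> exp \<bar>Im z\<bar> / 4"
proof -
  define r where "r = pi / 2 + real n * pi"
  have "square_box n - box (Complex (-r) (-r)) (Complex r r) = frontier (square_box n)"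
    unfolding square_box_eq_cbox r_def[symmetric] frontier_def by (simp add: interior_cbox)
  then have "z \<in> square_box n - box (Complex (-r) (-r)) (Complex r r)" using assms by simp
  then have or: "\<bar>Re z\<bar> = r \<or> \<bar>Im z\<bar> = r"
    unfolding square_box_def r_def[symmetric] by (auto simp: in_box_complex_iff)
  have p: "pi / 2 \<ge> 1" using pi_ge_two by simp
  moreover have "real n * pi \<ge> real n * 1" using p by (intro mult_left_mono) auto
  ultimately have r: "r \<ge> real n" "r \<ge> 1" unfolding r_def by auto
  show "norm z \<ge> real n" using or r abs_Re_le_cmod[of z] abs_Im_le_cmod[of z] by linarith
  have c: "cos (2 * r) = -1"
  proof -
    have "2 * r = pi + 2 * real n * pi" by (simp add: r_def algebra_simps)
    then show ?thesis by (simp add: cos_add cos_2npi sin_2npi)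
  qed
  have "cos (2 * Re z) = -1" if "\<bar>Re z\<bar> = r"
  proof -
    have "Re z = r \<or> Re z = - r" using that by auto
    then show ?thesis using c cos_minus[of "2 * r"] by auto
  qed
  then show "norm (sin z) \<ge> exp \<bar>Im z\<bar> / 4"
    using or r by (intro norm_sin_ge_exp) auto
qed

lemma entire_bound_from_boxes:
  assumes f: "f holomorphic_on UNIV" and N: "\<And>n z. n \<ge> N \<Longrightarrow> z \<in> frontier (square_box n) \<Longrightarrow> norm (f z) \<le> B"
  shows "norm (f z) \<le> B"
proof -
  obtain n :: nat where n: "norm z \<le> real n" using real_arch_simple by blast
  define m where "m = max n N"
  have pm: "real m * pi \<ge> real m * 1" using pi_ge_two by (intro mult_left_mono) auto
  have "norm z \<le> real m" using n by (simp add: m_def)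
  then have zin: "z \<in> square_box m"
    using order_trans[OF order_trans[OF abs_Re_le_cmod[of z]]] order_trans[OF order_trans[OF abs_Im_le_cmod[of z]]] pm pi_gt_zero
    unfolding square_box_def by (simp add: add_increasing)
  show ?thesis
  proof (rule maximum_modulus_frontier[OF _ _ _ _ zin])
    show "f holomorphic_on interior (square_box m)" using f holomorphic_on_subset by blast
    show "continuous_on (closure (square_box m)) f"
      using holomorphic_on_imp_continuous_on[OF f] continuous_on_subset by blast
    show "bounded (square_box m)" unfolding square_box_eq_cbox by (rule bounded_cbox)
    show "norm (f w) \<le> B" if "w \<in> frontier (square_box m)" for w
      by (rule N[OF _ that]) (simp add: m_def)
  qed
qed

lemma holomorphic_on_affine:
  assumes f: "f holomorphic_on UNIV" and L: "L > 0"
  shows "(\<lambda>z. f ((z + c) / of_real L)) holomorphic_on UNIV"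
proof -
  have "(\<lambda>z. (z + c) / of_real L) holomorphic_on UNIV"
    using L by (intro holomorphic_intros) auto
  from holomorphic_on_compose_gen[OF this f] show ?thesis by (simp add: o_def)
qed

text \<open>
  The functions that behave at infinity like \<open>sin(\<mu> L - c) / \<mu>\<close>, with an error that is small compared
  with the growth of the sine in the complex plane.
\<close>

definition sine_type :: "real \<Rightarrow> complex \<Rightarrow> (complex \<Rightarrow> complex) \<Rightarrow> bool" where
  "sine_type L c D \<longleftrightarrow> 0 < L \<and> D holomorphic_on UNIV \<and>
     (\<forall>\<eta>>0. \<exists>R. \<forall>\<mu>. R \<le> norm \<mu> \<longrightarrow>
        norm (\<mu> * D \<mu> - sin (\<mu> * of_real L - c)) \<le> \<eta> * growth \<mu> L)"

lemma sine_type_upper: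
  assumes "sine_type L c D"
  obtains R where "\<And>\<mu>. R \<le> norm \<mu> \<Longrightarrow> norm (\<mu> * D \<mu>) \<le> (exp (norm c) + 1) * growth \<mu> L"
proof -
  have L: "L > 0" using assms by (simp add: sine_type_def)
  obtain R where R: "\<And>\<mu>. R \<le> norm \<mu> \<Longrightarrow>
      norm (\<mu> * D \<mu> - sin (\<mu> * of_real L - c)) \<le> 1 * growth \<mu> L"
    using assms unfolding sine_type_def by (meson zero_less_one)
  show ?thesis
  proof (rule that[of R])
    fix \<mu> :: complex assume "R \<le> norm \<mu>"
    note R = R[OF this]
    have "norm (sin (\<mu> * of_real L - c)) \<le> exp \<bar>Im (\<mu> * of_real L - c)\<bar>" by (rule norm_sin_le_exp)
    also have "\<bar>Im (\<mu> * of_real L - c)\<bar> \<le> \<bar>Im \<mu>\<bar> * L + norm c"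
      using abs_triangle_ineq4[of "Im \<mu> * L" "Im c"] abs_Im_le_cmod[of c] L by (simp add: abs_mult)
    then have "exp \<bar>Im (\<mu> * of_real L - c)\<bar> \<le> exp (norm c) * growth \<mu> L"
      by (simp add: exp_add[symmetric] add.commute)
    finally have "norm (sin (\<mu> * of_real L - c)) \<le> exp (norm c) * growth \<mu> L" .
    moreover have "norm (\<mu> * D \<mu>) \<le> norm (sin (\<mu> * of_real L - c)) + norm (\<mu> * D \<mu> - sin (\<mu> * of_real L - c))"
      by (rule norm_triangle_sub)
    ultimately show "norm (\<mu> * D \<mu>) \<le> (exp (norm c) + 1) * growth \<mu> L"
      using R by (simp add: distrib_right)
  qed
qed

lemma norm_box_parameter_ge:
  assumes "0 < L" "R * L + norm c \<le> real n" "z \<in> frontier (square_box n)"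
  shows "R \<le> norm ((z + c) / of_real L)"
proof -
  have "R * L \<le> norm z - norm c" using assms(2) frontier_square_boxD(1)[OF assms(3)] by linarith
  also have "... \<le> norm (z + c)" using norm_triangle_ineq2[of z "- c"] by simp
  finally show ?thesis using assms(1) by (simp add: norm_divide pos_le_divide_eq)
qed

text \<open>
  The asymptotics is an assertion about \<open>\<mu>\<close>, but the boxes are placed in the variable
  \<open>z = \<mu> L - c\<close>, in which the leading term is exactly \<open>sin z\<close>.
\<close>

lemma sine_type_lower:
  assumes D: "sine_type L c D"
  obtains N where "\<And>n z. n \<ge> N \<Longrightarrow> z \<in> frontier (square_box n) \<Longrightarrow>
    exp (- norm c) / 8 * exp (\<bar>Im ((z + c) / of_real L)\<bar> * L)
      \<le> norm ((z + c) / of_real L * D ((z + c) / of_real L))"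
proof -
  have L: "L > 0" using assms by (simp add: sine_type_def)
  have "exp (- norm c) / 8 > 0" by simp
  then obtain R where R: "\<And>\<mu>. R \<le> norm \<mu> \<Longrightarrow>
      norm (\<mu> * D \<mu> - sin (\<mu> * of_real L - c)) \<le> exp (- norm c) / 8 * growth \<mu> L"
    using assms unfolding sine_type_def by blast
  obtain N :: nat where N: "R * L + norm c \<le> real N" using real_arch_simple by blast
  show ?thesis
  proof (rule that[of N])
    fix n z assume n: "n \<ge> N" and z: "z \<in> frontier (square_box n)"
    define \<mu> where "\<mu> = (z + c) / of_real L"
    have z\<mu>: "z = \<mu> * of_real L - c" using L by (simp add: \<mu>_def)
    have "R \<le> norm \<mu>"
      unfolding \<mu>_def by (rule norm_box_parameter_ge[OF L _ z]) (use N n in linarith)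
    note R = R[OF this]
    have "\<bar>Im \<mu>\<bar> * L - norm c \<le> \<bar>Im z\<bar>"
      using abs_triangle_ineq2[of "Im \<mu> * L" "Im c"] abs_Im_le_cmod[of c] L by (simp add: z\<mu> abs_mult)
    then have "exp (- norm c) * growth \<mu> L \<le> exp \<bar>Im z\<bar>" by (simp add: exp_add[symmetric])
    then have "exp (- norm c) / 4 * growth \<mu> L \<le> norm (sin z)"
      using frontier_square_boxD(2)[OF z] by simp
    moreover have "norm (sin z) \<le> norm (\<mu> * D \<mu>) + norm (\<mu> * D \<mu> - sin z)"
      using norm_triangle_sub[of "sin z" "\<mu> * D \<mu>"] by (simp add: norm_minus_commute)
    ultimately show "exp (- norm c) / 8 * exp (\<bar>Im ((z + c) / of_real L)\<bar> * L)
      \<le> norm ((z + c) / of_real L * D ((z + c) / of_real L))"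
      using R unfolding \<mu>_def[symmetric] z\<mu>[symmetric] by simp
  qed
qed

text \<open>
  On the two imaginary half-axes different exponentials dominate in the sine. The phase \<open>c\<close>
  therefore enters with opposite signs.
\<close>

lemma sine_type_limit:
  assumes D: "sine_type L c D" and w: "w = 1 \<or> w = (-1 :: real)"
  shows "((\<lambda>t. of_real (exp (- (t * L))) * (\<i> * of_real (w * t) * D (\<i> * of_real (w * t))))
    \<longlongrightarrow> of_real w * (\<i> / 2) * exp (\<i> * of_real w * c)) at_top"
proof -
  have L: "L > 0" using assms by (simp add: sine_type_def)
  define G where "G = (\<lambda>t. \<i> * of_real (w * t) * D (\<i> * of_real (w * t)))"
  define S where "S = (\<lambda>t::real. sin (\<i> * of_real (w * t) * of_real L - c))"
  have a: "((\<lambda>t. of_real (exp (- (t * L))) * (G t - S t)) \<longlongrightarrow> 0) at_top"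
  proof (rule tendstoI)
    fix e :: real assume e: "e > 0"
    then obtain R where R: "\<And>\<mu>. R \<le> norm \<mu> \<Longrightarrow>
      norm (\<mu> * D \<mu> - sin (\<mu> * of_real L - c)) \<le> e/2 * growth \<mu> L"
      using D unfolding sine_type_def by (meson half_gt_zero)
    show "\<forall>\<^sub>F t in at_top. dist (of_real (exp (- (t * L))) * (G t - S t)) 0 < e"
      using eventually_ge_at_top[of "max R 0"]
    proof eventually_elim
      case (elim t)
      have n: "norm (\<i> * of_real (w * t) :: complex) = t" "\<bar>Im (\<i> * of_real (w * t))\<bar> = t"
        using w elim by (auto simp: norm_mult)
      have "norm (G t - S t) \<le> e/2 * exp (t * L)"
        using R[of "\<i> * of_real (w * t)"] n elim unfolding G_def S_def by simp
      then have "exp (- (t * L)) * norm (G t - S t) \<le> exp (- (t * L)) * (e/2 * exp (t * L))"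
        by (intro mult_left_mono) auto
      moreover have "exp (- (t * L)) * (e/2 * exp (t * L)) = e/2" by (simp add: exp_minus)
      moreover have "norm (complex_of_real (exp (- (t * L))) * (G t - S t)) = exp (- (t * L)) * norm (G t - S t)"
        by (simp only: norm_mult norm_of_real abs_exp_cancel)
      ultimately show ?case using e unfolding dist_0_norm dist_norm diff_zero by linarith
    qed
  qed
  have b: "of_real (exp (- (t * L))) * S t = of_real w * (\<i> / 2) * exp (\<i> * of_real w * c)
      - of_real w * (\<i> / 2) * exp (- (\<i> * of_real w * c)) * of_real (exp (- (2 * (t * L))))" for t
  proof -
    have S: "S t = of_real w * sin (\<i> * of_real t * of_real L - of_real w * c)"
      using w by (auto simp: S_def) (metis minus_add_distrib add.commute sin_minus minus_diff_eq diff_minus_eq_add)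
    have e1: "\<i> * (\<i> * of_real t * of_real L - of_real w * c) = - of_real (t * L) - \<i> * of_real w * c"
      by (simp add: algebra_simps)
    have e2: "exp (- complex_of_real (t * L) - \<i> * of_real w * c) = of_real (exp (- (t * L))) * exp (- (\<i> * of_real w * c))"
      unfolding of_real_exp exp_add[symmetric] by simp
    have e3: "exp (- (- complex_of_real (t * L) - \<i> * of_real w * c)) = of_real (exp (t * L)) * exp (\<i> * of_real w * c)"
      unfolding of_real_exp exp_add[symmetric] by (simp add: add.commute)
    have e4: "of_real (exp (- (t * L))) * of_real (exp (t * L)) = (1 :: complex)"
      unfolding of_real_mult[symmetric] exp_add[symmetric] by simp
    have e5: "of_real (exp (- (t * L))) * of_real (exp (- (t * L))) = (of_real (exp (- (2 * (t * L)))) :: complex)"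
      unfolding of_real_mult[symmetric] exp_add[symmetric] by simp
    have "of_real (exp (- (t * L))) * S t = of_real w * (- (\<i> / 2)) *
       ((of_real (exp (- (t * L))) * of_real (exp (- (t * L)))) * exp (- (\<i> * of_real w * c))
        - (of_real (exp (- (t * L))) * of_real (exp (t * L))) * exp (\<i> * of_real w * c))"
      unfolding S sin_exp_eq e1 e2 e3 by (simp add: field_simps)
    then show ?thesis unfolding e4 e5 by (simp add: algebra_simps)
  qed
  have "((\<lambda>t. exp (- (2 * (t * L)))) \<longlongrightarrow> 0) at_top" using L by real_asymp
  then have ex: "((\<lambda>t. complex_of_real (exp (- (2 * (t * L))))) \<longlongrightarrow> of_real 0) at_top" by (rule tendsto_of_real)
  have "((\<lambda>t. of_real (exp (- (t * L))) * S t) \<longlongrightarrow>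
     of_real w * (\<i> / 2) * exp (\<i> * of_real w * c)
      - of_real w * (\<i> / 2) * exp (- (\<i> * of_real w * c)) * of_real 0) at_top"
    unfolding b by (intro tendsto_diff tendsto_const tendsto_mult_left ex)
  from tendsto_add[OF a this] show ?thesis by (simp add: G_def algebra_simps)
qed

lemma sine_type_eventually_nonzero:
  assumes D: "sine_type L c D"
  shows "eventually (\<lambda>t. D (\<i> * of_real t) \<noteq> 0) at_top"
proof -
  have "eventually (\<lambda>t. of_real (exp (- (t * L))) * (\<i> * of_real (1 * t) * D (\<i> * of_real (1 * t))) \<noteq> 0) at_top"
    by (rule tendsto_imp_eventually_ne[OF sine_type_limit[OF D]]) auto
  then show ?thesis by (rule eventually_mono) auto
qed

text \<open>
  On the boundaries of the boxes \<open>F\<close> is bounded, because \<open>D\<close> and \<open>D'\<close> grow at the same rate there. By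
  the maximum principle and Liouville's theorem \<open>F\<close> is constant, and its value can be read off on
  either imaginary half-axis.
\<close>

lemma sine_type_ratio:
  assumes D: "sine_type L c D" and D': "sine_type L c' D'"
    and F: "F holomorphic_on UNIV" and eq: "\<And>\<mu>. F \<mu> * D' \<mu> = D \<mu>"
  shows "F \<mu> = exp (\<i> * (c - c'))" "F \<mu> = exp (- (\<i> * (c - c')))"
proof -
  have L: "L > 0" using D by (simp add: sine_type_def)
  obtain R where R: "\<And>\<mu>. R \<le> norm \<mu> \<Longrightarrow> norm (\<mu> * D \<mu>) \<le> (exp (norm c) + 1) * growth \<mu> L"
    using sine_type_upper[OF D] by blast
  obtain N where N: "\<And>n z. n \<ge> N \<Longrightarrow> z \<in> frontier (square_box n) \<Longrightarrow>
    exp (- norm c') / 8 * exp (\<bar>Im ((z + c') / of_real L)\<bar> * L)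
      \<le> norm ((z + c') / of_real L * D' ((z + c') / of_real L))"
    using sine_type_lower[OF D'] by blast
  obtain M :: nat where M: "R * L + norm c' \<le> real M" using real_arch_simple by blast
  define B where "B = (exp (norm c) + 1) / (exp (- norm c') / 8)"
  define f where "f = (\<lambda>z. F ((z + c') / of_real L))"
  have fh: "f holomorphic_on UNIV"
    unfolding f_def by (rule holomorphic_on_affine[OF F L])
  have fB: "norm (f z) \<le> B" for z
  proof (rule entire_bound_from_boxes[OF fh])
    fix n z assume n: "max N M \<le> n" and z: "z \<in> frontier (square_box n)"
    define \<mu> where "\<mu> = (z + c') / of_real L"
    have R\<mu>: "R \<le> norm \<mu>"
      unfolding \<mu>_def by (rule norm_box_parameter_ge[OF L _ z]) (use M n in linarith)
    have "norm (f z) * (exp (- norm c') / 8 * growth \<mu> L) \<le> norm (F \<mu>) * norm (\<mu> * D' \<mu>)"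
      unfolding f_def \<mu>_def using N[OF _ z] n by (intro mult_left_mono) auto
    also have "... = norm (\<mu> * D \<mu>)" by (simp add: norm_mult eq[symmetric])
    also have "... \<le> (exp (norm c) + 1) * growth \<mu> L" by (rule R[OF R\<mu>])
    finally have "norm (f z) * (exp (- norm c') / 8) \<le> exp (norm c) + 1" by (simp add: mult.assoc[symmetric])
    then show "norm (f z) \<le> B" by (simp add: B_def field_simps)
  qed
  have "bounded (range f)" using fB by (auto simp: bounded_iff)
  then have "f constant_on UNIV" by (rule Liouville_theorem[OF fh])
  then obtain C where "\<And>z. f z = C" unfolding constant_on_def by blast
  then have "F \<mu> = C" for \<mu>
    using L by (metis (no_types, opaque_lifting) f_def add_diff_cancel diff_add_cancel nonzero_mult_div_cancel_right of_real_eq_0_iff less_irrefl)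
  then have FC: "F = (\<lambda>_. C)" by blast
  have C: "C * (of_real w * (\<i> / 2) * exp (\<i> * of_real w * c')) = of_real w * (\<i> / 2) * exp (\<i> * of_real w * c)"
    if w: "w = 1 \<or> w = (-1 :: real)" for w
  proof (rule tendsto_unique[OF trivial_limit_at_top_linorder])
    show "((\<lambda>t. of_real (exp (- (t * L))) * (\<i> * of_real (w * t) * D (\<i> * of_real (w * t))))
      \<longlongrightarrow> of_real w * (\<i> / 2) * exp (\<i> * of_real w * c)) at_top"
      by (rule sine_type_limit[OF D w])
    have "((\<lambda>t. C * (of_real (exp (- (t * L))) * (\<i> * of_real (w * t) * D' (\<i> * of_real (w * t)))))
      \<longlongrightarrow> C * (of_real w * (\<i> / 2) * exp (\<i> * of_real w * c'))) at_top"
      by (intro tendsto_mult_left sine_type_limit[OF D' w])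
    then show "((\<lambda>t. of_real (exp (- (t * L))) * (\<i> * of_real (w * t) * D (\<i> * of_real (w * t))))
      \<longlongrightarrow> C * (of_real w * (\<i> / 2) * exp (\<i> * of_real w * c'))) at_top"
      unfolding eq[symmetric] FC by (simp add: mult_ac)
  qed
  have "C * exp (\<i> * c') = exp (\<i> * c)" using C[of 1] by simp
  then show "F \<mu> = exp (\<i> * (c - c'))" by (simp add: FC right_diff_distrib exp_diff field_simps)
  have "C * exp (- (\<i> * c')) = exp (- (\<i> * c))" using C[of "-1"] by simp
  then show "F \<mu> = exp (- (\<i> * (c - c')))" by (simp add: FC right_diff_distrib exp_diff exp_minus field_simps)
qed

text \<open>
  Compared with \<open>D\<close> the product \<open>G D\<close> decays by one more power of \<open>\<mu>\<close>. Hence \<open>G\<close> tends to zero along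
  the boundaries of the boxes.
\<close>

lemma sine_type_quotient_zero:
  assumes D: "sine_type L c D" and G: "G holomorphic_on UNIV"
    and N: "\<And>\<mu>. R \<le> norm \<mu> \<Longrightarrow> norm (\<mu>\<^sup>2 * (G \<mu> * D \<mu>)) \<le> K * growth \<mu> L"
  shows "G \<mu> = 0"
proof -
  have L: "L > 0" using D by (simp add: sine_type_def)
  obtain N0 where N0: "\<And>n z. n \<ge> N0 \<Longrightarrow> z \<in> frontier (square_box n) \<Longrightarrow>
    exp (- norm c) / 8 * exp (\<bar>Im ((z + c) / of_real L)\<bar> * L)
      \<le> norm ((z + c) / of_real L * D ((z + c) / of_real L))"
    using sine_type_lower[OF D] by blast
  define f where "f = (\<lambda>z. G ((z + c) / of_real L))"
  have fh: "f holomorphic_on UNIV"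
    unfolding f_def by (rule holomorphic_on_affine[OF G L])
  have fe: "norm (f z) \<le> e" if e: "e > 0" for e z
  proof -
    define k where "k = exp (- norm c) / 8"
    have k: "k > 0" by (simp add: k_def)
    define R' where "R' = max R (\<bar>K\<bar> / (k * e))"
    obtain M :: nat where M: "R' * L + norm c \<le> real M" using real_arch_simple by blast
    show ?thesis
    proof (rule entire_bound_from_boxes[OF fh])
      fix n z assume n: "max N0 M \<le> n" and z: "z \<in> frontier (square_box n)"
      define \<mu> where "\<mu> = (z + c) / of_real L"
      have "R' \<le> norm \<mu>"
        unfolding \<mu>_def by (rule norm_box_parameter_ge[OF L _ z]) (use M n in linarith)
      then have R\<mu>: "R \<le> norm \<mu>" "\<bar>K\<bar> / (k * e) \<le> norm \<mu>" by (auto simp: R'_def)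
      have "(norm (f z) * norm \<mu>) * (k * growth \<mu> L) \<le> (norm (G \<mu>) * norm \<mu>) * norm (\<mu> * D \<mu>)"
        unfolding f_def \<mu>_def k_def using N0[OF _ z] n by (intro mult_left_mono) auto
      also have "... = norm (\<mu>\<^sup>2 * (G \<mu> * D \<mu>))" by (simp add: norm_mult power2_eq_square mult_ac)
      also have "... \<le> K * growth \<mu> L" by (rule N[OF R\<mu>(1)])
      also have "... \<le> \<bar>K\<bar> * growth \<mu> L" by (intro mult_right_mono) auto
      finally have b: "norm (f z) * norm \<mu> * k \<le> \<bar>K\<bar>" by (simp add: mult.assoc[symmetric])
      also have "\<bar>K\<bar> \<le> norm \<mu> * (k * e)" using R\<mu>(2) k e by (simp add: field_simps)
      finally have c: "norm \<mu> * k * norm (f z) \<le> norm \<mu> * k * e" by (simp add: mult_ac)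
      \<comment> \<open>At the parameter 0 the lower bound for \<open>\<mu> D(\<mu>)\<close> would be a positive bound for 0.\<close>
      show "norm (f z) \<le> e"
      proof (cases "\<mu> = 0")
        case True
        have "exp (- norm c) / 8 * growth \<mu> L \<le> norm (\<mu> * D \<mu>)"
          unfolding \<mu>_def using N0[OF _ z] n by simp
        then show ?thesis using True by simp
      next
        case False
        then show ?thesis using c k by simp
      qed
    qed
  qed
  have "norm (f (\<mu> * of_real L - c)) \<le> 0"
    by (rule field_le_epsilon) (use fe in simp)
  then show ?thesis using L by (simp add: f_def)
qed

text \<open>
  Local solutions of \<open>g D = N\<close> agree wherever \<open>D \<noteq> 0\<close>, hence by continuity everywhere, because the zeros
  of \<open>D\<close> are isolated. So the values at the centres of the discs fit together.
\<close>

lemma entire_quotient: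
  assumes D: "D holomorphic_on UNIV" and nz: "D \<xi> \<noteq> 0"
    and loc: "\<And>z0. \<exists>g r. 0 < r \<and> g holomorphic_on ball z0 r \<and> (\<forall>w\<in>ball z0 r. g w * D w = N w)"
  obtains F where "F holomorphic_on UNIV" "\<And>w. F w * D w = N w"
proof -
  from loc obtain g r where r: "\<And>z0. 0 < r z0" and g: "\<And>z0. g z0 holomorphic_on ball z0 (r z0)"
    and eq: "\<And>z0 w. w \<in> ball z0 (r z0) \<Longrightarrow> g z0 w * D w = N w" by metis
  define F where "F = (\<lambda>z. g z z)"
  have same: "g w w = g z0 w" if w: "w \<in> ball z0 (r z0)" for w z0
  proof -
    have nzD: "eventually (\<lambda>u. D u \<noteq> 0) (at w)"
      using non_zero_neighbour_alt[OF D open_UNIV connected_UNIV UNIV_I UNIV_I nz] by (auto elim: eventually_mono)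
    have "eventually (\<lambda>u. u \<in> ball w (r w) \<inter> ball z0 (r z0)) (at w)"
      using w r[of w] by (intro eventually_at_in_open') auto
    then have ev: "eventually (\<lambda>u. g w u = g z0 u) (at w)"
      using nzD
    proof eventually_elim
      case (elim u)
      then have "g w u * D u = g z0 u * D u" using eq[of u w] eq[of u z0] by simp
      then show ?case using elim by simp
    qed
    have "isCont (g w) w" "isCont (g z0) w"
      using g w r[of w] by (auto intro!: continuous_on_interior[OF holomorphic_on_imp_continuous_on])
    then have "g w \<midarrow>w\<rightarrow> g w w" "g z0 \<midarrow>w\<rightarrow> g z0 w" by (auto simp: isCont_def)
    then show ?thesis
      using tendsto_cong[OF ev] tendsto_unique[OF at_neq_bot] by blast
  qed
  show ?thesis
  proof (rule that)
    show "F w * D w = N w" for w using eq[of w w] r by (simp add: F_def)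
    have "F holomorphic_on ball z0 (r z0)" for z0
      using g[of z0] by (rule holomorphic_transform) (use same in \<open>auto simp: F_def\<close>)
    then have "F field_differentiable at z0" for z0
      using r[of z0] by (metis at_within_open centre_in_ball holomorphic_on_def open_ball)
    then show "F holomorphic_on UNIV" by (simp add: holomorphic_on_def)
  qed
qed

lemma entire_quotient_same_zeros:
  assumes N: "N holomorphic_on UNIV" "N \<xi>' \<noteq> 0" and D: "D holomorphic_on UNIV" "D \<xi> \<noteq> 0"
    and zeros: "(\<lambda>\<mu>. (\<mu>, zorder N \<mu>)) ` {\<mu>. N \<mu> = 0} = (\<lambda>\<mu>. (\<mu>, zorder D \<mu>)) ` {\<mu>. D \<mu> = 0}"
  obtains F where "F holomorphic_on UNIV" "\<And>w. F w * D w = N w"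
proof (rule entire_quotient[OF D])
  fix z0
  have nz: "\<exists>w\<in>UNIV. N w \<noteq> 0" "\<exists>w\<in>UNIV. D w \<noteq> 0" using N(2) D(2) by blast+
  note EN = zorder_exist_zero[OF N(1) open_UNIV connected_UNIV UNIV_I nz(1), of z0]
  note ED = zorder_exist_zero[OF D(1) open_UNIV connected_UNIV UNIV_I nz(2), of z0]
  have iff: "N z0 = 0 \<longleftrightarrow> D z0 = 0" and ord: "N z0 = 0 \<Longrightarrow> zorder N z0 = zorder D z0"
    using zeros by (auto simp: set_eq_iff image_iff)
  have o: "zorder N z0 = zorder D z0" using iff ord EN ED by (metis (no_types, lifting))
  obtain r1 where r1: "r1 > 0" "zor_poly N z0 holomorphic_on cball z0 r1"
    "\<And>w. w \<in> cball z0 r1 \<Longrightarrow> N w = zor_poly N z0 w * (w - z0) ^ nat (zorder N z0)" using EN by blast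
  obtain r2 where r2: "r2 > 0" "zor_poly D z0 holomorphic_on cball z0 r2"
    "\<And>w. w \<in> cball z0 r2 \<Longrightarrow> D w = zor_poly D z0 w * (w - z0) ^ nat (zorder D z0) \<and> zor_poly D z0 w \<noteq> 0" using ED by blast
  show "\<exists>g r. 0 < r \<and> g holomorphic_on ball z0 r \<and> (\<forall>w\<in>ball z0 r. g w * D w = N w)"
  proof (intro exI conjI ballI)
    show "0 < min r1 r2" using r1 r2 by simp
    have s: "ball z0 (min r1 r2) \<subseteq> cball z0 r1" "ball z0 (min r1 r2) \<subseteq> cball z0 r2" by auto
    show "(\<lambda>w. zor_poly N z0 w / zor_poly D z0 w) holomorphic_on ball z0 (min r1 r2)"
      using s r1 r2 by (intro holomorphic_intros) (blast intro: holomorphic_on_subset)+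
    show "zor_poly N z0 w / zor_poly D z0 w * D w = N w" if "w \<in> ball z0 (min r1 r2)" for w
      using r1(3)[of w] r2(3)[of w] that s o by auto
  qed
qed (use that in blast)

text \<open>
  Divisibility in the ring of entire functions is a local matter. Away from the zeros of \<open>D\<close> one divides
  \<open>A\<close> by \<open>D\<close>; near a zero of \<open>D\<close> the factor \<open>B\<close> is invertible and \<open>A / D = G / B\<close>.
\<close>

lemma entire_quotient_coprime:
  assumes A: "A holomorphic_on UNIV" and B: "B holomorphic_on UNIV" and G: "G holomorphic_on UNIV"
    and D: "D holomorphic_on UNIV" "D \<xi> \<noteq> 0"
    and eq: "\<And>w. A w * B w = G w * D w" and cop: "\<And>w. \<not> (D w = 0 \<and> B w = 0)"
  obtains F where "F holomorphic_on UNIV" "\<And>w. F w * D w = A w"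
proof (rule entire_quotient[OF D])
  fix z0
  have nbhd: "\<exists>r>0. \<forall>w\<in>ball z0 r. f w \<noteq> 0" if "f holomorphic_on UNIV" "f z0 \<noteq> 0" for f :: "complex \<Rightarrow> complex"
  proof -
    have "isCont f z0"
      using that(1) by (meson UNIV_I continuous_on_eq_continuous_at holomorphic_on_imp_continuous_on open_UNIV)
    then show ?thesis using that(2) continuous_at_avoid[of z0 f 0] by (auto simp: dist_commute)
  qed
  show "\<exists>g r. 0 < r \<and> g holomorphic_on ball z0 r \<and> (\<forall>w\<in>ball z0 r. g w * D w = A w)"
  proof (cases "D z0 = 0")
    case False
    then obtain r where r: "r > 0" "\<And>w. w \<in> ball z0 r \<Longrightarrow> D w \<noteq> 0" using nbhd[OF D(1)] by blast
    have "(\<lambda>w. A w / D w) holomorphic_on ball z0 r"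
      using r by (intro holomorphic_intros holomorphic_on_subset[OF A] holomorphic_on_subset[OF D(1)]) auto
    then show ?thesis using r by (intro exI[of _ "\<lambda>w. A w / D w"] exI[of _ r]) auto
  next
    case True
    then have "B z0 \<noteq> 0" using cop by blast
    then obtain r where r: "r > 0" "\<And>w. w \<in> ball z0 r \<Longrightarrow> B w \<noteq> 0" using nbhd[OF B] by blast
    have "(\<lambda>w. G w / B w) holomorphic_on ball z0 r"
      using r by (intro holomorphic_intros holomorphic_on_subset[OF G] holomorphic_on_subset[OF B]) auto
    moreover have "G w / B w * D w = A w" if "w \<in> ball z0 r" for w
      using eq[of w] r(2)[OF that] by (simp add: field_simps)
    ultimately show ?thesis using r by blast
  qed
qed (use that in blast)

section \<open>Recovering the coefficients from spectral data\<close>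

text \<open>
  The letters recall cosine and sine; \<open>dc\<close> and \<open>ds\<close> are the derivatives in \<open>x\<close>. The first argument of
  each function is \<open>x\<close>, the second one the spectral parameter.
\<close>

definition fundamental_system where
  "fundamental_system L p q c1 dc1 s1 ds1 \<longleftrightarrow>
     (\<forall>\<mu>. solves 0 L (pencil_coeff p q \<mu>) (\<lambda>x. c1 x \<mu>) (\<lambda>x. dc1 x \<mu>) \<and> c1 0 \<mu> = 1 \<and> dc1 0 \<mu> = 0 \<and>
          solves 0 L (pencil_coeff p q \<mu>) (\<lambda>x. s1 x \<mu>) (\<lambda>x. ds1 x \<mu>) \<and> s1 0 \<mu> = 0 \<and> ds1 0 \<mu> = 1) \<and>
     (\<forall>x\<in>{0..L}. c1 x holomorphic_on UNIV \<and> s1 x holomorphic_on UNIV)"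

lemma fundamental_systemD:
  assumes "fundamental_system L p q c1 dc1 s1 ds1"
  shows "solves 0 L (pencil_coeff p q \<mu>) (\<lambda>x. c1 x \<mu>) (\<lambda>x. dc1 x \<mu>)" "c1 0 \<mu> = 1" "dc1 0 \<mu> = 0"
    "solves 0 L (pencil_coeff p q \<mu>) (\<lambda>x. s1 x \<mu>) (\<lambda>x. ds1 x \<mu>)" "s1 0 \<mu> = 0" "ds1 0 \<mu> = 1"
    "x \<in> {0..L} \<Longrightarrow> c1 x holomorphic_on UNIV" "x \<in> {0..L} \<Longrightarrow> s1 x holomorphic_on UNIV"
  using assms unfolding fundamental_system_def by blast+

lemma fundamental_system_exists:
  assumes "0 \<le> L" "p absolutely_integrable_on {0..L}" "q absolutely_integrable_on {0..L}"
  obtains c1 dc1 s1 ds1 where "fundamental_system L p q c1 dc1 s1 ds1"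
proof -
  obtain c1 dc1 where 1: "\<And>\<mu>. solves 0 L (pencil_coeff p q \<mu>) (\<lambda>x. c1 x \<mu>) (\<lambda>x. dc1 x \<mu>)"
    "\<And>\<mu>. c1 0 \<mu> = 1" "\<And>\<mu>. dc1 0 \<mu> = 0" "\<And>x. x \<in> {0..L} \<Longrightarrow> c1 x holomorphic_on UNIV"
    using pencil_family_exists[OF assms, of 1 0] by blast
  obtain s1 ds1 where 2: "\<And>\<mu>. solves 0 L (pencil_coeff p q \<mu>) (\<lambda>x. s1 x \<mu>) (\<lambda>x. ds1 x \<mu>)"
    "\<And>\<mu>. s1 0 \<mu> = 0" "\<And>\<mu>. ds1 0 \<mu> = 1" "\<And>x. x \<in> {0..L} \<Longrightarrow> s1 x holomorphic_on UNIV"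
    using pencil_family_exists[OF assms, of 0 1] by blast
  show ?thesis by (rule that[of c1 dc1 s1 ds1]) (simp add: fundamental_system_def 1 2)
qed

lemma fundamental_system_subinterval:
  assumes "fundamental_system L p q c1 dc1 s1 ds1" "a \<le> L"
  shows "fundamental_system a p q c1 dc1 s1 ds1"
  using assms solves_subinterval[OF _ order_refl assms(2)] unfolding fundamental_system_def by auto

lemma fundamental_system_wronskian:
  assumes "fundamental_system L p q c1 dc1 s1 ds1" "x \<in> {0..L}"
  shows "c1 x \<mu> * ds1 x \<mu> - s1 x \<mu> * dc1 x \<mu> = 1"
  using solves_wronskian_constant[OF fundamental_systemD(1)[OF assms(1)] fundamental_systemD(4)[OF assms(1)] assms(2)]
  by (simp add: fundamental_systemD(2,3,5,6)[OF assms(1)])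

lemma solution_sine_type:
  assumes F: "fundamental_system L p q c1 dc1 s1 ds1"
    and pc: "continuous_on {0..L} p" and q: "q absolutely_integrable_on {0..L}" and x: "0 < x" "x \<le> L"
  shows "sine_type x (integral {0..x} p) (s1 x)"
  unfolding sine_type_def
proof (intro conjI allI impI)
  show "s1 x holomorphic_on UNIV" by (rule fundamental_systemD(8)[OF F]) (use x in auto)
  fix \<eta> :: real assume \<eta>: "\<eta> > 0"
  have L: "0 < L" using x by simp
  show "\<exists>R. \<forall>\<mu>. R \<le> norm \<mu> \<longrightarrow>
      norm (\<mu> * s1 x \<mu> - sin (\<mu> * of_real x - integral {0..x} p)) \<le> \<eta> * growth \<mu> x"
    by (rule sine_type_asymptotics[OF L pc q \<eta>])
      (use fundamental_systemD(4-6)[OF F] x in \<open>meson atLeastAtMost_iff less_imp_le\<close>)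
qed (use x in simp)

lemma forward_solution_bound:
  assumes F: "fundamental_system L p q c1 dc1 s1 ds1" and L: "0 < L"
    and pc: "continuous_on {0..L} p" and q: "q absolutely_integrable_on {0..L}"
  obtains R K where "\<And>\<mu> x. R \<le> norm \<mu> \<Longrightarrow> x \<in> {0..L} \<Longrightarrow> norm (\<mu> * s1 x \<mu>) \<le> K * growth \<mu> x"
  by (rule sine_type_asymptotics[OF L pc q zero_less_one], rule that)
    (use fundamental_systemD(4-6)[OF F] in blast)

text \<open>
  Both sides solve the reflected equation; the Wronskian identity at \<open>L\<close> shows that they have the same
  initial slope. For \<open>L = T\<close> and \<open>x = T - a\<close> the right-hand side is the characteristic function of the
  boundary conditions \<open>y(a) = y(T) = 0\<close>.
\<close>

lemma backward_solution:
  assumes F: "fundamental_system L p q c1 dc1 s1 ds1"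
    and G: "fundamental_system L (\<lambda>x. p (L - x)) (\<lambda>x. q (L - x)) c2 dc2 s2 ds2"
    and p: "p absolutely_integrable_on {0..L}" and q: "q absolutely_integrable_on {0..L}"
    and x: "x \<in> {0..L}"
  shows "s2 x \<mu> = c1 (L - x) \<mu> * s1 L \<mu> - s1 (L - x) \<mu> * c1 L \<mu>"
proof -
  have L: "L \<in> {0..L}" using x by simp
  have "solves (L - L) (L - 0) (\<lambda>x. pencil_coeff p q \<mu> (L - x))
      (\<lambda>x. s1 L \<mu> * c1 (L - x) \<mu> + (- c1 L \<mu>) * s1 (L - x) \<mu>)
      (\<lambda>x. - (s1 L \<mu> * dc1 (L - x) \<mu> + (- c1 L \<mu>) * ds1 (L - x) \<mu>))"
    by (rule solves_reflect[OF solves_combination[OF fundamental_systemD(1)[OF F] fundamental_systemD(4)[OF F]]])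
  then have s: "solves 0 L (pencil_coeff (\<lambda>x. p (L - x)) (\<lambda>x. q (L - x)) \<mu>)
      (\<lambda>x. s1 L \<mu> * c1 (L - x) \<mu> + (- c1 L \<mu>) * s1 (L - x) \<mu>)
      (\<lambda>x. - (s1 L \<mu> * dc1 (L - x) \<mu> + (- c1 L \<mu>) * ds1 (L - x) \<mu>))"
    by (simp add: pencil_coeff_def[abs_def])
  have Q: "pencil_coeff (\<lambda>x. p (L - x)) (\<lambda>x. q (L - x)) \<mu> absolutely_integrable_on {0..L}"
    using absolutely_integrable_reflect_about[OF p, of L] absolutely_integrable_reflect_about[OF q, of L]
    by (intro pencil_coeff_integrable) auto
  have "s2 x \<mu> = s1 L \<mu> * c1 (L - x) \<mu> + (- c1 L \<mu>) * s1 (L - x) \<mu>"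
    by (rule solves_unique(1)[OF Q fundamental_systemD(4)[OF G] s _ _ x])
      (use fundamental_systemD(5,6)[OF G] fundamental_system_wronskian[OF F L, of \<mu>] in \<open>auto simp: algebra_simps\<close>)
  then show ?thesis by (simp add: algebra_simps)
qed

text \<open>
  The solution with data \<open>(0,1)\<close> at \<open>L\<close> is a combination of two solutions that grow from \<open>0\<close> on, and
  the cancellation is visible only after reflection.
\<close>

lemma backward_solution_bound:
  assumes F: "fundamental_system L p q c1 dc1 s1 ds1" and L: "0 < L"
    and pc: "continuous_on {0..L} p" and q: "q absolutely_integrable_on {0..L}"
  obtains R K where "\<And>\<mu> x. R \<le> norm \<mu> \<Longrightarrow> x \<in> {0..L} \<Longrightarrow>
      norm (\<mu> * (c1 L \<mu> * s1 x \<mu> - s1 L \<mu> * c1 x \<mu>)) \<le> K * growth \<mu> (L - x)"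
proof -
  have pr: "continuous_on {0..L} (\<lambda>x. p (L - x))"
    by (rule continuous_on_compose2[OF pc]) (auto intro!: continuous_intros)
  have qr: "(\<lambda>x. q (L - x)) absolutely_integrable_on {0..L}"
    using absolutely_integrable_reflect_about[OF q, of L] by simp
  have p: "p absolutely_integrable_on {0..L}" by (rule absolutely_integrable_continuous_real[OF pc])
  obtain c2 dc2 s2 ds2 where G: "fundamental_system L (\<lambda>x. p (L - x)) (\<lambda>x. q (L - x)) c2 dc2 s2 ds2"
    using fundamental_system_exists[OF less_imp_le[OF L] absolutely_integrable_continuous_real[OF pr] qr] by blast
  obtain R K where R: "\<And>\<mu> x. R \<le> norm \<mu> \<Longrightarrow> x \<in> {0..L} \<Longrightarrow> norm (\<mu> * s2 x \<mu>) \<le> K * growth \<mu> x"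
    using forward_solution_bound[OF G L pr qr] by blast
  show ?thesis
  proof (rule that[of R K])
    fix \<mu> :: complex and x assume \<mu>: "R \<le> norm \<mu>" and x: "x \<in> {0..L}"
    have "s2 (L - x) \<mu> = c1 x \<mu> * s1 L \<mu> - s1 x \<mu> * c1 L \<mu>"
      using backward_solution[OF F G p q, of "L - x"] x by simp
    then have "norm (\<mu> * (c1 L \<mu> * s1 x \<mu> - s1 L \<mu> * c1 x \<mu>)) = norm (\<mu> * s2 (L - x) \<mu>)"
      by (simp add: norm_mult norm_minus_commute mult_ac)
    also have "... \<le> K * growth \<mu> (L - x)" by (rule R[OF \<mu>]) (use x in auto)
    finally show "norm (\<mu> * (c1 L \<mu> * s1 x \<mu> - s1 L \<mu> * c1 x \<mu>)) \<le> K * growth \<mu> (L - x)" .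
  qed
qed

text \<open>
  Write \<open>v\<close>, \<open>u\<close> for the solutions of the two equations with data \<open>(0,1)\<close> at \<open>L\<close>. Expanded in the
  fundamental systems, \<open>v s2 - \<sigma> s1 u\<close> contains the products of \<open>s1\<close> and \<open>s2\<close> only with the factor
  \<open>c1(L) - \<sigma> c2(L)\<close>, which is divisible by \<open>s2(L)\<close>, as are all other terms. The quotient by \<open>s2(L)\<close> is
  entire and small at infinity, because the growth of \<open>v\<close> and \<open>s2\<close> up to \<open>x\<close> and from \<open>x\<close> on adds up
  to that of \<open>s2(L)\<close>.
\<close>

lemma spectral_mapping_vanishes:
  assumes X: "fundamental_system L p q c1 dc1 s1 ds1" and Y: "fundamental_system L p' q' c2 dc2 s2 ds2" and L: "0 < L"
    and pc: "continuous_on {0..L} p" "continuous_on {0..L} p'"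
    and q: "q absolutely_integrable_on {0..L}" "q' absolutely_integrable_on {0..L}"
    and \<sigma>: "\<And>\<mu>. s1 L \<mu> = \<sigma> * s2 L \<mu>"
    and F: "F holomorphic_on UNIV" "\<And>\<mu>. F \<mu> * s2 L \<mu> = c1 L \<mu> - \<sigma> * c2 L \<mu>"
    and x: "x \<in> {0..L}"
  shows "(c1 L \<mu> * s1 x \<mu> - s1 L \<mu> * c1 x \<mu>) * s2 x \<mu> = \<sigma> * s1 x \<mu> * (c2 L \<mu> * s2 x \<mu> - s2 L \<mu> * c2 x \<mu>)"
proof -
  define v where "v = (\<lambda>\<mu>. c1 L \<mu> * s1 x \<mu> - s1 L \<mu> * c1 x \<mu>)"
  define u where "u = (\<lambda>\<mu>. c2 L \<mu> * s2 x \<mu> - s2 L \<mu> * c2 x \<mu>)"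
  define G where "G = (\<lambda>\<mu>. F \<mu> * s1 x \<mu> * s2 x \<mu> + \<sigma> * (s1 x \<mu> * c2 x \<mu> - c1 x \<mu> * s2 x \<mu>))"
  have eq: "G \<mu> * s2 L \<mu> = v \<mu> * s2 x \<mu> - \<sigma> * s1 x \<mu> * u \<mu>" for \<mu>
  proof -
    have "G \<mu> * s2 L \<mu> = (F \<mu> * s2 L \<mu>) * s1 x \<mu> * s2 x \<mu>
        + s2 L \<mu> * \<sigma> * (s1 x \<mu> * c2 x \<mu> - c1 x \<mu> * s2 x \<mu>)"
      by (simp add: G_def algebra_simps)
    also have "... = v \<mu> * s2 x \<mu> - \<sigma> * s1 x \<mu> * u \<mu>"
      unfolding F(2) v_def u_def \<sigma> by (simp add: algebra_simps)
    finally show ?thesis .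
  qed
  have Gh: "G holomorphic_on UNIV"
    unfolding G_def by (intro holomorphic_intros F(1) fundamental_systemD(7,8)[OF X x] fundamental_systemD(7,8)[OF Y x])
  obtain R1 K1 where 1: "\<And>\<mu> x. R1 \<le> norm \<mu> \<Longrightarrow> x \<in> {0..L} \<Longrightarrow> norm (\<mu> * s1 x \<mu>) \<le> K1 * growth \<mu> x"
    using forward_solution_bound[OF X L pc(1) q(1)] by blast
  obtain R2 K2 where 2: "\<And>\<mu> x. R2 \<le> norm \<mu> \<Longrightarrow> x \<in> {0..L} \<Longrightarrow> norm (\<mu> * s2 x \<mu>) \<le> K2 * growth \<mu> x"
    using forward_solution_bound[OF Y L pc(2) q(2)] by blast
  obtain R3 K3 where "\<And>\<mu> x. R3 \<le> norm \<mu> \<Longrightarrow> x \<in> {0..L} \<Longrightarrow>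
      norm (\<mu> * (c1 L \<mu> * s1 x \<mu> - s1 L \<mu> * c1 x \<mu>)) \<le> K3 * growth \<mu> (L - x)"
    using backward_solution_bound[OF X L pc(1) q(1)] by blast
  then have 3: "R3 \<le> norm \<mu> \<Longrightarrow> norm (\<mu> * v \<mu>) \<le> K3 * growth \<mu> (L - x)" for \<mu>
    using x unfolding v_def by blast
  obtain R4 K4 where "\<And>\<mu> x. R4 \<le> norm \<mu> \<Longrightarrow> x \<in> {0..L} \<Longrightarrow>
      norm (\<mu> * (c2 L \<mu> * s2 x \<mu> - s2 L \<mu> * c2 x \<mu>)) \<le> K4 * growth \<mu> (L - x)"
    using backward_solution_bound[OF Y L pc(2) q(2)] by blast
  then have 4: "R4 \<le> norm \<mu> \<Longrightarrow> norm (\<mu> * u \<mu>) \<le> K4 * growth \<mu> (L - x)" for \<mu>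
    using x unfolding u_def by blast
  have "G \<mu> = 0" for \<mu>
  proof (rule sine_type_quotient_zero[OF solution_sine_type[OF Y pc(2) q(2) L order_refl] Gh])
    fix \<mu> :: complex assume R: "max (max R1 R2) (max R3 R4) \<le> norm \<mu>"
    have e: "growth \<mu> (L - x) * growth \<mu> x = growth \<mu> L"
      by (simp add: exp_add[symmetric] algebra_simps)
    have "\<mu>\<^sup>2 * (G \<mu> * s2 L \<mu>) = (\<mu> * v \<mu>) * (\<mu> * s2 x \<mu>) - \<sigma> * ((\<mu> * u \<mu>) * (\<mu> * s1 x \<mu>))"
      unfolding eq by (simp add: algebra_simps power2_eq_square)
    also have "norm ... \<le> norm (\<mu> * v \<mu>) * norm (\<mu> * s2 x \<mu>) + norm \<sigma> * (norm (\<mu> * u \<mu>) * norm (\<mu> * s1 x \<mu>))"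
      using norm_triangle_ineq4 by (metis norm_mult)
    also have "... \<le> (K3 * growth \<mu> (L - x)) * (K2 * growth \<mu> x)
        + norm \<sigma> * ((K4 * growth \<mu> (L - x)) * (K1 * growth \<mu> x))"
      using 1[of \<mu> x] 2[of \<mu> x] 3[of \<mu>] 4[of \<mu>] R x by (intro add_mono mult_mono' mult_left_mono) auto
    also have "... = (K3 * K2 + norm \<sigma> * (K4 * K1)) * growth \<mu> L"
      unfolding e[symmetric] by (simp add: algebra_simps)
    finally show "norm (\<mu>\<^sup>2 * (G \<mu> * s2 L \<mu>)) \<le> (K3 * K2 + norm \<sigma> * (K4 * K1)) * growth \<mu> L" .
  qed
  then show ?thesis using eq[of \<mu>] by (simp add: v_def u_def)
qed

lemma has_vector_derivative_unique_Icc: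
  fixes f :: "real \<Rightarrow> complex"
  assumes "a < b" "x \<in> {a..b}" "\<And>t. t \<in> {a..b} \<Longrightarrow> f t = g t"
    and "(f has_vector_derivative f') (at x within {a..b})" "(g has_vector_derivative g') (at x within {a..b})"
  shows "f' = g'"
proof -
  have "(g has_vector_derivative f') (at x within {a..b})"
    by (rule has_vector_derivative_transform[OF assms(2) _ assms(4)]) (simp add: assms(3))
  then show ?thesis
    using assms vector_derivative_unique_within_closed_interval[of a b x g] by auto
qed

text \<open>
  Equation 1 says \<open>v/A = \<sigma> u/B\<close>, and the derivatives of these quotients are the Wronskians 3 and 4
  divided by \<open>A\<^sup>2\<close> and \<open>B\<^sup>2\<close>. The computation avoids division, since \<open>A\<close> and \<open>B\<close> may vanish.
\<close>

lemma wronskian_elimination: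
  fixes A A' B B' u u' v v' :: complex
  assumes 1: "v * B = \<sigma> * A * u" and 2: "v' * B + v * B' = \<sigma> * (A' * u + A * u')"
    and 3: "A * v' - A' * v = \<sigma> * D" and 4: "B * u' - B' * u = D" and nz: "\<sigma> \<noteq> 0" "D \<noteq> 0"
  shows "A\<^sup>2 = B\<^sup>2"
proof -
  have "B * B * (\<sigma> * D) = B * B * (A * v' - A' * v)" by (simp add: 3)
  also have "... = A * B * (v' * B + v * B') - A * B' * (v * B) - A' * B * (v * B)" by (simp add: algebra_simps)
  also have "... = \<sigma> * A * A * (B * u' - B' * u)" unfolding 1 2 by (simp add: algebra_simps)
  also have "... = A * A * (\<sigma> * D)" by (simp add: 4)
  finally show ?thesis using nz by (simp add: power2_eq_square)
qed

text \<open>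
  From \<open>y\<^sup>2 = u\<^sup>2\<close> follows \<open>y y' = u u'\<close>, hence the Wronskian of \<open>y\<close> and \<open>u\<close> vanishes identically, and so
  does its derivative almost everywhere.
\<close>

lemma squares_agree_imp_coefficients_agree:
  assumes L: "0 < L" and y: "solves 0 L Q y z" and u: "solves 0 L R u w"
    and sq: "\<And>x. x \<in> {0..L} \<Longrightarrow> (y x)\<^sup>2 = (u x)\<^sup>2"
  obtains N where "negligible N" "\<And>x. x \<in> {0<..<L} - N \<Longrightarrow> (R x - Q x) * (y x * u x) = 0"
proof -
  have W: "y x * w x - u x * z x = 0" if x: "x \<in> {0..L}" for x
  proof (cases "y x = 0")
    case True
    then have "u x = 0" using sq[OF x] by simp
    then show ?thesis using True by simp
  next
    case False
    then have ux: "u x \<noteq> 0" using sq[OF x] by auto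
    have "z x * y x + y x * z x = w x * u x + u x * w x"
    proof (rule has_vector_derivative_unique_Icc[OF L x])
      show "y t * y t = u t * u t" if "t \<in> {0..L}" for t using sq[OF that] by (simp add: power2_eq_square)
      show "((\<lambda>t. y t * y t) has_vector_derivative z x * y x + y x * z x) (at x within {0..L})"
        using has_vector_derivative_mult[OF solves_derivative[OF y x] solves_derivative[OF y x]] by (simp add: add.commute)
      show "((\<lambda>t. u t * u t) has_vector_derivative w x * u x + u x * w x) (at x within {0..L})"
        using has_vector_derivative_mult[OF solves_derivative[OF u x] solves_derivative[OF u x]] by (simp add: add.commute)
    qed
    then have yz: "y x * z x = u x * w x" by (simp add: mult.commute)
    have "(y x * w x - u x * z x) * (y x * u x) = (y x)\<^sup>2 * (u x * w x) - (u x)\<^sup>2 * (y x * z x)"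
      by (simp add: algebra_simps power2_eq_square)
    also have "... = 0" by (simp add: sq[OF x] yz)
    finally show ?thesis using False ux by simp
  qed
  have "primitive_on 0 L (\<lambda>x. y x * w x - u x * z x) (\<lambda>x. (R x - Q x) * (y x * u x))"
    by (rule primitive_on_wronskian[OF y u])
  then show ?thesis
    by (rule primitive_on_constant_AE) (use W L that in auto)
qed

text \<open>
  The exceptional null set of the previous lemma depends on \<open>\<mu>\<close>, so only the countably many values
  \<open>\<mu> = i k\<close> are used. For fixed \<open>x\<close> the solutions do not vanish at these values once \<open>k\<close> is large, and two
  consecutive values determine both differences \<open>p' - p\<close> and \<open>q' - q\<close> at \<open>x\<close>.
\<close>

lemma coefficients_determined:
  assumes X: "fundamental_system L p q c1 dc1 s1 ds1" and Y: "fundamental_system L p' q' c2 dc2 s2 ds2" and L: "0 < L"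
    and pc: "continuous_on {0..L} p" "continuous_on {0..L} p'"
    and q: "q absolutely_integrable_on {0..L}" "q' absolutely_integrable_on {0..L}"
    and \<sigma>: "\<And>\<mu>. s1 L \<mu> = \<sigma> * s2 L \<mu>" "\<sigma> \<noteq> 0"
    and F: "F holomorphic_on UNIV" "\<And>\<mu>. F \<mu> * s2 L \<mu> = c1 L \<mu> - \<sigma> * c2 L \<mu>"
  obtains N where "negligible N" "\<And>x. x \<in> {0<..<L} - N \<Longrightarrow> p x = p' x \<and> q x = q' x"
proof -
  have sq: "(s1 x \<mu>)\<^sup>2 = (s2 x \<mu>)\<^sup>2" if x: "x \<in> {0..L}" and D: "s2 L \<mu> \<noteq> 0" for x \<mu>
  proof -
    define v where "v = (\<lambda>x. c1 L \<mu> * s1 x \<mu> + (- s1 L \<mu>) * c1 x \<mu>)"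
    define v' where "v' = (\<lambda>x. c1 L \<mu> * ds1 x \<mu> + (- s1 L \<mu>) * dc1 x \<mu>)"
    define u where "u = (\<lambda>x. c2 L \<mu> * s2 x \<mu> + (- s2 L \<mu>) * c2 x \<mu>)"
    define u' where "u' = (\<lambda>x. c2 L \<mu> * ds2 x \<mu> + (- s2 L \<mu>) * dc2 x \<mu>)"
    have sv: "solves 0 L (pencil_coeff p q \<mu>) v v'"
      unfolding v_def v'_def by (rule solves_combination[OF fundamental_systemD(4)[OF X] fundamental_systemD(1)[OF X]])
    have su: "solves 0 L (pencil_coeff p' q' \<mu>) u u'"
      unfolding u_def u'_def by (rule solves_combination[OF fundamental_systemD(4)[OF Y] fundamental_systemD(1)[OF Y]])
    have eq: "v t * s2 t \<mu> = \<sigma> * s1 t \<mu> * u t" if "t \<in> {0..L}" for t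
      using spectral_mapping_vanishes[OF X Y L pc q \<sigma>(1) F that, of \<mu>] by (simp add: v_def u_def)
    show ?thesis
    proof (rule wronskian_elimination[where v = "v x" and v' = "v' x" and u = "u x" and u' = "u' x"
          and A' = "ds1 x \<mu>" and B' = "ds2 x \<mu>", OF eq[OF x] _ _ _ \<sigma>(2) D])
      show "v' x * s2 x \<mu> + v x * ds2 x \<mu> = \<sigma> * (ds1 x \<mu> * u x + s1 x \<mu> * u' x)"
      proof (rule has_vector_derivative_unique_Icc[OF L x])
        show "v t * s2 t \<mu> = \<sigma> * (s1 t \<mu> * u t)" if "t \<in> {0..L}" for t using eq[OF that] by simp
        show "((\<lambda>t. v t * s2 t \<mu>) has_vector_derivative v' x * s2 x \<mu> + v x * ds2 x \<mu>) (at x within {0..L})"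
          using has_vector_derivative_mult[OF solves_derivative[OF sv x] solves_derivative[OF fundamental_systemD(4)[OF Y] x]]
          by (simp add: add.commute)
        show "((\<lambda>t. \<sigma> * (s1 t \<mu> * u t)) has_vector_derivative \<sigma> * (ds1 x \<mu> * u x + s1 x \<mu> * u' x)) (at x within {0..L})"
          using has_vector_derivative_mult_right[OF has_vector_derivative_mult[OF
                solves_derivative[OF fundamental_systemD(4)[OF X] x] solves_derivative[OF su x]], of \<sigma>]
          by (simp add: add.commute)
      qed
      have "s1 x \<mu> * v' x - ds1 x \<mu> * v x = s1 L \<mu> * (c1 x \<mu> * ds1 x \<mu> - s1 x \<mu> * dc1 x \<mu>)"
        by (simp add: v_def v'_def algebra_simps)
      then show "s1 x \<mu> * v' x - ds1 x \<mu> * v x = \<sigma> * s2 L \<mu>"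
        by (simp add: fundamental_system_wronskian[OF X x] \<sigma>(1))
      have "s2 x \<mu> * u' x - ds2 x \<mu> * u x = s2 L \<mu> * (c2 x \<mu> * ds2 x \<mu> - s2 x \<mu> * dc2 x \<mu>)"
        by (simp add: u_def u'_def algebra_simps)
      then show "s2 x \<mu> * u' x - ds2 x \<mu> * u x = s2 L \<mu>"
        by (simp add: fundamental_system_wronskian[OF Y x])
    qed
  qed
  have "\<exists>N. negligible N \<and> (s2 L \<mu> \<noteq> 0 \<longrightarrow> (\<forall>x\<in>{0<..<L} - N.
      (pencil_coeff p' q' \<mu> x - pencil_coeff p q \<mu> x) * (s1 x \<mu> * s2 x \<mu>) = 0))" for \<mu>
  proof (cases "s2 L \<mu> = 0")
    case False
    then show ?thesis
      using squares_agree_imp_coefficients_agree[OF L fundamental_systemD(4)[OF X] fundamental_systemD(4)[OF Y] sq] by metis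
  qed (use negligible_empty in blast)
  then obtain N where N: "\<And>\<mu>. negligible (N \<mu>)" "\<And>\<mu> x. s2 L \<mu> \<noteq> 0 \<Longrightarrow> x \<in> {0<..<L} - N \<mu> \<Longrightarrow>
      (pencil_coeff p' q' \<mu> x - pencil_coeff p q \<mu> x) * (s1 x \<mu> * s2 x \<mu>) = 0"
    by metis
  define M where "M = (\<Union>k::nat. N (\<i> * of_real (real k)))"
  show ?thesis
  proof (rule that)
    show "negligible M" unfolding M_def by (intro negligible_countable_Union) (use N(1) in auto)
    fix x assume x: "x \<in> {0<..<L} - M"
    have "eventually (\<lambda>k. s2 L (\<i> * of_real (real k)) \<noteq> 0 \<and> s2 x (\<i> * of_real (real k)) \<noteq> 0) sequentially"
      using filterlim_real_sequentially
        eventually_conj[OF sine_type_eventually_nonzero[OF solution_sine_type[OF Y pc(2) q(2) L order_refl]]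
          sine_type_eventually_nonzero[OF solution_sine_type[OF Y pc(2) q(2), of x]]] x
      by (auto simp: filterlim_iff)
    then obtain k0 :: nat where k0: "\<And>k. k \<ge> k0 \<Longrightarrow> s2 L (\<i> * of_real (real k)) \<noteq> 0 \<and> s2 x (\<i> * of_real (real k)) \<noteq> 0"
      unfolding eventually_sequentially by blast
    have lin: "2 * (\<i> * of_real (real k)) * (p' x - p x) + (q' x - q x) = 0" if k: "k \<ge> k0" for k
    proof -
      let ?\<mu> = "\<i> * of_real (real k)"
      have "x \<notin> N ?\<mu>" using x unfolding M_def by blast
      then have "(pencil_coeff p' q' ?\<mu> x - pencil_coeff p q ?\<mu> x) * (s1 x ?\<mu> * s2 x ?\<mu>) = 0"
        using N(2)[of ?\<mu> x] k0[OF k] x by blast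
      moreover have "s1 x ?\<mu> \<noteq> 0" using sq[of x ?\<mu>] k0[OF k] x by auto
      ultimately have "pencil_coeff p' q' ?\<mu> x - pencil_coeff p q ?\<mu> x = 0" using k0[OF k] by auto
      then show ?thesis by (simp add: pencil_coeff_def algebra_simps)
    qed
    have "2 * \<i> * (p' x - p x) = (2 * (\<i> * of_real (real (Suc k0))) * (p' x - p x) + (q' x - q x))
        - (2 * (\<i> * of_real (real k0)) * (p' x - p x) + (q' x - q x))"
      by (simp add: algebra_simps)
    also have "... = 0" using lin[of "Suc k0"] lin[of k0] by (simp only:) simp
    finally have "2 * \<i> * (p' x - p x) = 0" .
    then have "p x = p' x" by simp
    moreover from this have "q x = q' x" using lin[of k0] by simp
    ultimately show "p x = p' x \<and> q x = q' x" ..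
  qed
qed

text \<open>
  Inserting the first two relations into the third one gives
  \<open>(c1(a) - \<sigma> c2(a)) s2(T) = \<sigma> (c1(T) - c2(T)) s2(a)\<close>, and \<open>s2(a)\<close> is coprime to \<open>s2(T)\<close>.
\<close>

lemma left_part_determined:
  assumes X: "fundamental_system T p q c1 dc1 s1 ds1" and Y: "fundamental_system T p' q' c2 dc2 s2 ds2"
    and a: "0 < a" "a < T"
    and pc: "continuous_on {0..T} p" "continuous_on {0..T} p'"
    and q: "q absolutely_integrable_on {0..T}" "q' absolutely_integrable_on {0..T}"
    and \<sigma>: "\<sigma> \<noteq> 0" and D0: "\<And>\<mu>. s1 a \<mu> = \<sigma> * s2 a \<mu>" and D1: "\<And>\<mu>. s1 T \<mu> = s2 T \<mu>"
    and D2: "\<And>\<mu>. c1 a \<mu> * s1 T \<mu> - s1 a \<mu> * c1 T \<mu> = \<sigma> * (c2 a \<mu> * s2 T \<mu> - s2 a \<mu> * c2 T \<mu>)"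
    and cop: "\<And>\<mu>. \<not> (s2 a \<mu> = 0 \<and> s2 T \<mu> = 0)"
  obtains N where "negligible N" "\<And>x. x \<in> {0<..<a} - N \<Longrightarrow> p x = p' x \<and> q x = q' x"
proof -
  have aT: "a \<in> {0..T}" "T \<in> {0..T}" using a by auto
  have qa: "q absolutely_integrable_on {0..a}" "q' absolutely_integrable_on {0..a}"
    using q a by (auto intro: absolutely_integrable_on_subinterval)
  have pa: "continuous_on {0..a} p" "continuous_on {0..a} p'"
    using pc a by (auto intro: continuous_on_subset)
  note Xa = fundamental_system_subinterval[OF X less_imp_le[OF a(2)]]
  note Ya = fundamental_system_subinterval[OF Y less_imp_le[OF a(2)]]
  have "sine_type a (integral {0..a} p') (s2 a)"
    by (rule solution_sine_type[OF Ya pa(2) qa(2) a(1) order_refl])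
  from eventually_happens'[OF trivial_limit_at_top_linorder sine_type_eventually_nonzero[OF this]]
  obtain \<xi> where \<xi>: "s2 a \<xi> \<noteq> 0" by blast
  have A: "(\<lambda>\<mu>. c1 a \<mu> - \<sigma> * c2 a \<mu>) holomorphic_on UNIV"
    by (intro holomorphic_intros fundamental_systemD(7)[OF X aT(1)] fundamental_systemD(7)[OF Y aT(1)])
  have G: "(\<lambda>\<mu>. \<sigma> * (c1 T \<mu> - c2 T \<mu>)) holomorphic_on UNIV"
    by (intro holomorphic_intros fundamental_systemD(7)[OF X aT(2)] fundamental_systemD(7)[OF Y aT(2)])
  obtain F where F: "F holomorphic_on UNIV" "\<And>\<mu>. F \<mu> * s2 a \<mu> = c1 a \<mu> - \<sigma> * c2 a \<mu>"
  proof (rule entire_quotient_coprime[OF A fundamental_systemD(8)[OF Y aT(2)] G fundamental_systemD(8)[OF Y aT(1)] \<xi>])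
    show "(c1 a \<mu> - \<sigma> * c2 a \<mu>) * s2 T \<mu> = \<sigma> * (c1 T \<mu> - c2 T \<mu>) * s2 a \<mu>" for \<mu>
      using D2[of \<mu>] unfolding D0 D1 by (simp add: algebra_simps)
  qed (use cop in auto)
  show ?thesis
    using coefficients_determined[OF Xa Ya a(1) pa qa D0 \<sigma> F] that by blast
qed

section \<open>Characteristic functions and the uniqueness theorem\<close>

lemma abs_continuous_imp_continuous:
  assumes "abs_continuous_on {a..b} F"
  shows "continuous_on {a..b} F"
  unfolding continuous_on_iff
proof (intro ballI allI impI)
  fix x e :: real assume x: "x \<in> {a..b}" and e: "0 < e"
  obtain d where d: "d > 0" "\<And>n u v. short_intervals {a..b} d n u v \<Longrightarrow> (\<Sum>i<n. norm (F (v i) - F (u i))) < e"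
    using assms e unfolding abs_continuous_on_iff by blast
  have step: "norm (F t - F s) < e" if "s \<le> t" "a \<le> s" "t \<le> b" "t - s < d" for s t
    using d(2)[of "Suc 0" "\<lambda>_. s" "\<lambda>_. t"] that by (simp add: short_intervals_def disjoint_family_on_def)
  have "dist (F y) (F x) < e" if "y \<in> {a..b}" "dist y x < d" for y
  proof (cases "x \<le> y")
    case True
    then show ?thesis using step[of x y] that x by (simp add: dist_norm)
  next
    case False
    then show ?thesis using step[of y x] that x by (simp add: dist_norm norm_minus_commute)
  qed
  then show "\<exists>d>0. \<forall>y\<in>{a..b}. dist y x < d \<longrightarrow> dist (F y) (F x) < e" using d(1) by blast
qed

lemma AE_lebesgue_negligibleE:
  assumes "AE x in lebesgue. P x"
  obtains N where "negligible N" "\<And>x. x \<notin> N \<Longrightarrow> P x"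
proof -
  obtain N where "N \<in> null_sets lebesgue" "{x \<in> space lebesgue. \<not> P x} \<subseteq> N"
    using assms unfolding eventually_ae_filter by blast
  then show ?thesis by (intro that[of N]) (auto simp: negligible_iff_null_sets)
qed

lemma AE_lebesgueI_negligible:
  assumes "negligible N" "\<And>x. x \<notin> N \<Longrightarrow> P x"
  shows "AE x in lebesgue. P x"
  by (rule AE_I'[of N]) (use assms in \<open>auto simp: negligible_iff_null_sets\<close>)

lemma deriv_on_eq:
  assumes "0 < T" "x \<in> {0..T}" "(y has_vector_derivative d) (at x within {0..T})"
  shows "deriv_on T y x = d"
  unfolding deriv_on_def by (rule vector_derivative_within_closed_interval[OF assms])

lemma pencil_solution_imp_solves:
  assumes T: "0 < T" and p: "p absolutely_integrable_on {0..T}" and q: "q absolutely_integrable_on {0..T}"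
    and y: "pencil_solution T p q \<mu> y"
  shows "solves 0 T (pencil_coeff p q \<mu>) y (deriv_on T y)"
  unfolding solves_def
proof
  have ac: "abs_continuous_on {0..T} (deriv_on T y)" and diff: "y differentiable_on {0..T}"
    and ae: "AE x in lebesgue. x \<in> {0<..<T} \<longrightarrow> (\<exists>d. (deriv_on T y has_vector_derivative d) (at x) \<and>
             d + (\<mu>\<^sup>2 - 2 * \<mu> * p x - q x) * y x = 0)"
    using y unfolding pencil_solution_def by auto
  show 1: "primitive_on 0 T y (deriv_on T y)"
  proof (rule primitive_on_C1)
    show "(y has_vector_derivative deriv_on T y x) (at x within {0..T})" if "x \<in> {0..T}" for x
      using diff that unfolding deriv_on_def differentiable_on_def by (simp add: vector_derivative_works[symmetric])
    show "continuous_on {0..T} (deriv_on T y)" by (rule abs_continuous_imp_continuous[OF ac])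
  qed
  obtain N where N: "negligible N" "\<And>x. x \<notin> N \<Longrightarrow> x \<in> {0<..<T} \<longrightarrow> (\<exists>d. (deriv_on T y has_vector_derivative d) (at x) \<and>
             d + (\<mu>\<^sup>2 - 2 * \<mu> * p x - q x) * y x = 0)"
    using AE_lebesgue_negligibleE[OF ae] by blast
  have der: "(deriv_on T y has_vector_derivative pencil_coeff p q \<mu> x * y x) (at x)" if x: "x \<notin> N" "x \<in> {0<..<T}" for x
  proof -
    obtain d where d: "(deriv_on T y has_vector_derivative d) (at x)" "d + (\<mu>\<^sup>2 - 2 * \<mu> * p x - q x) * y x = 0"
      using N(2)[OF x(1)] x(2) by blast
    have "d = pencil_coeff p q \<mu> x * y x"
      using d(2) by (simp add: pencil_coeff_def algebra_simps add_eq_0_iff)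
    then show ?thesis using d(1) by simp
  qed
  show "primitive_on 0 T (deriv_on T y) (\<lambda>x. pencil_coeff p q \<mu> x * y x)"
  proof (rule primitive_onI)
    show "(\<lambda>x. pencil_coeff p q \<mu> x * y x) absolutely_integrable_on {0..T}"
      by (rule absolutely_integrable_mult_continuous[OF pencil_coeff_integrable[OF p q] primitive_on_continuous[OF 1]])
    fix x assume x: "x \<in> {0..T}"
    show "((\<lambda>x. pencil_coeff p q \<mu> x * y x) has_integral deriv_on T y x - deriv_on T y 0) {0..x}"
    proof (rule abs_continuous_has_integral[where N = "N \<union> {0,T}"])
      show "abs_continuous_on {0..x} (deriv_on T y)"
        by (rule abs_continuous_on_subset_cong[OF ac _ refl]) (use x in auto)
      show "negligible (N \<union> {0,T})" using N(1) by (simp add: negligible_Un)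
      show "(deriv_on T y has_vector_derivative pencil_coeff p q \<mu> t * y t) (at t within {0..x})"
        if "t \<in> {0..x} - (N \<union> {0,T})" for t
        by (rule has_vector_derivative_at_within[OF der]) (use that x in auto)
    qed (use x in auto)
  qed
qed

lemma solves_imp_pencil_solution:
  assumes T: "0 < T" and s: "solves 0 T (pencil_coeff p q \<mu>) y z"
  shows "pencil_solution T p q \<mu> (restrict y {0..T})" "x \<in> {0..T} \<Longrightarrow> deriv_on T (restrict y {0..T}) x = z x"
proof -
  let ?y = "restrict y {0..T}"
  have der: "(?y has_vector_derivative z x) (at x within {0..T})" if x: "x \<in> {0..T}" for x
    by (rule has_vector_derivative_transform[OF x _ solves_derivative[OF s x]]) simp
  show d: "deriv_on T ?y x = z x" if "x \<in> {0..T}" for x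
    by (rule deriv_on_eq[OF T that der[OF that]])
  have P: "primitive_on 0 T y z" "primitive_on 0 T z (\<lambda>x. pencil_coeff p q \<mu> x * y x)"
    using s by (auto simp: solves_def)
  obtain N where N: "negligible N" "\<And>x. x \<in> {0<..<T} - N \<Longrightarrow> (z has_vector_derivative pencil_coeff p q \<mu> x * y x) (at x)"
    using primitive_ae_derivative[OF P(2)] by blast
  show "pencil_solution T p q \<mu> ?y"
    unfolding pencil_solution_def
  proof (intro conjI)
    show "abs_continuous_on {0..T} ?y"
      by (rule abs_continuous_on_subset_cong[OF primitive_imp_abs_continuous[OF P(1)] order_refl]) simp
    show "?y differentiable_on {0..T}"
      using der unfolding differentiable_on_def by (blast intro: differentiableI_vector)
    show "abs_continuous_on {0..T} (deriv_on T ?y)"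
      by (rule abs_continuous_on_subset_cong[OF primitive_imp_abs_continuous[OF P(2)] order_refl]) (simp add: d)
    show "AE x in lebesgue. x \<in> {0<..<T} \<longrightarrow> (\<exists>e. (deriv_on T ?y has_vector_derivative e) (at x) \<and>
             e + (\<mu>\<^sup>2 - 2 * \<mu> * p x - q x) * ?y x = 0)"
    proof (rule AE_lebesgueI_negligible[OF N(1)], intro impI)
      fix x assume x: "x \<notin> N" "x \<in> {0<..<T}"
      have "(deriv_on T ?y has_vector_derivative pencil_coeff p q \<mu> x * y x) (at x)"
        by (rule has_vector_derivative_transform_within_open[of z _ x "{0<..<T}"])
          (use x N(2) d in auto)
      moreover have "pencil_coeff p q \<mu> x * y x + (\<mu>\<^sup>2 - 2 * \<mu> * p x - q x) * ?y x = 0"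
        using x by (simp add: pencil_coeff_def algebra_simps)
      ultimately show "\<exists>e. (deriv_on T ?y has_vector_derivative e) (at x) \<and>
             e + (\<mu>\<^sup>2 - 2 * \<mu> * p x - q x) * ?y x = 0" by blast
    qed
  qed
qed

text \<open>
  Absolutely continuous solutions in the almost everywhere sense are the same as solutions of the
  integrated equation, for which uniqueness holds by contraction.
\<close>

lemma cauchy_solution_eq:
  assumes T: "0 < T" and p: "p absolutely_integrable_on {0..T}" and q: "q absolutely_integrable_on {0..T}"
    and s: "solves 0 T (pencil_coeff p q \<mu>) y z" and x: "x \<in> {0..T}"
  shows "cauchy_solution T p q (y 0) (z 0) x \<mu> = y x"
proof -
  have "(THE u. pencil_solution T p q \<mu> u \<and> u 0 = y 0 \<and> deriv_on T u 0 = z 0 \<and> u \<in> extensional {0..T}) = restrict y {0..T}"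
  proof (rule the_equality)
    show "pencil_solution T p q \<mu> (restrict y {0..T}) \<and> restrict y {0..T} 0 = y 0 \<and>
        deriv_on T (restrict y {0..T}) 0 = z 0 \<and> restrict y {0..T} \<in> extensional {0..T}"
      using solves_imp_pencil_solution[OF T s] T by simp
    fix u assume u: "pencil_solution T p q \<mu> u \<and> u 0 = y 0 \<and> deriv_on T u 0 = z 0 \<and> u \<in> extensional {0..T}"
    have "solves 0 T (pencil_coeff p q \<mu>) u (deriv_on T u)"
      using u by (intro pencil_solution_imp_solves[OF T p q]) auto
    from solves_unique(1)[OF pencil_coeff_integrable[OF p q] this s] u
    have "u t = y t" if "t \<in> {0..T}" for t using that by auto
    then show "u = restrict y {0..T}"
      using u by (intro extensionalityI[of u "{0..T}"]) auto
  qed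
  then show ?thesis using x by (simp add: cauchy_solution_def)
qed

lemma char_fun_eq:
  assumes T: "0 < T" and p: "p absolutely_integrable_on {0..T}" and q: "q absolutely_integrable_on {0..T}"
    and F: "fundamental_system T p q c1 dc1 s1 ds1" and bc: "b \<in> {0..T}" "c \<in> {0..T}"
  shows "char_fun T p q b c = (\<lambda>\<mu>. c1 b \<mu> * s1 c \<mu> - s1 b \<mu> * c1 c \<mu>)"
proof
  fix \<mu>
  have "X1 T p q x \<mu> = c1 x \<mu>" "X2 T p q x \<mu> = s1 x \<mu>" if "x \<in> {0..T}" for x
    using cauchy_solution_eq[OF T p q fundamental_systemD(1)[OF F] that]
      cauchy_solution_eq[OF T p q fundamental_systemD(4)[OF F] that] fundamental_systemD(2,3,5,6)[OF F] by simp_all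
  then show "char_fun T p q b c \<mu> = c1 b \<mu> * s1 c \<mu> - s1 b \<mu> * c1 c \<mu>"
    using bc by (simp add: char_fun_def)
qed

lemma sine_type_same_spectrum:
  assumes D: "sine_type L c D" and D': "sine_type L c' D'"
    and zeros: "(\<lambda>\<mu>. (\<mu>, zorder D \<mu>)) ` {\<mu>. D \<mu> = 0} = (\<lambda>\<mu>. (\<mu>, zorder D' \<mu>)) ` {\<mu>. D' \<mu> = 0}"
  shows "D \<mu> = exp (\<i> * (c - c')) * D' \<mu>" "D \<mu> = exp (- (\<i> * (c - c'))) * D' \<mu>"
proof -
  obtain \<xi> \<xi>' where nz: "D \<xi> \<noteq> 0" "D' \<xi>' \<noteq> 0"
    using eventually_happens'[OF trivial_limit_at_top_linorder sine_type_eventually_nonzero[OF D]]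
      eventually_happens'[OF trivial_limit_at_top_linorder sine_type_eventually_nonzero[OF D']] by blast
  obtain F where F: "F holomorphic_on UNIV" "\<And>w. F w * D' w = D w"
    using entire_quotient_same_zeros[OF _ nz(1) _ nz(2) zeros] D D' unfolding sine_type_def by blast
  show "D \<mu> = exp (\<i> * (c - c')) * D' \<mu>" "D \<mu> = exp (- (\<i> * (c - c'))) * D' \<mu>"
    using F(2)[of \<mu>] sine_type_ratio[OF D D' F, of \<mu>] by metis+
qed

text \<open>
  The set where two continuous functions differ is open, and a nonempty open set is not negligible.
\<close>

lemma continuous_eq_off_negligible:
  fixes f g :: "real \<Rightarrow> complex"
  assumes c: "continuous_on {a<..<b} f" "continuous_on {a<..<b} g"
    and N: "negligible N" "\<And>x. x \<in> {a<..<b} - N \<Longrightarrow> f x = g x" and x: "x \<in> {a<..<b}"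
  shows "f x = g x"
proof (rule ccontr)
  assume ne: "f x \<noteq> g x"
  define U where "U = {a<..<b} \<inter> (\<lambda>x. f x - g x) -` (- {0})"
  have "open U"
    unfolding U_def by (intro continuous_open_preimage continuous_intros c)
  moreover have "x \<in> U" using x ne by (simp add: U_def)
  moreover have "U \<subseteq> N" using N(2) by (auto simp: U_def)
  ultimately show False
    using open_not_negligible[of U] negligible_subset[OF N(1)] by blast
qed

lemma negligible_reflect:
  fixes N :: "real set"
  assumes "negligible N" shows "negligible ((\<lambda>x. c - x) ` N)"
  using assms
  by (intro negligible_differentiable_image_negligible) (auto intro!: derivative_intros simp: differentiable_on_def)

theorem theorem4:
  fixes T a :: real and p q pt qt :: "real \<Rightarrow> complex"
  assumes "T > 0" and "a \<in> {0<..<T}"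
    and "abs_continuous_on {0..T} p" and "abs_continuous_on {0..T} pt"
    and "q absolutely_integrable_on {0<..<T}" and "qt absolutely_integrable_on {0<..<T}"
    and "integral {0..T} p = integral {0..T} pt"
    and "dirichlet_spectrum T p q 0 a \<inter> dirichlet_spectrum T p q 0 T = {}"
    and "counted_spectrum T p q 0 a = counted_spectrum T pt qt 0 a"
    and "counted_spectrum T p q 0 T = counted_spectrum T pt qt 0 T"
    and "counted_spectrum T p q a T = counted_spectrum T pt qt a T"
  shows "(\<forall>x\<in>{0<..<T}. p x = pt x) \<and>
         (AE x in lebesgue. x \<in> {0<..<T} \<longrightarrow> q x = qt x)"
proof -
  note T = assms(1)
  have a: "0 < a" "a < T" and a0: "0 \<le> T" and aT: "a \<in> {0..T}" "T \<in> {0..T}" "0 \<in> {0..T}" using assms(1,2) by auto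
  have pc: "continuous_on {0..T} p" "continuous_on {0..T} pt"
    using assms(3,4) abs_continuous_imp_continuous by auto
  have p: "p absolutely_integrable_on {0..T}" "pt absolutely_integrable_on {0..T}"
    using pc by (auto intro: absolutely_integrable_continuous_real)
  have q: "q absolutely_integrable_on {0..T}" "qt absolutely_integrable_on {0..T}"
    using assms(5,6) by (auto simp: absolutely_integrable_on_Icc_iff_Ioo)
  define pr where "pr = (\<lambda>x. p (T - x))"
  define qr where "qr = (\<lambda>x. q (T - x))"
  define ptr where "ptr = (\<lambda>x. pt (T - x))"
  define qtr where "qtr = (\<lambda>x. qt (T - x))"
  have pcr: "continuous_on {0..T} pr" "continuous_on {0..T} ptr"
    unfolding pr_def ptr_def
    by (rule continuous_on_compose2[OF pc(1)]; auto intro!: continuous_intros)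
      (rule continuous_on_compose2[OF pc(2)]; auto intro!: continuous_intros)
  have prr: "pr absolutely_integrable_on {0..T}" "ptr absolutely_integrable_on {0..T}"
    using pcr by (auto intro: absolutely_integrable_continuous_real)
  have qrr: "qr absolutely_integrable_on {0..T}" "qtr absolutely_integrable_on {0..T}"
    using absolutely_integrable_reflect_about[OF q(1), of T] absolutely_integrable_reflect_about[OF q(2), of T]
    by (auto simp: qr_def qtr_def)
  \<comment> \<open>Systems 3 and 4 belong to the reflections of systems 1 and 2.\<close>
  obtain c1 dc1 s1 ds1 where F: "fundamental_system T p q c1 dc1 s1 ds1"
    using fundamental_system_exists[OF a0 p(1) q(1)] by blast
  obtain c2 dc2 s2 ds2 where Ft: "fundamental_system T pt qt c2 dc2 s2 ds2"
    using fundamental_system_exists[OF a0 p(2) q(2)] by blast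
  obtain c3 dc3 s3 ds3 where R: "fundamental_system T pr qr c3 dc3 s3 ds3"
    using fundamental_system_exists[OF a0 prr(1) qrr(1)] by blast
  obtain c4 dc4 s4 ds4 where Rt: "fundamental_system T ptr qtr c4 dc4 s4 ds4"
    using fundamental_system_exists[OF a0 prr(2) qrr(2)] by blast
  have bk: "s3 x \<mu> = c1 (T - x) \<mu> * s1 T \<mu> - s1 (T - x) \<mu> * c1 T \<mu>"
    "s4 x \<mu> = c2 (T - x) \<mu> * s2 T \<mu> - s2 (T - x) \<mu> * c2 T \<mu>"
    "s1 x \<mu> = c3 (T - x) \<mu> * s3 T \<mu> - s3 (T - x) \<mu> * c3 T \<mu>"
    "s2 x \<mu> = c4 (T - x) \<mu> * s4 T \<mu> - s4 (T - x) \<mu> * c4 T \<mu>" if "x \<in> {0..T}" for x \<mu>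
    using backward_solution[OF F R[unfolded pr_def qr_def] p(1) q(1) that]
      backward_solution[OF Ft Rt[unfolded ptr_def qtr_def] p(2) q(2) that]
      backward_solution[OF R _ prr(1) qrr(1) that, of c1 dc1 s1 ds1] F
      backward_solution[OF Rt _ prr(2) qrr(2) that, of c2 dc2 s2 ds2] Ft
    by (simp_all add: pr_def qr_def ptr_def qtr_def)
  note I = fundamental_systemD(2,5)[OF F] fundamental_systemD(2,5)[OF Ft] fundamental_systemD(2,5)[OF R] fundamental_systemD(2,5)[OF Rt]
  have s3T: "s3 T \<mu> = s1 T \<mu>" and s4T: "s4 T \<mu> = s2 T \<mu>" for \<mu>
    using bk(1,2)[OF aT(2), of \<mu>] by (simp_all add: I)
  have cf: "char_fun T p q 0 x = s1 x" "char_fun T pt qt 0 x = s2 x" if "x \<in> {0..T}" for x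
    using char_fun_eq[OF T p(1) q(1) F aT(3) that] char_fun_eq[OF T p(2) q(2) Ft aT(3) that] by (simp_all add: I)
  have Ta: "T - a \<in> {0..T}" "0 < T - a" "T - a \<le> T" using a by auto
  have cfa: "char_fun T p q a T = s3 (T - a)" "char_fun T pt qt a T = s4 (T - a)"
    unfolding char_fun_eq[OF T p(1) q(1) F aT(1,2)] char_fun_eq[OF T p(2) q(2) Ft aT(1,2)]
    using bk(1,2)[OF Ta(1)] by (simp_all add: fun_eq_iff)
  define \<delta> where "\<delta> = integral {0..a} p - integral {0..a} pt"
  define \<sigma> where "\<sigma> = exp (\<i> * \<delta>)"
  have right: "integral {0..T - a} (\<lambda>x. f (T - x)) = integral {0..T} f - integral {0..a} f"
    if "f absolutely_integrable_on {0..T}" for f :: "real \<Rightarrow> complex"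
  proof -
    have i: "(f has_integral (integral {0..T} f - integral {0..a} f)) {a..T}"
      using primitive_on_has_integral[OF primitive_on_indefinite[OF that], of a T] a by simp
    have "((\<lambda>x. f (T - x)) has_integral (integral {0..T} f - integral {0..a} f)) {T - T..T - a}"
      by (rule has_integral_reflect_about[OF i])
    then show ?thesis by (simp add: integral_unique)
  qed
  \<comment> \<open>The phases of the characteristic functions differ by \<delta> on [0,a], by 0 on [0,T] and by -\<delta> on [a,T].
    Reading off the last constant on the other half-axis gives the same \<sigma> as for [0,a].\<close>
  have D0: "s1 a \<mu> = \<sigma> * s2 a \<mu>" for \<mu>
    unfolding \<sigma>_def \<delta>_def
    by (rule sine_type_same_spectrum(1)[OF solution_sine_type[OF F pc(1) q(1) a(1) less_imp_le[OF a(2)]]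
            solution_sine_type[OF Ft pc(2) q(2) a(1) less_imp_le[OF a(2)]]])
      (use assms(9) in \<open>simp add: counted_spectrum_def dirichlet_spectrum_def cf[OF aT(1)]\<close>)
  have D1: "s1 T \<mu> = s2 T \<mu>" for \<mu>
    using sine_type_same_spectrum(1)[OF solution_sine_type[OF F pc(1) q(1) T order_refl]
            solution_sine_type[OF Ft pc(2) q(2) T order_refl], of \<mu>] assms(7,10)
    by (simp add: counted_spectrum_def dirichlet_spectrum_def cf[OF aT(2)])
  have D2: "s3 (T - a) \<mu> = \<sigma> * s4 (T - a) \<mu>" for \<mu>
  proof -
    have "s3 (T - a) \<mu> = exp (- (\<i> * (integral {0..T - a} pr - integral {0..T - a} ptr))) * s4 (T - a) \<mu>"
      by (rule sine_type_same_spectrum(2)[OF solution_sine_type[OF R pcr(1) qrr(1) Ta(2,3)]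
            solution_sine_type[OF Rt pcr(2) qrr(2) Ta(2,3)]])
      (use assms(11) in \<open>simp add: counted_spectrum_def dirichlet_spectrum_def cfa\<close>)
    also have "- (\<i> * (integral {0..T - a} pr - integral {0..T - a} ptr)) = \<i> * \<delta>"
      unfolding pr_def ptr_def right[OF p(1)] right[OF p(2)] assms(7) \<delta>_def by (simp add: algebra_simps)
    finally show ?thesis by (simp add: \<sigma>_def)
  qed
  have \<sigma>: "\<sigma> \<noteq> 0" by (simp add: \<sigma>_def)
  have cop: "\<not> (s2 a \<mu> = 0 \<and> s2 T \<mu> = 0)" for \<mu>
    using assms(8) D0[of \<mu>] D1[of \<mu>] by (auto simp: dirichlet_spectrum_def cf[OF aT(1)] cf[OF aT(2)])
  \<comment> \<open>The hypothesis of the reflected problem, by the Wronskian identity at T.\<close>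
  have copr: "\<not> (s4 (T - a) \<mu> = 0 \<and> s4 T \<mu> = 0)" for \<mu>
  proof
    assume z: "s4 (T - a) \<mu> = 0 \<and> s4 T \<mu> = 0"
    then have "s2 T \<mu> = 0" using s4T by simp
    moreover from this have "s2 a \<mu> * c2 T \<mu> = 0" using bk(2)[OF Ta(1), of \<mu>] z by simp
    moreover have "c2 T \<mu> \<noteq> 0" using fundamental_system_wronskian[OF Ft aT(2), of \<mu>] \<open>s2 T \<mu> = 0\<close> by auto
    ultimately show False using cop by auto
  qed
  obtain N1 where N1: "negligible N1" "\<And>x. x \<in> {0<..<a} - N1 \<Longrightarrow> p x = pt x \<and> q x = qt x"
  proof (rule left_part_determined[OF F Ft a pc q \<sigma> D0 D1 _ cop])
    show "c1 a \<mu> * s1 T \<mu> - s1 a \<mu> * c1 T \<mu> = \<sigma> * (c2 a \<mu> * s2 T \<mu> - s2 a \<mu> * c2 T \<mu>)" for \<mu>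
      using D2[of \<mu>] bk(1,2)[OF Ta(1), of \<mu>] by simp
  qed (use that in blast)
  have "T - a < T" using a by simp
  then obtain N2 where N2: "negligible N2" "\<And>x. x \<in> {0<..<T - a} - N2 \<Longrightarrow> pr x = ptr x \<and> qr x = qtr x"
  proof (rule left_part_determined[OF R Rt Ta(2) _ pcr qrr \<sigma> D2 _ _ copr])
    show "s3 T \<mu> = s4 T \<mu>" for \<mu> by (simp add: s3T s4T D1)
    show "c3 (T - a) \<mu> * s3 T \<mu> - s3 (T - a) \<mu> * c3 T \<mu> = \<sigma> * (c4 (T - a) \<mu> * s4 T \<mu> - s4 (T - a) \<mu> * c4 T \<mu>)" for \<mu>
      using D0[of \<mu>] bk(3,4)[OF aT(1), of \<mu>] by simp
  qed (use that in blast)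
  define N where "N = N1 \<union> (\<lambda>x. T - x) ` N2 \<union> {a}"
  have N: "negligible N" using N1(1) negligible_reflect[OF N2(1), of T] by (simp add: N_def negligible_Un)
  have eq: "p x = pt x \<and> q x = qt x" if x: "x \<in> {0<..<T} - N" for x
  proof (cases "x < a")
    case True
    then show ?thesis using N1(2)[of x] x by (simp add: N_def)
  next
    case False
    have "x \<noteq> a" using x by (auto simp: N_def)
    moreover have "T - x \<notin> N2" using x by (auto simp: N_def image_iff dest: bspec[where x = "T - x"])
    ultimately show ?thesis using N2(2)[of "T - x"] x False by (simp add: pr_def ptr_def qr_def qtr_def)
  qed
  have "p x = pt x" if "x \<in> {0<..<T}" for x
    by (rule continuous_eq_off_negligible[OF _ _ N _ that])
      (use pc eq in \<open>auto intro: continuous_on_subset\<close>)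
  moreover have "AE x in lebesgue. x \<in> {0<..<T} \<longrightarrow> q x = qt x"
    by (rule AE_lebesgueI_negligible[OF N]) (use eq in blast)
  ultimately show ?thesis by blast
qed
end
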